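(* For all $1\le p\le 2$, and for all $q\ge 1$, $\Upsilon_{p,q}$ and $\Psi_{p,q}$ are convex on $\mathbf{H}_n^+$ and $\mathbf{H}_{mn}^+$ respectively, while $\Phi_{p,q}$ is jointly convex on $(\mathbf{H}_n^+)^m$. For $0<p\le q\le 1$, $\Upsilon_{p,q}$ and $\Psi_{p,q}$ are concave on $\mathbf{H}_n^+$ and $\mathbf{H}_{mn}^+$ respectively, while $\Phi_{p,q}$ is jointly concave on $(\mathbf{H}_n^+)^m$. For $p>2$, none of these functions are convex or concave for any values of $q\neq p$.
   Context: Let $m$ and $n$ be any positive integers. $\mathbf{M}_n$ denotes the set of $n\times n$ complex matrices and $\mathbf{H}_n^+$ the set of $n\times n$ positive semidefinite (Hermitian) matrices. For $q>0$ and $A\in\mathbf{M}_n$, $\|A\|_q=\left(\mathrm{Tr}[(A^*A)^{q/2}]\right)^{1/q}$ (this notation is used also for $q<1$, when it is not a norm). Powers of positive semidefinite matrices are defined by functional calculus. Operators on $\mathbb{C}^m\otimes\mathbb{C}^n$ are identified with $mn\times mn$ matrices; for such an $A$, the partial trace $\mathrm{Tr}_2A$ is the $m\times m$ matrix with $\mathrm{Tr}[(\mathrm{Tr}_2A)C]=\mathrm{Tr}[A(C\otimes I_{n\times n})]$ for all $m\times m$ matrices $C$. For any numbers $p,q>0$ define: - $\Phi_{p,q}(A_1,\dots,A_m)=\left\|\left(\sum_{j=1}^m A_j^p\right)^{1/p}\right\|_q$ for $A_1,\dots,A_m\in\mathbf{H}_n^+$; - $\Psi_{p,q}(A)=\left\|\left(\mathrm{Tr}_2A^p\right)^{1/p}\right\|_q$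 for $A\in\mathbf{H}_{mn}^+$, regarded as an operator on $\mathbb{C}^m\otimes\mathbb{C}^n$; - for any fixed $B\in\mathbf{M}_n$, $\Upsilon_{p,q}(A)=\mathrm{Tr}\left[(B^*A^pB)^{q/p}\right]$ for $A\in\mathbf{H}_n^+$. "Jointly convex (concave)" means convex (concave) as a function of the tuple $(A_1,\dots,A_m)$.
   Formalization: The last claim fails literally for m=1 or n=1 (e.g. Φ is then a norm for q≥1) and for B=I (Υ=Tr A^q); it is stated for all m,n≥2 for Φ and Ψ, and for Υ as: for every n≥2 some B makes Υ neither convex nor concave. *)

theory Defs
  imports "HOL-Analysis.Analysis"
begin

definition adj :: "complex^'m^'n \<Rightarrow> complex^'n^'m" where
  "adj A = transpose (map_matrix cnj A)"

definition unitary :: "complex^'n^'n \<Rightarrow> bool" where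
  "unitary U \<longleftrightarrow> adj U ** U = mat 1 \<and> U ** adj U = mat 1"

definition diag_real :: "('n \<Rightarrow> real) \<Rightarrow> complex^'n^'n" where
  "diag_real d = (\<chi> i j. if i = j then complex_of_real (d i) else 0)"

definition hermitian :: "complex^'n^'n \<Rightarrow> bool" where
  "hermitian A \<longleftrightarrow> adj A = A"

(* For Hermitian A the sum, i.e. the sesquilinear form (x, A x), is automatically real. *)
definition psd :: "(complex^'n^'n) set" where
  "psd = {A. hermitian A \<and> (\<forall>x. 0 \<le> Re (\<Sum>i\<in>UNIV. cnj (x $ i) * (A *v x) $ i))}"

definition psd_tuples :: "(complex^'n^'n^'m) set" where
  "psd_tuples = {A. \<forall>j. A $ j \<in> psd}"

(* Functional calculus: if A = U diag(d) U* with U unitary and d real, then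
   f(A) = U diag(f(d)) U*.  The result does not depend on the chosen diagonalisation
   (fun_calc_diag below); matrices that are not Hermitian get an unspecified value. *)
definition fun_calc :: "(real \<Rightarrow> real) \<Rightarrow> complex^'n^'n \<Rightarrow> complex^'n^'n" where
  "fun_calc f A = (THE F. \<exists>U d. unitary U \<and> A = U ** diag_real d ** adj U
                             \<and> F = U ** diag_real (\<lambda>i. f (d i)) ** adj U)"

(* Only used with p > 0 and A positive semidefinite; note that 0 powr p = 0. *)
definition mpow :: "complex^'n^'n \<Rightarrow> real \<Rightarrow> complex^'n^'n" where
  "mpow A p = fun_calc (\<lambda>t. t powr p) A"

(* Traces of positive semidefinite matrices are real, so Re here, and in Upsilon below,
   only converts the type. *)
definition schatten :: "real \<Rightarrow> complex^'n^'n \<Rightarrow> real" where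
  "schatten q A = (Re (trace (mpow (adj A ** A) (q / 2)))) powr (1 / q)"

(* Operators on the tensor product of C^m and C^n are matrices indexed by pairs. *)
definition kron :: "complex^'m^'m \<Rightarrow> complex^'n^'n \<Rightarrow> complex^('m \<times> 'n::finite)^('m \<times> 'n)" where
  "kron C D = (\<chi> a b. C $ fst a $ fst b * D $ snd a $ snd b)"

definition ptrace2 :: "complex^('m::finite \<times> 'n::finite)^('m \<times> 'n) \<Rightarrow> complex^'m^'m" where
  "ptrace2 A = (THE T. \<forall>C. trace (T ** C) = trace (A ** kron C (mat 1)))"

definition Phi :: "real \<Rightarrow> real \<Rightarrow> complex^'n^'n^'m \<Rightarrow> real" where
  "Phi p q A = schatten q (mpow (\<Sum>j\<in>UNIV. mpow (A $ j) p) (1 / p))"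

definition Psi :: "real \<Rightarrow> real \<Rightarrow> complex^('m::finite \<times> 'n::finite)^('m \<times> 'n) \<Rightarrow> real" where
  "Psi p q A = schatten q (mpow (ptrace2 (mpow A p)) (1 / p))"

definition Upsilon :: "complex^'n^'n \<Rightarrow> real \<Rightarrow> real \<Rightarrow> complex^'n^'n \<Rightarrow> real" where
  "Upsilon B p q A = Re (trace (mpow (adj B ** mpow A p ** B) (q / p)))"


lemma diag_mult_left: "(diag_real d ** W) $ i $ j = complex_of_real (d i) * W $ i $ j"
proof -
  have "(diag_real d ** W) $ i $ j
      = (\<Sum>k\<in>UNIV. if i = k then complex_of_real (d i) * W $ k $ j else 0)"
    unfolding matrix_matrix_mult_def diag_real_def vec_lambda_beta
    by (rule sum.cong) simp_all
  then show ?thesis by simp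
qed

lemma diag_mult_right: "(W ** diag_real d) $ i $ j = W $ i $ j * complex_of_real (d j)"
proof -
  have "(W ** diag_real d) $ i $ j
      = (\<Sum>k\<in>UNIV. if k = j then W $ i $ k * complex_of_real (d j) else 0)"
    unfolding matrix_matrix_mult_def diag_real_def vec_lambda_beta
    by (rule sum.cong) simp_all
  then show ?thesis by simp
qed

lemma fun_calc_unique:
  assumes U: "unitary U" and V: "unitary V"
    and eq: "U ** diag_real d ** adj U = V ** diag_real e ** adj V"
  shows "U ** diag_real (\<lambda>i. f (d i)) ** adj U = V ** diag_real (\<lambda>i. f (e i)) ** adj V"
proof -
  define W where "W = adj V ** U"
  have "adj V ** (U ** diag_real d ** adj U) ** U = adj V ** (V ** diag_real e ** adj V) ** U"
    using eq by simp
  moreover have "adj V ** (U ** diag_real d ** adj U) ** U = W ** diag_real d ** (adj U ** U)"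
    unfolding W_def by (simp add: matrix_mul_assoc)
  moreover have "adj V ** (V ** diag_real e ** adj V) ** U = (adj V ** V) ** diag_real e ** W"
    unfolding W_def by (simp add: matrix_mul_assoc)
  ultimately have WD: "W ** diag_real d = diag_real e ** W"
    using U V by (simp add: unitary_def)
  have "W $ i $ j * complex_of_real (f (d j)) = complex_of_real (f (e i)) * W $ i $ j" for i j
  proof -
    have "W $ i $ j * complex_of_real (d j) = complex_of_real (e i) * W $ i $ j"
      using WD diag_mult_left[of e W i j] diag_mult_right[of W d i j] by metis
    then show ?thesis by (cases "W $ i $ j = 0") auto
  qed
  then have Wf: "W ** diag_real (\<lambda>i. f (d i)) = diag_real (\<lambda>i. f (e i)) ** W"
    by (simp add: vec_eq_iff diag_mult_left diag_mult_right)
  have "V ** (W ** diag_real (\<lambda>i. f (d i))) ** adj U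
      = V ** (diag_real (\<lambda>i. f (e i)) ** W) ** adj U"
    using Wf by simp
  moreover have "V ** (W ** diag_real (\<lambda>i. f (d i))) ** adj U
      = (V ** adj V) ** U ** diag_real (\<lambda>i. f (d i)) ** adj U"
    unfolding W_def by (simp add: matrix_mul_assoc)
  moreover have "V ** (diag_real (\<lambda>i. f (e i)) ** W) ** adj U
      = V ** diag_real (\<lambda>i. f (e i)) ** adj V ** (U ** adj U)"
    unfolding W_def by (simp add: matrix_mul_assoc)
  ultimately show ?thesis using U V by (simp add: unitary_def)
qed

lemma fun_calc_diag:
  assumes "unitary U"
  shows "fun_calc f (U ** diag_real d ** adj U) = U ** diag_real (\<lambda>i. f (d i)) ** adj U"
  unfolding fun_calc_def
proof (rule the_equality)
  show "\<exists>Ua da. unitary Ua \<and> U ** diag_real d ** adj U = Ua ** diag_real da ** adj Ua \<and>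
        U ** diag_real (\<lambda>i. f (d i)) ** adj U = Ua ** diag_real (\<lambda>i. f (da i)) ** adj Ua"
    using assms by blast
next
  fix F
  assume "\<exists>Ua da. unitary Ua \<and> U ** diag_real d ** adj U = Ua ** diag_real da ** adj Ua \<and>
        F = Ua ** diag_real (\<lambda>i. f (da i)) ** adj Ua"
  then show "F = U ** diag_real (\<lambda>i. f (d i)) ** adj U"
    using fun_calc_unique[OF assms] by metis
qed

lemma trace_mult_eq:
  "trace (A ** B) = (\<Sum>i\<in>UNIV. \<Sum>j\<in>UNIV. A $ i $ j * B $ j $ i)"
  by (simp add: trace_def matrix_matrix_mult_def)

lemma trace_kron_mat1:
  "trace (A ** kron C (mat 1)) = trace ((\<chi> i j. \<Sum>k\<in>UNIV. A $ (i, k) $ (j, k)) ** C)"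
proof -
  have pairs: "(\<Sum>a\<in>UNIV. f a) = (\<Sum>i\<in>UNIV. \<Sum>k\<in>UNIV. f (i, k))"
    for f :: "'a::finite \<times> 'b::finite \<Rightarrow> complex"
    by (simp add: UNIV_Times_UNIV[symmetric] sum.cartesian_product del: UNIV_Times_UNIV)
  have "trace (A ** kron C (mat 1))
      = (\<Sum>i\<in>UNIV. \<Sum>k\<in>UNIV. \<Sum>j\<in>UNIV. \<Sum>l\<in>UNIV.
           if l = k then A $ (i, k) $ (j, l) * C $ j $ i else 0)"
    unfolding trace_mult_eq pairs by (intro sum.cong refl) (simp add: kron_def mat_def)
  also have "\<dots> = (\<Sum>i\<in>UNIV. \<Sum>k\<in>UNIV. \<Sum>j\<in>UNIV. A $ (i, k) $ (j, k) * C $ j $ i)"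
    by simp
  also have "\<dots> = (\<Sum>i\<in>UNIV. \<Sum>j\<in>UNIV. \<Sum>k\<in>UNIV. A $ (i, k) $ (j, k) * C $ j $ i)"
    by (intro sum.cong refl sum.swap)
  finally show ?thesis
    by (simp add: trace_mult_eq sum_distrib_right)
qed

lemma trace_mult_unique:
  fixes S T :: "complex^'n^'n"
  assumes "\<And>C. trace (S ** C) = trace (T ** C)"
  shows "S = T"
proof -
  have "S $ a $ b = T $ a $ b" for a b
  proof -
    define E :: "complex^'n^'n" where "E = (\<chi> i j. if i = b \<and> j = a then 1 else 0)"
    have "trace (M ** E) = M $ a $ b" for M :: "complex^'n^'n"
    proof -
      have "trace (M ** E)
          = (\<Sum>i\<in>UNIV. \<Sum>j\<in>UNIV. if j = b then (if i = a then M $ i $ j else 0) else 0)"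
        unfolding trace_mult_eq E_def by (intro sum.cong refl) simp
      then show ?thesis by simp
    qed
    then show ?thesis using assms[of E] by simp
  qed
  then show ?thesis by (simp add: vec_eq_iff)
qed

lemma ptrace2_eq: "ptrace2 A = (\<chi> i j. \<Sum>k\<in>UNIV. A $ (i, k) $ (j, k))"
  unfolding ptrace2_def trace_kron_mat1
  by (rule the_equality) (auto intro: trace_mult_unique)

(* convex_on and concave_on include convexity of the domain; by the next two lemmas their
   negations are statements about the functions alone. *)
lemma convex_psd: "convex psd"
proof (rule convexI)
  fix A B :: "complex^'n^'n" and u v :: real
  assume A: "A \<in> psd" and B: "B \<in> psd" and uv: "0 \<le> u" "0 \<le> v"
  have "adj (u *\<^sub>R A + v *\<^sub>R B) = u *\<^sub>R adj A + v *\<^sub>R adj B"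
    by (simp add: adj_def transpose_def map_matrix_def vec_eq_iff)
  then have h: "hermitian (u *\<^sub>R A + v *\<^sub>R B)"
    using A B by (simp add: psd_def hermitian_def)
  have "0 \<le> Re (\<Sum>i\<in>UNIV. cnj (x $ i) * ((u *\<^sub>R A + v *\<^sub>R B) *v x) $ i)" for x
  proof -
    have "((u *\<^sub>R A + v *\<^sub>R B) *v x) $ i = u *\<^sub>R (A *v x) $ i + v *\<^sub>R (B *v x) $ i" for i
      by (simp add: matrix_vector_mult_def sum.distrib algebra_simps scaleR_sum_right)
    then have "Re (\<Sum>i\<in>UNIV. cnj (x $ i) * ((u *\<^sub>R A + v *\<^sub>R B) *v x) $ i)
        = u * Re (\<Sum>i\<in>UNIV. cnj (x $ i) * (A *v x) $ i)
        + v * Re (\<Sum>i\<in>UNIV. cnj (x $ i) * (B *v x) $ i)"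
      by (simp add: sum.distrib sum_distrib_left algebra_simps)
    then show ?thesis
      using A B uv by (simp add: psd_def)
  qed
  with h show "u *\<^sub>R A + v *\<^sub>R B \<in> psd" by (simp add: psd_def)
qed

lemma convex_psd_tuples: "convex psd_tuples"
proof (rule convexI)
  fix A B :: "complex^'n^'n^'m" and u v :: real
  assume "A \<in> psd_tuples" "B \<in> psd_tuples" "0 \<le> u" "0 \<le> v" "u + v = 1"
  then show "u *\<^sub>R A + v *\<^sub>R B \<in> psd_tuples"
    unfolding psd_tuples_def by (auto intro!: convexD[OF convex_psd])
qed

end

theory Submission
  imports Defs
begin

text \<open>
  Everything rests on the trace \<open>Tr (K* A\<^sup>s K X\<^sup>t)\<close>. In eigenbases of \<open>A\<close> and \<open>X\<close> it is a diagonal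
  quadratic form in \<open>K\<close> with coefficients \<open>a\<^sub>i\<^sup>s x\<^sub>j\<^sup>t\<close>. Joint concavity in \<open>(A, X)\<close> holds for the
  coefficients \<open>a\<^sub>i\<close>, \<open>x\<^sub>j\<close> and \<open>1\<close>, and it is inherited by parallel sums, since these are infima
  over decompositions of \<open>K\<close>; hence by geometric means, which are limits of arithmetic-harmonic
  means; hence by all \<open>a\<^sup>s x\<^sup>t\<close> with \<open>s + t \<le> 1\<close> (Lieb). Joint convexity of \<open>a\<^sup>p x\<^sup>-\<^sup>t\<close> for \<open>p \<le> 2\<close>,
  \<open>t \<le> p - 1\<close> (Ando) follows by writing the form as a supremum. The power \<open>q/p\<close> of
  \<open>Y = \<Sum> K\<^sub>j* A\<^sub>j\<^sup>p K\<^sub>j\<close> is then linearised by Young's inequality,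
  \<open>Tr Y\<^sup>r = sup r Tr (Y X\<^sup>1\<^sup>-\<^sup>1\<^sup>/\<^sup>r) - (r - 1) Tr X\<close> for \<open>r \<ge> 1\<close>, and an infimum for \<open>r < 1\<close>. The
  three functions are such traces, or roots of them that are homogeneous of degree one.

  For \<open>p > 2\<close> the map \<open>A \<mapsto> \<langle>e, A\<^sup>p e\<rangle>\<^sup>1\<^sup>/\<^sup>p\<close> already fails to be subadditive on \<open>2 \<times> 2\<close> matrices. This
  gives the counterexample for \<open>Upsilon\<close>, and it survives in the first-order expansion of \<open>Phi\<close>
  around a tuple with one dominant entry.
\<close>

section \<open>Matrices and the spectral theorem\<close>

text \<open>The obstacle is noncommutativity: a convex combination and its two ends have three
  unrelated eigenbases, so comparing coefficients pointwise says nothing about the traces. All that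
  the three quadratic forms share is the matrix \<open>K\<close> at which they are evaluated. The
  basic operations on coefficients are therefore described by an optimisation over matrices of the
  shape of \<open>K\<close>: the optimiser is chosen for the combination and inserted at the two
  ends, where it is merely admissible. The exponent 2 is critical for the following reason. If
  \<open>C e = 0\<close>, then \<open>A e = (A + C) e\<close>, so the spectral measures of
  \<open>A\<close> and \<open>A + C\<close> at \<open>e\<close> have the same moments of order 0, 1
  and 2. What separates them is governed by the third derivative of \<open>x powr p\<close>, whose
  sign for p > 1 is that of p - 2. \<open>Psi\<close> inherits the failure from \<open>Phi\<close>,
  which sits inside it on block diagonal matrices.\<close>

lemma adj_nth [simp]: "adj A $ i $ j = cnj (A $ j $ i)"
  by (simp add: adj_def transpose_def map_matrix_def)

lemma adj_mult: "adj (A ** B) = adj B ** adj A"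
  by (simp add: vec_eq_iff matrix_matrix_mult_def mult.commute)

lemma adj_adj [simp]: "adj (adj A) = A"
  by (simp add: vec_eq_iff)

lemma adj_mat_1 [simp]: "adj (mat 1) = mat 1"
  by (simp add: vec_eq_iff mat_def)

lemma adj_diag_real [simp]: "adj (diag_real d) = diag_real d"
  by (simp add: vec_eq_iff diag_real_def)

lemma diag_real_mult: "diag_real d ** diag_real e = diag_real (\<lambda>i. d i * e i)"
  by (simp add: vec_eq_iff diag_mult_left) (simp add: diag_real_def)

lemma diag_real_1 [simp]: "diag_real (\<lambda>_. 1) = mat 1"
  by (simp add: vec_eq_iff diag_real_def mat_def)

lemma diag_real_add: "diag_real d + diag_real e = diag_real (\<lambda>i. d i + e i)"
  by (simp add: vec_eq_iff diag_real_def)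

lemma diag_real_scaleR: "c *\<^sub>R diag_real d = diag_real (\<lambda>i. c * d i)"
  by (simp add: vec_eq_iff diag_real_def) (simp add: scaleR_conv_of_real)

lemma matrix_scaleR_left: "(c *\<^sub>R A) ** B = c *\<^sub>R (A ** B)" for A :: "complex^'k^'n" and B :: "complex^'m^'k"
  by (simp add: vec_eq_iff matrix_matrix_mult_def scaleR_sum_right)

lemma matrix_scaleR_right: "A ** (c *\<^sub>R B) = c *\<^sub>R (A ** B)" for A :: "complex^'k^'n" and B :: "complex^'m^'k"
  by (simp add: vec_eq_iff matrix_matrix_mult_def scaleR_sum_right)

lemma matrix_add_right: "A ** (B + C) = A ** B + A ** C"
  for A :: "complex^'k^'n" and B C :: "complex^'m^'k"
  by (simp add: vec_eq_iff matrix_matrix_mult_def sum.distrib algebra_simps)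

lemma matrix_add_left: "(A + B) ** C = A ** C + B ** C"
  for A B :: "complex^'k^'n" and C :: "complex^'m^'k"
  by (simp add: vec_eq_iff matrix_matrix_mult_def sum.distrib algebra_simps)

lemma matrix_sum_left: "(\<Sum>j\<in>J. A j) ** B = (\<Sum>j\<in>J. A j ** B)"
  for A :: "'j \<Rightarrow> complex^'k^'n" and B :: "complex^'m^'k"
  by (induction J rule: infinite_finite_induct) (simp_all add: matrix_add_left)

lemma trace_mult_comm: "trace (A ** B) = trace (B ** A)"
  for A :: "complex^'m^'n" and B :: "complex^'n^'m"
  unfolding trace_mult_eq by (subst sum.swap) (simp add: mult.commute)

lemma trace_scaleR: "trace (c *\<^sub>R A) = c *\<^sub>R trace A" for A :: "complex^'n^'n"
  by (simp add: trace_def scaleR_sum_right)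

lemma trace_sum: "trace (\<Sum>j\<in>J. A j) = (\<Sum>j\<in>J. trace (A j))" for A :: "'j \<Rightarrow> complex^'n^'n"
  by (induction J rule: infinite_finite_induct) (simp_all add: trace_add, simp_all add: trace_def)

lemma trace_diag_real: "trace (diag_real d) = of_real (\<Sum>i\<in>UNIV. d i)"
  by (simp add: trace_def diag_real_def)

definition cdot :: "complex^'n \<Rightarrow> complex^'n \<Rightarrow> complex" where
  "cdot x y = (\<Sum>i\<in>UNIV. cnj (x $ i) * y $ i)"

lemma Re_cdot: "Re (cdot x y) = inner x y"
  by (simp add: cdot_def inner_vec_def inner_complex_def)

lemma cdot_adj: "cdot (adj A *v x) y = cdot x (A *v y)"
proof -
  have "cdot (adj A *v x) y = (\<Sum>i\<in>UNIV. \<Sum>k\<in>UNIV. A $ k $ i * cnj (x $ k) * y $ i)"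
    by (simp add: cdot_def matrix_vector_mult_def sum_distrib_right)
  also have "\<dots> = cdot x (A *v y)"
    by (subst sum.swap) (simp add: cdot_def matrix_vector_mult_def sum_distrib_left mult_ac)
  finally show ?thesis .
qed

lemma cdot_add_right: "cdot x (y + z) = cdot x y + cdot x z"
  by (simp add: cdot_def sum.distrib algebra_simps)

lemma cdot_scaleR_right: "cdot x (c *\<^sub>R y) = c *\<^sub>R cdot x y"
  by (simp add: cdot_def scaleR_sum_right)

lemma cdot_scaleR_left: "cdot (c *\<^sub>R x) y = c *\<^sub>R cdot x y"
  by (simp add: cdot_def scaleR_sum_right)

lemma cdot_commute: "cdot y x = cnj (cdot x y)"
  by (simp add: cdot_def mult.commute)

lemma cdot_self: "cdot x x = of_real ((norm x)\<^sup>2)"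
proof -
  have "Im (cdot x x) = 0"
    by (simp add: cdot_def mult.commute)
  then show ?thesis
    by (simp add: complex_eq_iff Re_cdot power2_norm_eq_inner)
qed

lemma matrix_vector_mult_scaleR: "A *v (c *\<^sub>R x) = c *\<^sub>R (A *v x)" for A :: "complex^'m^'n"
  by (simp add: vec_eq_iff matrix_vector_mult_def scaleR_sum_right)

text \<open>Since the index \<open>k\<close> is left out of \<open>S\<close>, a square matrix can
  carry the conjugates of the \<open>v i\<close> as rows and still have a zero row. It is not
  invertible, and a vector of its kernel is orthogonal to all of them.\<close>

lemma exists_orthogonal:
  fixes v :: "'n::finite \<Rightarrow> complex^'n"
  assumes "k \<notin> S"
  shows "\<exists>x. x \<noteq> 0 \<and> (\<forall>i\<in>S. cdot (v i) x = 0)"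
proof (rule ccontr)
  assume contra: "\<not> ?thesis"
  define M :: "complex^'n^'n" where "M = (\<chi> i j. if i \<in> S then cnj (v i $ j) else 0)"
  have Mi: "(M *v x) $ i = (if i \<in> S then cdot (v i) x else 0)" for x i
    by (simp add: M_def matrix_vector_mult_def cdot_def)
  have "x = 0" if "M *v x = 0" for x
    using that contra by (metis Mi zero_index)
  then have "\<exists>N. N ** M = mat 1"
    by (simp add: matrix_left_invertible_ker)
  then obtain N where "M ** N = mat 1"
    using matrix_left_right_inverse by blast
  then have "M *v (N *v axis k 1) = axis k 1"
    by (simp add: matrix_vector_mul_assoc)
  then show False
    using Mi[of "N *v axis k 1" k] assms by (simp add: axis_def)
qed

text \<open>The maximiser of the quadratic form on the unit sphere of an invariant subspace is an
  eigenvector: moving it in an orthogonal direction changes the form to second order only.\<close>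

lemma exists_eigenvector:
  fixes A :: "complex^'n^'n"
  assumes A: "hermitian A" and W: "subspace W" and inv: "\<And>x. x \<in> W \<Longrightarrow> A *v x \<in> W"
    and ne: "x1 \<in> W" "x1 \<noteq> 0"
  shows "\<exists>x\<in>W. norm x = 1 \<and> (\<exists>l::real. A *v x = l *\<^sub>R x)"
proof -
  have sym: "inner x (A *v y) = inner (A *v x) y" for x y
    using A cdot_adj[of A x y] by (metis Re_cdot hermitian_def)
  define S where "S = W \<inter> sphere 0 1"
  have "compact S"
    unfolding S_def using closed_subspace[OF W] by (simp add: closed_Int_compact)
  moreover have "x1 /\<^sub>R norm x1 \<in> S"
    using ne subspace_scale[OF W] by (simp add: S_def)
  moreover have "continuous_on S (\<lambda>x. inner x (A *v x))"
    by (intro continuous_intros linear_continuous_on_compose[OF continuous_on_id])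
       (simp add: matrix_vector_mult_scaleR matrix_vector_right_distrib linearI)
  ultimately obtain x where x: "x \<in> S" and max: "\<And>y. y \<in> S \<Longrightarrow> inner y (A *v y) \<le> inner x (A *v x)"
    using continuous_attains_sup[of S "\<lambda>x. inner x (A *v x)"] by auto
  have xW: "x \<in> W" and nx: "norm x = 1"
    using x by (auto simp: S_def)
  have xx: "inner x x = 1"
    using nx by (simp add: norm_eq_1)
  define l where "l = inner x (A *v x)"
  have bound: "inner y (A *v y) \<le> l * inner y y" if "y \<in> W" for y
  proof (cases "y = 0")
    case False
    have "y /\<^sub>R norm y \<in> S"
      using that False subspace_scale[OF W] by (simp add: S_def)
    from max[OF this] have "inner y (A *v y) / (norm y)\<^sup>2 \<le> l"
      by (simp add: l_def matrix_vector_mult_scaleR power2_eq_square divide_inverse mult_ac)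
    then show ?thesis
      using False by (simp add: power2_norm_eq_inner[symmetric] field_simps)
  qed simp
  define h where "h = A *v x - l *\<^sub>R x"
  have hW: "h \<in> W"
    unfolding h_def using inv xW W by (simp add: subspace_diff subspace_scale)
  have Ax: "A *v x = h + l *\<^sub>R x"
    by (simp add: h_def)
  have "h = 0"
  proof (rule ccontr)
    assume "h \<noteq> 0"
    define g where "g = inner h h"
    have g: "0 < g"
      using \<open>h \<noteq> 0\<close> by (simp add: g_def)
    define b where "b = l * g - inner h (A *v h)"
    have key: "2 * t * g \<le> t\<^sup>2 * b" for t
    proof -
      have "x + t *\<^sub>R h \<in> W"
        using xW hW W by (simp add: subspace_add subspace_scale)
      from bound[OF this]
      have "inner (x + t *\<^sub>R h) (A *v (x + t *\<^sub>R h)) \<le> l * inner (x + t *\<^sub>R h) (x + t *\<^sub>R h)" .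
      moreover have "inner x (A *v h) = inner h (A *v x)"
        using sym[of x h] by (simp add: inner_commute)
      ultimately have "l + 2 * t * inner h (A *v x) + t\<^sup>2 * inner h (A *v h)
          \<le> l * (1 + 2 * t * inner h x + t\<^sup>2 * g)"
        by (simp add: matrix_vector_right_distrib matrix_vector_mult_scaleR inner_add_left
            inner_add_right inner_commute[of x h] l_def[symmetric] xx g_def power2_eq_square
            algebra_simps)
      moreover have "inner h (A *v x) = g + l * inner h x"
        by (simp add: Ax inner_add_right g_def)
      ultimately show ?thesis
        by (simp add: b_def algebra_simps)
    qed
    \<comment> \<open>With t = g / (|b| + 1) the product t b is at most g, so \<open>key\<close>
      would give 2 t g \<le> t g.\<close>
    have "\<bar>b\<bar> + 1 > 0" by simp
    then have "2 * (g / (\<bar>b\<bar> + 1)) * g \<le> (g / (\<bar>b\<bar> + 1))\<^sup>2 * b"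
      using key by blast
    also have "\<dots> = (g / (\<bar>b\<bar> + 1)) * g * (b / (\<bar>b\<bar> + 1))"
      by (simp add: power2_eq_square)
    also have "\<dots> \<le> (g / (\<bar>b\<bar> + 1)) * g * 1"
      using g by (intro mult_left_mono) (auto simp: divide_simps)
    finally have "(g / (\<bar>b\<bar> + 1)) * g \<le> 0"
      by simp
    then show False
      using g by (simp add: field_simps mult_le_0_iff)
  qed
  then show ?thesis
    using xW nx Ax by auto
qed

text \<open>The orthogonal complement of the eigenvectors found so far is invariant because
  \<open>A\<close> is Hermitian, so it contains another one. Indexing them by the index type of the
  matrix lets them become the columns of \<open>U\<close>.\<close>

lemma exists_orthonormal_eigenvectors:
  fixes A :: "complex^'n^'n"
  assumes A: "hermitian A" and "finite S"
  shows "\<exists>v (l :: 'n \<Rightarrow> real). \<forall>i\<in>S. A *v v i = l i *\<^sub>R v i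
           \<and> (\<forall>j\<in>S. cdot (v i) (v j) = (if i = j then 1 else 0))"
  using \<open>finite S\<close>
proof (induction S)
  case (insert k S)
  then obtain v and l :: "'n \<Rightarrow> real" where ev: "\<And>i. i \<in> S \<Longrightarrow> A *v v i = l i *\<^sub>R v i"
    and on: "\<And>i j. i \<in> S \<Longrightarrow> j \<in> S \<Longrightarrow> cdot (v i) (v j) = (if i = j then 1 else 0)"
    by blast
  define W where "W = {x. \<forall>i\<in>S. cdot (v i) x = 0}"
  have "subspace W"
    unfolding W_def
    by (rule subspaceI) (auto simp: cdot_add_right cdot_scaleR_right, simp add: cdot_def)
  moreover have "A *v x \<in> W" if "x \<in> W" for x
  proof -
    have "cdot (v i) (A *v x) = l i *\<^sub>R cdot (v i) x" if "i \<in> S" for i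
      using cdot_adj[of A "v i" x] A ev[OF that]
      by (simp add: hermitian_def cdot_scaleR_left)
    then show ?thesis
      using that by (simp add: W_def)
  qed
  moreover obtain x1 where "x1 \<in> W" "x1 \<noteq> 0"
    using exists_orthogonal[OF insert.hyps(2), of v] by (auto simp: W_def)
  ultimately obtain x m where x: "x \<in> W" "norm x = 1" "A *v x = (m::real) *\<^sub>R x"
    using exists_eigenvector[OF A] by metis
  have "cdot x x = 1"
    using x(2) by (simp add: cdot_self)
  moreover have "cdot x (v i) = 0" if "i \<in> S" for i
    using x(1) that cdot_commute[of "v i" x] by (auto simp: W_def)
  ultimately show ?case
    using insert.hyps(2) ev on x
    by (intro exI[of _ "v(k := x)"] exI[of _ "l(k := m)"]) (auto simp: W_def)
qed simp

theorem hermitian_diagonalizable: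
  fixes A :: "complex^'n^'n"
  assumes "hermitian A"
  obtains U d where "unitary U" "A = U ** diag_real d ** adj U"
proof -
  obtain v and l :: "'n \<Rightarrow> real" where ev: "\<And>i. A *v v i = l i *\<^sub>R v i"
    and on: "\<And>i j. cdot (v i) (v j) = (if i = j then 1 else 0)"
    using exists_orthonormal_eigenvectors[OF assms finite[of UNIV]] by (metis UNIV_I)
  define U where "U = (\<chi> i j. v j $ i)"
  have "adj U ** U = mat 1"
    using on by (simp add: vec_eq_iff matrix_matrix_mult_def U_def cdot_def mat_def)
  then have U: "unitary U"
    unfolding unitary_def using matrix_left_right_inverse by blast
  have "A ** U = U ** diag_real l"
  proof -
    have "(A ** U) $ i $ j = (U ** diag_real l) $ i $ j" for i j
    proof -
      have "(A ** U) $ i $ j = (A *v v j) $ i"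
        by (simp add: matrix_matrix_mult_def matrix_vector_mult_def U_def)
      also have "\<dots> = l j *\<^sub>R (v j $ i)"
        by (simp add: ev)
      finally show ?thesis
        by (simp add: diag_mult_right U_def scaleR_conv_of_real mult.commute)
    qed
    then show ?thesis by (simp add: vec_eq_iff)
  qed
  then have "A ** (U ** adj U) = U ** diag_real l ** adj U"
    by (simp add: matrix_mul_assoc)
  with U show ?thesis
    using that by (simp add: unitary_def)
qed


section \<open>Spectral form and functional calculus of positive semidefinite matrices\<close>

definition spec :: "complex^'n^'n \<Rightarrow> ('n \<Rightarrow> real) \<Rightarrow> complex^'n^'n" where
  "spec U d = U ** diag_real d ** adj U"

lemma fun_calc_spec: "unitary U \<Longrightarrow> fun_calc f (spec U d) = spec U (\<lambda>i. f (d i))"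
  unfolding spec_def by (rule fun_calc_diag)

lemma unitary_mat_1 [simp]: "unitary (mat 1)"
  by (simp add: unitary_def)

lemma spec_mat_1 [simp]: "spec (mat 1) d = diag_real d"
  by (simp add: spec_def)

lemma hermitian_spec: "hermitian (spec U d)"
  by (simp add: hermitian_def spec_def adj_mult matrix_mul_assoc)

lemma spec_mult: "unitary U \<Longrightarrow> spec U d ** spec U e = spec U (\<lambda>i. d i * e i)"
proof -
  assume U: "unitary U"
  have "spec U d ** spec U e = U ** diag_real d ** (adj U ** U) ** diag_real e ** adj U"
    by (simp add: spec_def matrix_mul_assoc)
  also have "\<dots> = U ** (diag_real d ** diag_real e) ** adj U"
    using U by (simp add: unitary_def matrix_mul_assoc)
  finally show ?thesis
    by (simp add: diag_real_mult spec_def)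
qed

lemma spec_1 [simp]: "unitary U \<Longrightarrow> spec U (\<lambda>_. 1) = mat 1"
  by (simp add: spec_def unitary_def)

lemma spec_scaleR: "c *\<^sub>R spec U d = spec U (\<lambda>i. c * d i)"
  by (simp add: spec_def matrix_scaleR_left matrix_scaleR_right flip: diag_real_scaleR)

lemma spec_add: "spec U d + spec U e = spec U (\<lambda>i. d i + e i)"
  by (simp add: spec_def matrix_add_left matrix_add_right flip: diag_real_add)

lemma trace_spec: "unitary U \<Longrightarrow> trace (spec U d) = of_real (\<Sum>i\<in>UNIV. d i)"
  unfolding spec_def
  by (subst trace_mult_comm) (simp add: matrix_mul_assoc unitary_def trace_diag_real)

lemma psd_cdot: "A \<in> psd \<longleftrightarrow> hermitian A \<and> (\<forall>x. 0 \<le> Re (cdot x (A *v x)))"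
  by (simp add: psd_def cdot_def)

lemma cdot_diag_real: "Re (cdot x (diag_real d *v x)) = (\<Sum>i\<in>UNIV. d i * (cmod (x $ i))\<^sup>2)"
proof -
  have "(diag_real d *v x) $ i = of_real (d i) * x $ i" for i
  proof -
    have "(diag_real d *v x) $ i = (\<Sum>j\<in>UNIV. if i = j then of_real (d i) * x $ j else 0)"
      unfolding matrix_vector_mult_def diag_real_def vec_lambda_beta by (rule sum.cong) simp_all
    then show ?thesis by simp
  qed
  moreover have "Re (cnj z * (of_real r * z)) = r * (cmod z)\<^sup>2" for z r
    by (simp only: cmod_power2) (simp add: power2_eq_square algebra_simps)
  ultimately show ?thesis
    by (simp add: cdot_def)
qed

lemma spec_cdot: "Re (cdot x (spec U d *v x)) = (\<Sum>i\<in>UNIV. d i * (cmod ((adj U *v x) $ i))\<^sup>2)"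
proof -
  have "cdot x (spec U d *v x) = cdot (adj U *v x) (diag_real d *v (adj U *v x))"
    using cdot_adj[of "U" x "diag_real d *v (adj U *v x)"]
    by (simp add: spec_def matrix_vector_mul_assoc matrix_mul_assoc)
  then show ?thesis
    by (simp add: cdot_diag_real)
qed

lemma spec_in_psd: "(\<And>i. 0 \<le> d i) \<Longrightarrow> spec U d \<in> psd"
  by (simp add: psd_cdot hermitian_spec spec_cdot sum_nonneg)

lemma psd_spec:
  assumes "A \<in> psd"
  obtains U d where "unitary U" "A = spec U d" "\<And>i. 0 \<le> d i"
proof -
  obtain U d where U: "unitary U" and A: "A = spec U d"
    using assms hermitian_diagonalizable unfolding psd_cdot spec_def by metis
  have "0 \<le> d k" for k
  proof -
    have "0 \<le> (\<Sum>i\<in>UNIV. d i * (cmod ((adj U *v (U *v axis k 1)) $ i))\<^sup>2)"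
      using assms unfolding psd_cdot A spec_cdot by blast
    also have "\<dots> = (\<Sum>i\<in>UNIV. if i = k then d i else 0)"
      using U by (intro sum.cong refl) (simp add: matrix_vector_mul_assoc unitary_def axis_def)
    finally show ?thesis by simp
  qed
  with U A that show ?thesis by blast
qed

lemma psd_scaleR: "A \<in> psd \<Longrightarrow> 0 \<le> c \<Longrightarrow> c *\<^sub>R A \<in> psd"
  by (erule psd_spec) (simp add: spec_scaleR spec_in_psd)

lemma psd_0: "0 \<in> psd"
  by (simp add: psd_def hermitian_def vec_eq_iff)

lemma psd_add:
  assumes "A \<in> psd" "B \<in> psd" shows "A + B \<in> psd"
proof -
  have "(1/2) *\<^sub>R (2 *\<^sub>R A) + (1/2) *\<^sub>R (2 *\<^sub>R B) \<in> psd"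
    by (rule convexD[OF convex_psd]) (simp_all add: psd_scaleR assms)
  then show ?thesis by simp
qed

lemma psd_sum: "(\<And>j. j \<in> J \<Longrightarrow> A j \<in> psd) \<Longrightarrow> (\<Sum>j\<in>J. A j) \<in> psd"
  by (induction J rule: infinite_finite_induct) (simp_all add: psd_0 psd_add)

lemma psd_congruence:
  assumes "A \<in> psd" shows "adj K ** A ** K \<in> psd"
proof -
  have "cdot x (adj K ** A ** K *v x) = cdot (K *v x) (A *v (K *v x))" for x
    using cdot_adj[of "adj K"] by (simp add: matrix_vector_mul_assoc[symmetric])
  with assms show ?thesis
    by (simp add: psd_cdot hermitian_def adj_mult matrix_mul_assoc)
qed

lemma fun_calc_in_psd: "A \<in> psd \<Longrightarrow> (\<And>x. 0 \<le> x \<Longrightarrow> 0 \<le> f x) \<Longrightarrow> fun_calc f A \<in> psd"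
  by (erule psd_spec) (simp add: fun_calc_spec spec_in_psd)

lemma mpow_in_psd: "A \<in> psd \<Longrightarrow> mpow A p \<in> psd"
  by (simp add: mpow_def fun_calc_in_psd)

lemma fun_calc_cong:
  "A \<in> psd \<Longrightarrow> (\<And>x. 0 \<le> x \<Longrightarrow> f x = g x) \<Longrightarrow> fun_calc f A = fun_calc g A"
  by (erule psd_spec) (simp add: fun_calc_spec)

lemma fun_calc_comp: "A \<in> psd \<Longrightarrow> fun_calc f (fun_calc g A) = fun_calc (\<lambda>x. f (g x)) A"
  by (erule psd_spec) (simp add: fun_calc_spec)

lemma fun_calc_one [simp]: "A \<in> psd \<Longrightarrow> fun_calc (\<lambda>_. 1) A = mat 1"
  by (erule psd_spec) (simp add: fun_calc_spec)

lemma fun_calc_ident [simp]: "A \<in> psd \<Longrightarrow> fun_calc (\<lambda>x. x) A = A"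
  by (erule psd_spec) (simp add: fun_calc_spec)

lemma mpow_scaleR:
  "A \<in> psd \<Longrightarrow> 0 \<le> c \<Longrightarrow> mpow (c *\<^sub>R A) p = (c powr p) *\<^sub>R mpow A p"
  unfolding mpow_def
  by (erule psd_spec) (simp add: fun_calc_spec spec_scaleR powr_mult)

lemma mpow_mpow: "A \<in> psd \<Longrightarrow> mpow (mpow A p) q = mpow A (p * q)"
  by (simp add: mpow_def fun_calc_comp powr_powr)

lemma trace_sandwich:
  fixes U :: "complex^'n^'n" and V :: "complex^'m^'m"
  shows "Re (trace (adj K ** spec U f ** K ** spec V g))
       = (\<Sum>i\<in>UNIV. \<Sum>j\<in>UNIV. f i * g j * (cmod ((adj U ** K ** V) $ i $ j))\<^sup>2)"
proof -
  define W where "W = adj U ** K ** V"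
  have "trace (adj K ** spec U f ** K ** spec V g)
      = trace ((adj K ** U ** diag_real f ** adj U ** K ** V ** diag_real g) ** adj V)"
    by (simp add: spec_def matrix_mul_assoc)
  also have "\<dots> = trace (adj W ** (diag_real f ** W ** diag_real g))"
    by (subst trace_mult_comm) (simp add: W_def adj_mult matrix_mul_assoc)
  also have "\<dots> = (\<Sum>j\<in>UNIV. \<Sum>i\<in>UNIV. of_real (f i * g j * (cmod (W $ i $ j))\<^sup>2))"
    by (simp add: trace_mult_eq diag_mult_left diag_mult_right complex_norm_square
        algebra_simps del: of_real_power)
  finally have "Re (trace (adj K ** spec U f ** K ** spec V g))
      = (\<Sum>j\<in>UNIV. \<Sum>i\<in>UNIV. f i * g j * (cmod (W $ i $ j))\<^sup>2)"
    by simp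
  then show ?thesis
    by (subst sum.swap) (simp add: W_def)
qed

text \<open>Reduces trace inequalities between functions of two noncommuting matrices
  (of the type of Klein's inequality) to inequalities between scalar functions.\<close>

lemma joint_spectrum:
  fixes Y X :: "complex^'n^'n"
  assumes "Y \<in> psd" "X \<in> psd"
  obtains y x :: "'n \<Rightarrow> real" and w where "\<And>i. 0 \<le> y i" "\<And>j. 0 \<le> x j" "\<And>i j. 0 \<le> w i j"
    "\<And>f g. Re (trace (fun_calc f Y ** fun_calc g X)) = (\<Sum>i\<in>UNIV. \<Sum>j\<in>UNIV. f (y i) * g (x j) * w i j)"
    "\<And>f. Re (trace (fun_calc f Y)) = (\<Sum>i\<in>UNIV. \<Sum>j\<in>UNIV. f (y i) * w i j)"
    "\<And>g. Re (trace (fun_calc g X)) = (\<Sum>i\<in>UNIV. \<Sum>j\<in>UNIV. g (x j) * w i j)"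
proof -
  obtain U y where Y: "unitary U" "Y = spec U y" "\<And>i. 0 \<le> y i"
    using assms(1) psd_spec by metis
  obtain V x where X: "unitary V" "X = spec V x" "\<And>i. 0 \<le> x i"
    using assms(2) psd_spec by metis
  define w where "w i j = (cmod ((adj U ** V) $ i $ j))\<^sup>2" for i j
  have tr: "Re (trace (fun_calc f Y ** fun_calc g X)) = (\<Sum>i\<in>UNIV. \<Sum>j\<in>UNIV. f (y i) * g (x j) * w i j)"
    for f g
    using trace_sandwich[of "mat 1" U "\<lambda>i. f (y i)" V "\<lambda>i. g (x i)"]
    by (simp add: Y X fun_calc_spec w_def)
  show thesis
  proof (rule that[of y x w])
    show "Re (trace (fun_calc f Y)) = (\<Sum>i\<in>UNIV. \<Sum>j\<in>UNIV. f (y i) * w i j)" for f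
      using tr[of f "\<lambda>_. 1"] assms by simp
    show "Re (trace (fun_calc g X)) = (\<Sum>i\<in>UNIV. \<Sum>j\<in>UNIV. g (x j) * w i j)" for g
      using tr[of "\<lambda>_. 1" g] assms by simp
  qed (use Y X tr in \<open>simp_all add: w_def\<close>)
qed

section \<open>Concave families of diagonal forms\<close>

text \<open>Quadratic forms that are diagonal in three unrelated coordinate systems \<open>c 0\<close>, \<open>c 1\<close>, \<open>c 2\<close>.
  In the application the index \<open>w\<close> ranges over a convex combination (0) and its two ends (1, 2), the
  vectors are matrices \<open>K\<close>, and \<open>form w F\<close> is \<open>Re Tr(K* f(A) K g(X))\<close> with \<open>F\<close> the values of \<open>f(a) g(x)\<close>
  on the spectra; \<open>superadd\<close> is then joint concavity of this trace in \<open>(A, X)\<close>.\<close>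

locale diagonal_forms =
  fixes c :: "nat \<Rightarrow> 'v::ab_group_add \<Rightarrow> 'i::finite \<Rightarrow> complex" and u v :: real
  assumes c_add: "\<And>w x y i. c w (x + y) i = c w x i + c w y i"
    and c_surj: "\<And>z. \<exists>x. \<forall>i. c 0 x i = z i"
    and u: "0 \<le> u" and v: "0 \<le> v"
begin

definition form :: "nat \<Rightarrow> (nat \<Rightarrow> 'i \<Rightarrow> real) \<Rightarrow> 'v \<Rightarrow> real" where
  "form w F x = (\<Sum>i\<in>UNIV. F w i * (cmod (c w x i))\<^sup>2)"

definition superadd :: "(nat \<Rightarrow> 'i \<Rightarrow> real) \<Rightarrow> bool" where
  "superadd F \<longleftrightarrow> (\<forall>w i. 0 \<le> F w i) \<and> (\<forall>x. u * form 1 F x + v * form 2 F x \<le> form 0 F x)"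

lemma superadd_nonneg: "superadd F \<Longrightarrow> 0 \<le> F w i"
  by (simp add: superadd_def)

lemma superaddD: "superadd F \<Longrightarrow> u * form 1 F x + v * form 2 F x \<le> form 0 F x"
  by (simp add: superadd_def)

lemma c_diff: "c w (x - y) i = c w x i - c w y i"
  using c_add[of w "x - y" y i] by simp

lemma form_add: "form w (\<lambda>w i. F w i + G w i) x = form w F x + form w G x"
  by (simp add: form_def sum.distrib distrib_right)

lemma form_scale: "form w (\<lambda>w i. k * F w i) x = k * form w F x"
  by (simp add: form_def sum_distrib_left mult.assoc)

lemma superadd_add:
  assumes "superadd F" "superadd G" shows "superadd (\<lambda>w i. F w i + G w i)"
  unfolding superadd_def form_add
proof (intro conjI allI)
  fix x show "u * (form 1 F x + form 1 G x) + v * (form 2 F x + form 2 G x) \<le> form 0 F x + form 0 G x"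
    using superaddD[OF assms(1), of x] superaddD[OF assms(2), of x] by (simp add: algebra_simps)
qed (use assms in \<open>simp add: superadd_nonneg\<close>)

lemma superadd_scale:
  assumes "superadd F" "0 \<le> k" shows "superadd (\<lambda>w i. k * F w i)"
  unfolding superadd_def form_scale
proof (intro conjI allI)
  fix x show "u * (k * form 1 F x) + v * (k * form 2 F x) \<le> k * form 0 F x"
    using mult_left_mono[OF superaddD[OF assms(1), of x] assms(2)] by (simp add: algebra_simps)
qed (use assms in \<open>simp add: superadd_nonneg\<close>)

lemma superadd_limit:
  assumes F: "\<And>n. superadd (F n)" and lim: "\<And>w i. (\<lambda>n. F n w i) \<longlonglongrightarrow> G w i"
  shows "superadd G"
  unfolding superadd_def
proof (intro conjI allI)
  show "0 \<le> G w i" for w i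
    by (rule LIMSEQ_le_const[OF lim]) (use F superadd_nonneg in blast)
next
  fix x
  have L: "(\<lambda>n. form w (F n) x) \<longlonglongrightarrow> form w G x" for w
    unfolding form_def by (intro tendsto_intros lim)
  show "u * form 1 G x + v * form 2 G x \<le> form 0 G x"
    by (rule LIMSEQ_le[of "\<lambda>n. u * form 1 (F n) x + v * form 2 (F n) x" _ "\<lambda>n. form 0 (F n) x"])
      (use F superaddD in \<open>auto intro!: tendsto_intros L\<close>)
qed

text \<open>Weighted Cauchy-Schwarz: after the triangle inequality the defect is the square of
  \<open>f * a - g * b\<close>. If both weights vanish, the quotient is 0 by convention.\<close>

lemma parallel_sum_le:
  fixes f g :: real and k z :: complex
  assumes "0 \<le> f" "0 \<le> g"
  shows "f * g / (f + g) * (cmod k)\<^sup>2 \<le> f * (cmod z)\<^sup>2 + g * (cmod (k - z))\<^sup>2"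
proof (cases "f + g = 0")
  case False
  then have pos: "0 < f + g" using assms by simp
  define a b where "a = cmod z" and "b = cmod (k - z)"
  have ab: "0 \<le> a" "0 \<le> b" "cmod k \<le> a + b"
    using norm_triangle_ineq[of z "k - z"] by (auto simp: a_def b_def)
  have "f * g * (cmod k)\<^sup>2 \<le> f * g * (a + b)\<^sup>2"
    using ab assms by (intro mult_left_mono power_mono) auto
  also have "\<dots> \<le> f * g * (a + b)\<^sup>2 + (f * a - g * b)\<^sup>2"
    by simp
  also have "\<dots> = (f * a\<^sup>2 + g * b\<^sup>2) * (f + g)"
    by (simp add: power2_eq_square algebra_simps)
  finally show ?thesis
    using pos by (simp add: a_def b_def field_simps)
qed (use assms in simp)

text \<open>The parallel sum is the infimum of \<open>F(z) + G(x - z)\<close> over \<open>z\<close>.\<close>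

lemma superadd_parallel_sum:
  assumes F: "superadd F" and G: "superadd G"
  shows "superadd (\<lambda>w i. F w i * G w i / (F w i + G w i))" (is "superadd ?P")
  unfolding superadd_def
proof (intro conjI allI)
  fix x
  \<comment> \<open>The optimal splitting is formed in the coordinates of index 0, the only ones for
    which surjectivity is assumed. At the two ends the same \<open>z\<close> only enters an
    inequality.\<close>
  obtain z where z: "\<And>i. c 0 z i = of_real (G 0 i / (F 0 i + G 0 i)) * c 0 x i"
    using c_surj[of "\<lambda>i. of_real (G 0 i / (F 0 i + G 0 i)) * c 0 x i"] by metis
  have le: "form w ?P x \<le> form w F z + form w G (x - z)" for w
    unfolding form_def sum.distrib[symmetric] c_diff
    by (intro sum_mono parallel_sum_le superadd_nonneg F G)
  have "F 0 i * (cmod (c 0 z i))\<^sup>2 + G 0 i * (cmod (c 0 (x - z) i))\<^sup>2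
      = F 0 i * G 0 i / (F 0 i + G 0 i) * (cmod (c 0 x i))\<^sup>2" for i
  proof (cases "F 0 i + G 0 i = 0")
    case True
    then have "F 0 i = 0" "G 0 i = 0"
      using superadd_nonneg[OF F, of 0 i] superadd_nonneg[OF G, of 0 i] by linarith+
    then show ?thesis by simp
  next
    case False
    define f g where "f = F 0 i" and "g = G 0 i"
    have fg: "f + g \<noteq> 0"
      using False by (simp add: f_def g_def)
    have "c 0 (x - z) i = of_real (1 - g / (f + g)) * c 0 x i"
      by (simp add: c_diff z f_def g_def algebra_simps)
    also have "1 - g / (f + g) = f / (f + g)"
      using fg by (simp add: field_simps)
    finally have "c 0 (x - z) i = of_real (f / (f + g)) * c 0 x i" .
    then have "f * (cmod (c 0 z i))\<^sup>2 + g * (cmod (c 0 (x - z) i))\<^sup>2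
        = (f * (g / (f + g))\<^sup>2 + g * (f / (f + g))\<^sup>2) * (cmod (c 0 x i))\<^sup>2"
      by (simp only: z norm_mult norm_of_real power_mult_distrib power2_abs f_def[symmetric] g_def[symmetric])
         (simp add: algebra_simps)
    also have "f * (g / (f + g))\<^sup>2 + g * (f / (f + g))\<^sup>2 = f * g * (f + g) / (f + g)\<^sup>2"
      by (simp add: power_divide add_divide_distrib[symmetric] power2_eq_square algebra_simps)
    also have "\<dots> = f * g / (f + g)"
      using fg by (simp add: power2_eq_square)
    finally show ?thesis
      by (simp add: f_def g_def)
  qed
  then have eq: "form 0 F z + form 0 G (x - z) = form 0 ?P x"
    unfolding form_def sum.distrib[symmetric] by simp
  have "u * form 1 ?P x + v * form 2 ?P x
      \<le> u * (form 1 F z + form 1 G (x - z)) + v * (form 2 F z + form 2 G (x - z))"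
    by (intro add_mono mult_left_mono le u v)
  also have "\<dots> \<le> form 0 F z + form 0 G (x - z)"
    using superaddD[OF F, of z] superaddD[OF G, of "x - z"] by (simp add: algebra_simps)
  finally show "u * form 1 ?P x + v * form 2 ?P x \<le> form 0 ?P x"
    by (simp add: eq)
qed (simp add: superadd_nonneg[OF F] superadd_nonneg[OF G])

end

section \<open>The arithmetic-harmonic mean of two numbers\<close>

text \<open>The harmonic mean is twice the parallel sum, so both components stay within the
  operations that preserve \<open>superadd\<close>. Their product is invariant, which identifies the
  common limit. If both numbers vanish, \<open>0 / 0 = 0\<close> keeps the recursion
  correct.\<close>

fun ah_mean :: "real \<Rightarrow> real \<Rightarrow> nat \<Rightarrow> real \<times> real" where
  "ah_mean f g 0 = (f, g)"
| "ah_mean f g (Suc n) = (let (a, b) = ah_mean f g n in ((a + b) / 2, 2 * (a * b / (a + b))))"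

lemma ah_mean_nonneg: "0 \<le> f \<Longrightarrow> 0 \<le> g \<Longrightarrow> 0 \<le> fst (ah_mean f g n) \<and> 0 \<le> snd (ah_mean f g n)"
  by (induction n) (auto simp: Let_def split: prod.splits)

lemma ah_mean_prod:
  "0 \<le> f \<Longrightarrow> 0 \<le> g \<Longrightarrow> fst (ah_mean f g n) * snd (ah_mean f g n) = f * g"
proof (induction n)
  case (Suc n)
  then show ?case
    using ah_mean_nonneg[OF Suc.prems, of n]
    by (cases "ah_mean f g n") (auto simp: add_nonneg_eq_0_iff)
qed simp

text \<open>The new gap is (a - b)^2 / (2 (a + b)), at most half the old one since |a - b| \<le> a +
  b.\<close>

lemma ah_mean_diff:
  assumes "0 \<le> f" "0 \<le> g"
  shows "\<bar>fst (ah_mean f g n) - snd (ah_mean f g n)\<bar> \<le> \<bar>f - g\<bar> / 2 ^ n"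
proof (induction n)
  case (Suc n)
  obtain a b where ab: "ah_mean f g n = (a, b)" by force
  have a: "0 \<le> a" and b: "0 \<le> b"
    using ah_mean_nonneg[OF assms, of n] by (auto simp: ab)
  have "\<bar>(a + b) / 2 - 2 * (a * b / (a + b))\<bar> \<le> \<bar>a - b\<bar> / 2"
  proof (cases "a + b = 0")
    case False
    then have pos: "0 < a + b" using a b by simp
    have "(a + b) / 2 - 2 * (a * b / (a + b)) = (a - b)\<^sup>2 / (a + b) / 2"
      using pos by (simp add: field_simps power2_eq_square)
    then have "\<bar>(a + b) / 2 - 2 * (a * b / (a + b))\<bar> = (a - b)\<^sup>2 / (a + b) / 2"
      using pos by simp
    moreover have "(a - b)\<^sup>2 / (a + b) \<le> \<bar>a - b\<bar>"
    proof -
      have "\<bar>a - b\<bar> * \<bar>a - b\<bar> \<le> \<bar>a - b\<bar> * (a + b)"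
        using a b by (intro mult_left_mono) auto
      then show ?thesis
        using pos by (simp add: field_simps power2_eq_square)
    qed
    ultimately show ?thesis
      using divide_right_mono[of "(a - b)\<^sup>2 / (a + b)" "\<bar>a - b\<bar>" 2] by simp
  qed simp
  with Suc show ?case
    by (simp add: ab)
qed simp

lemma ah_mean_tendsto:
  assumes "0 \<le> f" "0 \<le> g"
  shows "(\<lambda>n. fst (ah_mean f g n)) \<longlonglongrightarrow> sqrt (f * g)"
proof (rule LIMSEQ_I)
  fix r :: real assume "0 < r"
  have "(\<lambda>n. \<bar>f - g\<bar> / 2 ^ n) \<longlonglongrightarrow> 0"
    using LIMSEQ_divide_realpow_zero[of 2 "\<bar>f - g\<bar>"] by simp
  from LIMSEQ_D[OF this \<open>0 < r\<close>] obtain N where N: "\<And>n. N \<le> n \<Longrightarrow> \<bar>f - g\<bar> / 2 ^ n < r"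
    by auto
  show "\<exists>N. \<forall>n\<ge>N. norm (fst (ah_mean f g n) - sqrt (f * g)) < r"
  proof (intro exI allI impI)
    fix n assume "N \<le> n"
    define a b where "a = fst (ah_mean f g n)" and "b = snd (ah_mean f g n)"
    have a: "0 \<le> a" and b: "0 \<le> b" and fg: "f * g = a * b"
      using ah_mean_nonneg[OF assms, of n] ah_mean_prod[OF assms, of n] by (auto simp: a_def b_def)
    have "min a b \<le> sqrt (a * b)"
      using a b by (intro real_le_rsqrt) (auto simp: power2_eq_square min_def intro!: mult_mono)
    moreover have "sqrt (a * b) \<le> max a b"
      using a b by (intro real_le_lsqrt) (auto simp: power2_eq_square max_def intro!: mult_mono)
    ultimately have "\<bar>a - sqrt (f * g)\<bar> \<le> \<bar>a - b\<bar>"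
      unfolding fg by linarith
    also have "\<dots> < r"
      using ah_mean_diff[OF assms, of n] N[OF \<open>N \<le> n\<close>] unfolding a_def b_def by linarith
    finally show "norm (fst (ah_mean f g n) - sqrt (f * g)) < r"
      by (simp add: a_def)
  qed
qed

text \<open>A power with \<open>0\<close>-th power constantly \<open>1\<close>, unlike \<open>0 powr 0 = 0\<close>.\<close>

definition pw :: "real \<Rightarrow> real \<Rightarrow> real" where
  "pw x s = (if s = 0 then 1 else x powr s)"

lemma pw_nonneg [simp]: "0 \<le> pw x s"
  by (simp add: pw_def)

lemma pw_1: "0 \<le> x \<Longrightarrow> pw x 1 = x"
  by (simp add: pw_def)

lemma pw_one [simp]: "pw 1 s = 1"
  by (simp add: pw_def)

lemma pw_powr: "t \<noteq> 0 \<Longrightarrow> pw x s powr t = pw x (s * t)"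
  by (simp add: pw_def powr_powr)

text \<open>Nonnegative exponents matter at \<open>x = 0\<close>: their mean is 0 only if both are,
  which respects the convention of \<open>pw\<close> for exponent 0.\<close>

lemma sqrt_pw: "0 \<le> s \<Longrightarrow> 0 \<le> t \<Longrightarrow> 0 \<le> x \<Longrightarrow> sqrt (pw x s * pw x t) = pw x ((s + t) / 2)"
proof -
  assume st: "0 \<le> s" "0 \<le> t" and x: "0 \<le> x"
  have "sqrt (x powr s * x powr t) = x powr ((s + t) / 2)"
    using powr_half_sqrt[of "x powr (s + t)"] by (simp add: powr_powr powr_add[symmetric])
  moreover have "sqrt (x powr r) = x powr (r / 2)" for r
    using powr_half_sqrt[of "x powr r"] by (simp add: powr_powr)
  ultimately show ?thesis
    using st by (simp add: pw_def)
qed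

context diagonal_forms
begin

lemma superadd_sqrt:
  assumes F: "superadd F" and G: "superadd G"
  shows "superadd (\<lambda>w i. sqrt (F w i * G w i))"
proof (rule superadd_limit[of "\<lambda>n w i. fst (ah_mean (F w i) (G w i) n)"])
  have "superadd (\<lambda>w i. fst (ah_mean (F w i) (G w i) n)) \<and> superadd (\<lambda>w i. snd (ah_mean (F w i) (G w i) n))" for n
  proof (induction n)
    case (Suc n)
    then show ?case
      using superadd_scale[OF superadd_add[of "\<lambda>w i. fst (ah_mean (F w i) (G w i) n)"], of _ "1/2"]
        superadd_scale[OF superadd_parallel_sum[of "\<lambda>w i. fst (ah_mean (F w i) (G w i) n)"], of _ 2]
      by (simp add: case_prod_beta Let_def)
  qed (use F G in simp)
  then show "superadd (\<lambda>w i. fst (ah_mean (F w i) (G w i) n))" for n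
    by blast
qed (intro ah_mean_tendsto superadd_nonneg F G)

text \<open>Each multiple of 2^-(n+1) is the midpoint of two equal or adjacent multiples of 2^-n,
  and the geometric mean of two weighted means is the weighted mean at the midpoint of the
  weights.\<close>

lemma superadd_dyadic_mean:
  assumes F: "superadd F" and G: "superadd G"
  shows "k \<le> 2 ^ n \<Longrightarrow> superadd (\<lambda>w i. pw (F w i) (1 - real k / 2 ^ n) * pw (G w i) (real k / 2 ^ n))"
proof (induction n arbitrary: k)
  case 0
  then have "k = 0 \<or> k = 1" by auto
  moreover have "superadd (\<lambda>w i. pw (F w i) 1)" "superadd (\<lambda>w i. pw (G w i) 1)"
    using F G by (simp_all add: pw_1 superadd_nonneg)
  moreover have "pw x 0 = 1" for x by (simp add: pw_def)
  ultimately show ?case by auto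
next
  case (Suc n)
  define k1 k2 where "k1 = k div 2" and "k2 = k - k div 2"
  have k12: "k1 \<le> 2 ^ n" "k2 \<le> 2 ^ n" "k = k1 + k2"
    using Suc.prems by (auto simp: k1_def k2_def)
  let ?t1 = "real k1 / 2 ^ n" and ?t2 = "real k2 / 2 ^ n"
  have t: "0 \<le> ?t1" "?t1 \<le> 1" "0 \<le> ?t2" "?t2 \<le> 1"
    using of_nat_mono[OF k12(1), where 'a = real] of_nat_mono[OF k12(2), where 'a = real] by simp_all
  have m: "(?t1 + ?t2) / 2 = real k / 2 ^ Suc n"
    by (simp add: k12(3) add_divide_distrib)
  have e: "sqrt ((pw (F w i) (1 - ?t1) * pw (G w i) ?t1) * (pw (F w i) (1 - ?t2) * pw (G w i) ?t2))
      = pw (F w i) (1 - real k / 2 ^ Suc n) * pw (G w i) (real k / 2 ^ Suc n)" for w i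
  proof -
    have "sqrt ((pw (F w i) (1 - ?t1) * pw (G w i) ?t1) * (pw (F w i) (1 - ?t2) * pw (G w i) ?t2))
       = sqrt (pw (F w i) (1 - ?t1) * pw (F w i) (1 - ?t2)) * sqrt (pw (G w i) ?t1 * pw (G w i) ?t2)"
      by (simp only: real_sqrt_mult mult_ac)
    also have "\<dots> = pw (F w i) ((1 - ?t1 + (1 - ?t2)) / 2) * pw (G w i) ((?t1 + ?t2) / 2)"
      using t F G by (simp add: sqrt_pw superadd_nonneg)
    also have "(1 - ?t1 + (1 - ?t2)) / 2 = 1 - real k / 2 ^ Suc n"
      unfolding m[symmetric] by (simp add: field_simps)
    finally show ?thesis
      by (simp only: m)
  qed
  show ?case
    using superadd_sqrt[OF Suc.IH[OF k12(1)] Suc.IH[OF k12(2)]] unfolding e .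
qed

lemma superadd_weighted_mean:
  assumes F: "superadd F" and G: "superadd G" and t: "0 \<le> t" "t \<le> 1"
  shows "superadd (\<lambda>w i. pw (F w i) (1 - t) * pw (G w i) t)"
proof (cases "t = 0 \<or> t = 1")
  case True
  then show ?thesis
    using superadd_dyadic_mean[OF F G, of 0 0] superadd_dyadic_mean[OF F G, of 1 0] by auto
next
  case False
  with t have t: "0 < t" "t < 1" by auto
  define s where "s n = real (nat \<lfloor>t * 2 ^ n\<rfloor>) / 2 ^ n" for n
  have s: "s n = of_int \<lfloor>t * 2 ^ n\<rfloor> / 2 ^ n" for n
    using t by (simp add: s_def)
  have "s \<longlonglongrightarrow> t"
  proof (rule real_tendsto_sandwich)
    show "\<forall>\<^sub>F n in sequentially. t - 1 / 2 ^ n \<le> s n"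
    proof (rule always_eventually, rule allI)
      fix n
      have "t * 2 ^ n - 1 \<le> of_int \<lfloor>t * 2 ^ n\<rfloor>" by linarith
      then have "(t * 2 ^ n - 1) / 2 ^ n \<le> s n"
        unfolding s by (rule divide_right_mono) simp
      then show "t - 1 / 2 ^ n \<le> s n"
        by (simp add: diff_divide_distrib)
    qed
    show "\<forall>\<^sub>F n in sequentially. s n \<le> t"
      by (rule always_eventually) (simp add: s field_simps)
    show "(\<lambda>n. t - 1 / 2 ^ n) \<longlonglongrightarrow> t"
      using tendsto_diff[OF tendsto_const LIMSEQ_divide_realpow_zero[of 2 1], of t] by simp
  qed simp
  note sub = this
  \<comment> \<open>\<open>pw\<close> jumps at exponent 0 on base 0. The limit is therefore taken
    along the tail on which both exponents are positive and \<open>pw\<close> is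
    \<open>powr\<close>.\<close>
  have ev: "\<forall>\<^sub>F n in sequentially. 0 < s n \<and> s n < 1"
    using order_tendstoD[OF sub, of 0] order_tendstoD[OF sub, of 1] t by (simp add: eventually_conj_iff)
  then obtain N where N: "\<And>n. N \<le> n \<Longrightarrow> 0 < s n \<and> s n < 1"
    by (auto simp: eventually_sequentially)
  have powr_lim: "(\<lambda>n. x powr (1 - s n) * y powr s n) \<longlonglongrightarrow> x powr (1 - t) * y powr t"
    if "0 \<le> x" "0 \<le> y" for x y
  proof (cases "x = 0 \<or> y = 0")
    case False
    then show ?thesis by (intro tendsto_intros sub) auto
  qed auto
  show ?thesis
  proof (rule superadd_limit[of "\<lambda>n w i. pw (F w i) (1 - s (n + N)) * pw (G w i) (s (n + N))"])
    show "superadd (\<lambda>w i. pw (F w i) (1 - s (n + N)) * pw (G w i) (s (n + N)))" for n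
      unfolding s_def
    proof (rule superadd_dyadic_mean[OF F G])
      have "\<lfloor>t * 2 ^ (n + N)\<rfloor> \<le> 2 ^ (n + N)"
        using t by (simp add: floor_le_iff)
           (smt (verit) mult_left_le_one_le zero_less_power)
      then show "nat \<lfloor>t * 2 ^ (n + N)\<rfloor> \<le> 2 ^ (n + N)"
        by (simp add: nat_le_iff)
    qed
    have nz: "s (n + N) \<noteq> 0" "s (n + N) \<noteq> 1" for n
      using N[of "n + N"] by auto
    show "(\<lambda>n. pw (F w i) (1 - s (n + N)) * pw (G w i) (s (n + N))) \<longlonglongrightarrow> pw (F w i) (1 - t) * pw (G w i) t"
      for w i
      using LIMSEQ_ignore_initial_segment[OF powr_lim[of "F w i" "G w i"], of N] t nz F G
      by (simp add: pw_def superadd_nonneg)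
  qed
qed

text \<open>With r = s + t the product is the r-th power of the mean with weights s/r and t/r, and
  an r-th power with r \<le> 1 is itself a weighted mean with the constant family 1.\<close>

theorem superadd_powers:
  assumes F: "superadd F" and G: "superadd G" and one: "superadd (\<lambda>_ _. 1)"
    and st: "0 \<le> s" "0 \<le> t" "s + t \<le> 1"
  shows "superadd (\<lambda>w i. pw (F w i) s * pw (G w i) t)"
proof (cases "s + t = 0")
  case True
  then have "s = 0" "t = 0" using st by auto
  with one show ?thesis by (simp add: pw_def)
next
  case False
  define r where "r = s + t"
  have r: "0 < r" "r \<le> 1" using False st by (auto simp: r_def)
  have q: "1 - t / r = s / r"
    using r by (simp add: r_def field_simps)
  have "superadd (\<lambda>w i. pw (F w i) (s / r) * pw (G w i) (t / r))"
    using superadd_weighted_mean[OF F G, of "t / r"] r st unfolding q by (simp add: r_def)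
  from superadd_weighted_mean[OF one this, of r]
  have *: "superadd (\<lambda>w i. pw (pw (F w i) (s / r) * pw (G w i) (t / r)) r)"
    using r by simp
  have "pw (pw x (s / r) * pw y (t / r)) r = pw x s * pw y t" for x y
    using r pw_powr[of r x "s / r"] pw_powr[of r y "t / r"]
    by (simp add: pw_def[of _ r] powr_mult)
  with * show ?thesis by simp
qed

text \<open>\<open>a\<^sup>2 / G\<close> is the supremum over \<open>z\<close> of \<open>2 Re \<langle>z, a x\<rangle> - G(z)\<close>, where the first term is affine
  in the mixture and the second one subadditive.\<close>

theorem subadd_square_over:
  assumes a: "\<And>x. form 0 a x = u * form 1 a x + v * form 2 a x"
    and G: "superadd G" and a0: "\<And>w i. G w i = 0 \<Longrightarrow> a w i = 0"
  shows "form 0 (\<lambda>w i. (a w i)\<^sup>2 / G w i) x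
       \<le> u * form 1 (\<lambda>w i. (a w i)\<^sup>2 / G w i) x + v * form 2 (\<lambda>w i. (a w i)\<^sup>2 / G w i) x"
proof -
  let ?P = "\<lambda>w i. (a w i)\<^sup>2 / G w i"
  \<comment> \<open>The cross term is obtained by polarisation because hypothesis \<open>a\<close>
    speaks of quadratic forms only; in this form it is visibly affine in the mixture.\<close>
  define pol where "pol w z = form w a (x + z) - form w a x - form w a z" for w z
  have pol: "pol w z = (\<Sum>i\<in>UNIV. a w i * (2 * Re (cnj (c w x i) * c w z i)))" for w z
    unfolding pol_def form_def c_add sum_subtractf[symmetric]
    by (intro sum.cong refl, simp only: cmod_power2) (simp add: power2_eq_square algebra_simps)
  obtain z where z: "\<And>i. c 0 z i = of_real (a 0 i / G 0 i) * c 0 x i"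
    using c_surj[of "\<lambda>i. of_real (a 0 i / G 0 i) * c 0 x i"] by metis
  have le: "pol w z - form w G z \<le> form w ?P x" for w
    unfolding pol form_def sum_subtractf[symmetric]
  proof (intro sum_mono)
    fix i
    define p q where "p = c w x i" and "q = c w z i"
    show "a w i * (2 * Re (cnj (c w x i) * c w z i)) - G w i * (cmod (c w z i))\<^sup>2
       \<le> (a w i)\<^sup>2 / G w i * (cmod (c w x i))\<^sup>2"
      unfolding p_def[symmetric] q_def[symmetric]
    proof (cases "G w i = 0")
      case False
      then have g: "0 < G w i" using superadd_nonneg[OF G, of w i] by simp
      have "0 \<le> (cmod (of_real (a w i) * p - of_real (G w i) * q))\<^sup>2"
        by simp
      also have "\<dots> = (a w i)\<^sup>2 * (cmod p)\<^sup>2 - a w i * (2 * Re (cnj p * q)) * G w i + (G w i)\<^sup>2 * (cmod q)\<^sup>2"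
        by (simp only: cmod_power2) (simp add: power2_eq_square algebra_simps)
      finally show "a w i * (2 * Re (cnj p * q)) - G w i * (cmod q)\<^sup>2 \<le> (a w i)\<^sup>2 / G w i * (cmod p)\<^sup>2"
        using g by (simp add: field_simps power2_eq_square)
    qed (simp add: a0)
  qed
  have "pol 0 z - form 0 G z = form 0 ?P x"
    unfolding pol form_def sum_subtractf[symmetric]
  proof (intro sum.cong refl)
    fix i
    define g where "g = G 0 i"
    show "a 0 i * (2 * Re (cnj (c 0 x i) * c 0 z i)) - G 0 i * (cmod (c 0 z i))\<^sup>2
       = (a 0 i)\<^sup>2 / G 0 i * (cmod (c 0 x i))\<^sup>2"
    proof (cases "g = 0")
      case False
      have "Re (cnj (c 0 x i) * c 0 z i) = a 0 i / g * (cmod (c 0 x i))\<^sup>2"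
        unfolding z by (simp only: cmod_power2) (simp add: g_def power2_eq_square algebra_simps add_divide_distrib)
      moreover have "(cmod (c 0 z i))\<^sup>2 = (a 0 i / g)\<^sup>2 * (cmod (c 0 x i))\<^sup>2"
        by (simp only: z norm_mult norm_of_real power_mult_distrib power2_abs g_def)
      ultimately have "a 0 i * (2 * Re (cnj (c 0 x i) * c 0 z i)) - g * (cmod (c 0 z i))\<^sup>2
          = (2 * (a 0 i * (a 0 i / g)) - g * (a 0 i / g)\<^sup>2) * (cmod (c 0 x i))\<^sup>2"
        by (simp only: algebra_simps)
      also have "2 * (a 0 i * (a 0 i / g)) - g * (a 0 i / g)\<^sup>2 = (a 0 i)\<^sup>2 / g"
        using False by (simp add: power2_eq_square)
      finally show ?thesis
        by (simp add: g_def)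
    qed (simp add: a0 g_def)
  qed
  then have "form 0 ?P x = pol 0 z - form 0 G z" by simp
  also have "\<dots> \<le> u * (pol 1 z - form 1 G z) + v * (pol 2 z - form 2 G z)"
    using superaddD[OF G, of z] by (simp add: pol_def a algebra_simps)
  also have "\<dots> \<le> u * form 1 ?P x + v * form 2 ?P x"
    by (intro add_mono mult_left_mono le u v)
  finally show ?thesis .
qed

end

section \<open>Lieb concavity, Ando convexity and traces of powers\<close>

locale matrix_mixture =
  fixes A :: "nat \<Rightarrow> complex^'n^'n" and X :: "nat \<Rightarrow> complex^'m^'m"
    and U :: "nat \<Rightarrow> complex^'n^'n" and V :: "nat \<Rightarrow> complex^'m^'m"
    and a :: "nat \<Rightarrow> 'n \<Rightarrow> real" and x :: "nat \<Rightarrow> 'm \<Rightarrow> real" and u v :: real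
  assumes U: "unitary (U w)" and V: "unitary (V w)"
    and A: "A w = spec (U w) (a w)" and X: "X w = spec (V w) (x w)"
    and a: "0 \<le> a w i" and x: "0 \<le> x w j"
    and A0: "A 0 = u *\<^sub>R A 1 + v *\<^sub>R A 2" and X0: "X 0 = u *\<^sub>R X 1 + v *\<^sub>R X 2"
    and u: "0 \<le> u" and v: "0 \<le> v" and uv: "u + v = 1"
begin

sublocale diagonal_forms "\<lambda>w K ij. (adj (U w) ** K ** V w) $ fst ij $ snd ij" u v
proof
  fix z :: "'n \<times> 'm \<Rightarrow> complex"
  define Z :: "complex^'m^'n" where "Z = (\<chi> i j. z (i, j))"
  have "adj (U 0) ** (U 0 ** Z ** adj (V 0)) ** V 0 = (adj (U 0) ** U 0) ** Z ** (adj (V 0) ** V 0)"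
    by (simp add: matrix_mul_assoc)
  also have "\<dots> = Z"
    using U V by (simp add: unitary_def)
  finally show "\<exists>K. \<forall>ij. (adj (U 0) ** K ** V 0) $ fst ij $ snd ij = z ij"
    by (intro exI[of _ "U 0 ** Z ** adj (V 0)"]) (simp add: Z_def)
qed (simp_all add: u v matrix_add_right matrix_add_left)

lemma form_trace:
  "form w (\<lambda>w ij. f (a w (fst ij)) * g (x w (snd ij))) K
   = Re (trace (adj K ** fun_calc f (A w) ** K ** fun_calc g (X w)))"
  unfolding A X fun_calc_spec[OF U] fun_calc_spec[OF V] trace_sandwich form_def
    sum.cartesian_product by (simp add: case_prod_beta)

lemma form_left: "form w (\<lambda>w ij. a w (fst ij)) K = Re (trace (adj K ** A w ** K))"
  using form_trace[of w "\<lambda>x. x" "\<lambda>_. 1" K] by (simp add: A X U V fun_calc_spec)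

lemma form_right: "form w (\<lambda>w ij. x w (snd ij)) K = Re (trace (adj K ** K ** X w))"
  using form_trace[of w "\<lambda>_. 1" "\<lambda>x. x" K] by (simp add: A X U V fun_calc_spec)

lemma form_one: "form w (\<lambda>w ij. 1) K = Re (trace (adj K ** K))"
  using form_trace[of w "\<lambda>_. 1" "\<lambda>x. 1" K] by (simp add: A X U V fun_calc_spec)

lemma form_left_affine:
  "form 0 (\<lambda>w ij. a w (fst ij)) K
   = u * form 1 (\<lambda>w ij. a w (fst ij)) K + v * form 2 (\<lambda>w ij. a w (fst ij)) K"
  by (simp add: form_left A0 matrix_add_left matrix_add_right matrix_scaleR_left
      matrix_scaleR_right trace_add trace_scaleR)

lemma superadd_left: "superadd (\<lambda>w ij. a w (fst ij))"
  by (simp add: superadd_def a form_left_affine)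

lemma superadd_right: "superadd (\<lambda>w ij. x w (snd ij))"
  by (simp add: superadd_def x form_right X0 matrix_add_right matrix_scaleR_right
      trace_add trace_scaleR)

lemma superadd_one: "superadd (\<lambda>w ij. 1)"
  by (simp add: superadd_def form_one uv flip: distrib_right)

end

lemma psd_mixture:
  assumes "A1 \<in> psd" "A2 \<in> psd" "X1 \<in> psd" "X2 \<in> psd" "0 \<le> u" "0 \<le> v" "u + v = 1"
  obtains A X U V a x where "matrix_mixture A X U V a x u v"
    "A 0 = u *\<^sub>R A1 + v *\<^sub>R A2" "A 1 = A1" "A 2 = A2"
    "X 0 = u *\<^sub>R X1 + v *\<^sub>R X2" "X 1 = X1" "X 2 = X2"
proof -
  define A where "A w = (if w = 0 then u *\<^sub>R A1 + v *\<^sub>R A2 else if w = 1 then A1 else A2)" for w :: nat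
  define X where "X w = (if w = 0 then u *\<^sub>R X1 + v *\<^sub>R X2 else if w = 1 then X1 else X2)" for w :: nat
  have "A w \<in> psd" "X w \<in> psd" for w
    using assms by (auto simp: A_def X_def psd_add psd_scaleR)
  then have "\<forall>w. \<exists>U a. unitary U \<and> A w = spec U a \<and> (\<forall>i. 0 \<le> a i)"
    "\<forall>w. \<exists>V x. unitary V \<and> X w = spec V x \<and> (\<forall>i. 0 \<le> x i)"
    by (meson psd_spec)+
  then obtain U a V x where "\<And>w. unitary (U w) \<and> A w = spec (U w) (a w) \<and> (\<forall>i. 0 \<le> a w i)"
    "\<And>w. unitary (V w) \<and> X w = spec (V w) (x w) \<and> (\<forall>i. 0 \<le> x w i)"
    by metis
  then have "matrix_mixture A X U V a x u v"
    using assms(5-7) by unfold_locales (simp_all add: A_def X_def)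
  then show thesis
    by (rule that) (simp_all add: A_def X_def)
qed

text \<open>The powers are written with \<open>pw\<close> so that exponent 0 yields the identity
  also on singular matrices; \<open>t = 0\<close> occurs below when q = p.\<close>

theorem Lieb_concavity:
  fixes K :: "complex^'m^'n"
  assumes psd: "A1 \<in> psd" "A2 \<in> psd" "X1 \<in> psd" "X2 \<in> psd" and uv: "0 \<le> u" "0 \<le> v" "u + v = 1"
    and st: "0 \<le> s" "0 \<le> t" "s + t \<le> 1"
  defines "L \<equiv> \<lambda>A X. Re (trace (adj K ** fun_calc (\<lambda>x. pw x s) A ** K ** fun_calc (\<lambda>x. pw x t) X))"
  shows "u * L A1 X1 + v * L A2 X2 \<le> L (u *\<^sub>R A1 + v *\<^sub>R A2) (u *\<^sub>R X1 + v *\<^sub>R X2)"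
proof -
  obtain A X U V a x where mm: "matrix_mixture A X U V a x u v"
    and e: "A 0 = u *\<^sub>R A1 + v *\<^sub>R A2" "A 1 = A1" "A 2 = A2"
      "X 0 = u *\<^sub>R X1 + v *\<^sub>R X2" "X 1 = X1" "X 2 = X2"
    using psd_mixture[OF psd uv] by metis
  interpret matrix_mixture A X U V a x u v by (rule mm)
  show ?thesis
    using superaddD[OF superadd_powers[OF superadd_left superadd_right superadd_one st], of K]
    unfolding form_trace[of _ "\<lambda>x. pw x s" "\<lambda>x. pw x t" K] L_def e .
qed

text \<open>The shift by \<open>e\<close> makes the negative power meaningful on singular matrices.\<close>

theorem Ando_convexity:
  fixes K :: "complex^'m^'n"
  assumes psd: "A1 \<in> psd" "A2 \<in> psd" "X1 \<in> psd" "X2 \<in> psd" and uv: "0 \<le> u" "0 \<le> v" "u + v = 1"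
    and p: "1 \<le> p" "p \<le> 2" and t: "0 \<le> t" "t \<le> p - 1" and e: "0 < e"
  defines "L \<equiv> \<lambda>A X. Re (trace (adj K ** mpow A p ** K ** fun_calc (\<lambda>x. (x + e) powr (- t)) X))"
  shows "L (u *\<^sub>R A1 + v *\<^sub>R A2) (u *\<^sub>R X1 + v *\<^sub>R X2) \<le> u * L A1 X1 + v * L A2 X2"
proof -
  obtain A X U V a x where mm: "matrix_mixture A X U V a x u v"
    and eqs: "A 0 = u *\<^sub>R A1 + v *\<^sub>R A2" "A 1 = A1" "A 2 = A2"
      "X 0 = u *\<^sub>R X1 + v *\<^sub>R X2" "X 1 = X1" "X 2 = X2"
    using psd_mixture[OF psd uv] by metis
  interpret matrix_mixture A X U V a x u v by (rule mm)
  have "superadd (\<lambda>w ij. x w (snd ij) + e)"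
    using superadd_add[OF superadd_right superadd_scale[OF superadd_one, of e]] e by simp
  \<comment> \<open>Dividing a^2 by a^(2-p) (x+e)^t leaves the wanted coefficient. The condition (2
    - p) + t \<le> 1 on the denominator is t \<le> p - 1, and p \<le> 2 makes the exponent 2 - p
    nonnegative.\<close>
  from superadd_powers[OF superadd_left this superadd_one, of "2 - p" t]
  have G: "superadd (\<lambda>w ij. pw (a w (fst ij)) (2 - p) * pw (x w (snd ij) + e) t)"
    using p t by simp
  have "a w i = 0" if "pw (a w i) (2 - p) * pw (x w j + e) t = 0" for w i j
    using that e x[of w j] by (auto simp: pw_def split: if_splits)
  from subadd_square_over[OF form_left_affine G this]
  have *: "form 0 (\<lambda>w ij. (a w (fst ij))\<^sup>2 / (pw (a w (fst ij)) (2 - p) * pw (x w (snd ij) + e) t)) K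
    \<le> u * form 1 (\<lambda>w ij. (a w (fst ij))\<^sup>2 / (pw (a w (fst ij)) (2 - p) * pw (x w (snd ij) + e) t)) K
    + v * form 2 (\<lambda>w ij. (a w (fst ij))\<^sup>2 / (pw (a w (fst ij)) (2 - p) * pw (x w (snd ij) + e) t)) K"
    by simp
  have "(a w i)\<^sup>2 / (pw (a w i) (2 - p) * pw (x w j + e) t) = a w i powr p * (x w j + e) powr (- t)"
    for w i j
  proof (cases "a w i = 0")
    case False
    then have pos: "0 < a w i" "0 < x w j + e"
      using a[of w i] x[of w j] e by auto
    then have "(a w i)\<^sup>2 / pw (a w i) (2 - p) = a w i powr p"
      by (simp add: pw_def powr_diff flip: powr_numeral)
    moreover have "pw (x w j + e) t = (x w j + e) powr t"
      using pos by (simp add: pw_def)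
    ultimately show ?thesis
      by (simp add: powr_minus divide_inverse mult_ac)
  qed simp
  with * show ?thesis
    unfolding L_def eqs mpow_def
    by (simp only: form_trace[of _ "\<lambda>x. x powr p" "\<lambda>x. (x + e) powr (- t)" K] eqs)
qed

lemma fun_calc_mult: "A \<in> psd \<Longrightarrow> fun_calc f A ** fun_calc g A = fun_calc (\<lambda>x. f x * g x) A"
  by (erule psd_spec) (simp add: fun_calc_spec spec_mult)

text \<open>Absorbing the square root \<open>S\<close> of \<open>fun_calc g X\<close> into
  \<open>K\<close> leaves operator convexity of the p-th power, tested on \<open>K ** S\<close>.
  This is \<open>Ando_convexity\<close> with exponent 0, where the second factor is the
  identity.\<close>

lemma mpow_operator_convex:
  fixes K :: "complex^'m^'n"
  assumes psd: "A1 \<in> psd" "A2 \<in> psd" "X \<in> psd" and uv: "0 \<le> u" "0 \<le> v" "u + v = 1"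
    and p: "1 \<le> p" "p \<le> 2" and g: "\<And>x. 0 \<le> g x"
  defines "L \<equiv> \<lambda>A. Re (trace (adj K ** mpow A p ** K ** fun_calc g X))"
  shows "L (u *\<^sub>R A1 + v *\<^sub>R A2) \<le> u * L A1 + v * L A2"
proof -
  define S where "S = fun_calc (\<lambda>x. sqrt (g x)) X"
  have "S \<in> psd"
    using psd(3) g by (simp add: S_def fun_calc_in_psd)
  then have "adj S = S"
    by (simp add: psd_def hermitian_def)
  moreover have "S ** S = fun_calc g X"
    using psd(3) g by (simp add: S_def fun_calc_mult flip: power2_eq_square)
  ultimately have L: "L A = Re (trace (adj (K ** S) ** mpow A p ** (K ** S)))" for A
    using trace_mult_comm[of S "adj K ** mpow A p ** K ** S"]
    by (simp add: L_def adj_mult matrix_mul_assoc) (simp flip: matrix_mul_assoc)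
  have "fun_calc (\<lambda>x. (x + 1) powr (- 0)) 0 = (mat 1 :: complex^'m^'m)"
    using fun_calc_cong[OF psd_0, of "\<lambda>x. (x + 1) powr (- 0)" "\<lambda>_. 1"] by (simp add: psd_0)
  then show ?thesis
    using Ando_convexity[OF psd(1,2) psd_0 psd_0 uv p order_refl _ zero_less_one, of "K ** S"] p
    by (simp only: L scaleR_zero_right add_0 matrix_mul_rid)
qed

section \<open>Variational formulas for traces of powers\<close>

text \<open>Young's inequality with weights 1/r and 1 - 1/r, applied to y^r and x. For r = 1 both
  sides equal y, by the convention of \<open>pw\<close> also at x = 0.\<close>

lemma Young_powr:
  fixes r x y e :: real
  assumes "1 \<le> r" "0 \<le> x" "0 \<le> y"
  shows "r * (y * pw x (1 - 1 / r)) \<le> y powr r + (r - 1) * x"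
proof (cases "r = 1 \<or> x = 0 \<or> y = 0")
  case True
  then show ?thesis using assms by (auto simp: pw_def)
next
  case False
  with assms have r: "1 < r" "0 < x" "0 < y" by auto
  have "(y powr r) powr (1 / r) * x powr (1 - 1 / r) \<le> 1 / r * y powr r + (1 - 1 / r) * x"
    using r by (intro Youngs_inequality_0) auto
  then have "y * x powr (1 - 1 / r) \<le> 1 / r * y powr r + (1 - 1 / r) * x"
    using r by (simp add: powr_powr)
  then have "r * (y * x powr (1 - 1 / r)) \<le> r * (1 / r * y powr r + (1 - 1 / r) * x)"
    using r by (intro mult_left_mono) auto
  also have "\<dots> = y powr r + (r - 1) * x"
    using r by (simp add: field_simps)
  finally show ?thesis using r by (simp add: pw_def)
qed

lemma Young_powr_eq: "1 \<le> r \<Longrightarrow> 0 \<le> y \<Longrightarrow> y * pw (y powr r) (1 - 1 / r) = y powr r"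
proof (cases "y = 0 \<or> r = 1")
  case False
  moreover assume "1 \<le> r" "0 \<le> y"
  ultimately have "0 < y" "1 < r" by auto
  moreover from this have "r * (1 - 1 / r) = r - 1"
    by (simp add: field_simps)
  ultimately show ?thesis
    by (simp add: pw_def powr_powr powr_diff)
qed (auto simp: pw_def)

text \<open>Young's inequality with weights r and 1 - r, applied to y x^(1-1/r) and x: the powers of
  x cancel on the smaller side. The negative power forces x > 0, whence the shifts by
  \<open>e\<close> below.\<close>

lemma Young_powr_neg:
  fixes r x y e :: real
  assumes "0 < r" "r < 1" "0 < x" "0 \<le> y"
  shows "y powr r \<le> r * (y * x powr (- (1 / r - 1))) + (1 - r) * x"
proof (cases "y = 0")
  case False
  with assms have y: "0 < y" by (simp add: less_le)
  have "(y * x powr (- (1 / r - 1))) powr r * x powr (1 - r)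
      \<le> r * (y * x powr (- (1 / r - 1))) + (1 - r) * x"
    using assms y by (intro Youngs_inequality_0) auto
  also have "(y * x powr (- (1 / r - 1))) powr r * x powr (1 - r) = y powr r"
  proof -
    have "- (1 / r - 1) * r + (1 - r) = 0"
      using assms by (simp add: field_simps)
    then have "x powr (- (1 / r - 1) * r) * x powr (1 - r) = 1"
      using assms by (simp only: powr_add[symmetric]) simp
    then show ?thesis
      using assms y by (simp add: powr_mult powr_powr mult.assoc)
  qed
  finally show ?thesis .
qed (use assms in simp)

text \<open>At x = y^r the product y x^(1-1/r) would be exactly y^r. Shifting the base of a negative
  power only decreases it, so the bound survives in the direction that is needed.\<close>

lemma Young_powr_neg_shift:
  fixes r x y e :: real
  assumes "0 < r" "r < 1" "0 \<le> y" "0 < e"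
  shows "r * (y * (y powr r + e) powr (- (1 / r - 1))) \<le> r * y powr r"
proof (cases "y = 0")
  case False
  with assms have y: "0 < y" by (simp add: less_le)
  have r: "0 \<le> 1 / r - 1"
    using assms by (simp add: field_simps)
  have "(y powr r + e) powr (- (1 / r - 1)) \<le> (y powr r) powr (- (1 / r - 1))"
    using assms y r by (intro powr_mono2') auto
  also have "\<dots> = y powr (r - 1)"
    using assms by (simp add: powr_powr algebra_simps)
  finally have "y * (y powr r + e) powr (- (1 / r - 1)) \<le> y * y powr (r - 1)"
    using y by (intro mult_left_mono) auto
  also have "\<dots> = y powr r"
    using y by (simp add: powr_diff)
  finally show ?thesis
    using assms by simp
qed simp

text \<open>Three specialisations are in view: a single \<open>K\<close> for \<open>Upsilon\<close>,
  identities with varying \<open>A j\<close> for \<open>Phi\<close>, and isometries with one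
  repeated matrix for \<open>Psi\<close>.\<close>

definition kraus_pow :: "real \<Rightarrow> ('j::finite \<Rightarrow> complex^'m^'n) \<Rightarrow> ('j \<Rightarrow> complex^'n^'n) \<Rightarrow> complex^'m^'m" where
  "kraus_pow p K A = (\<Sum>j\<in>UNIV. adj (K j) ** mpow (A j) p ** K j)"

definition kraus_trace :: "real \<Rightarrow> real \<Rightarrow> ('j::finite \<Rightarrow> complex^'m^'n) \<Rightarrow> ('j \<Rightarrow> complex^'n^'n) \<Rightarrow> real" where
  "kraus_trace p q K A = Re (trace (mpow (kraus_pow p K A) (q / p)))"

lemma kraus_pow_psd: "(\<And>j. A j \<in> psd) \<Longrightarrow> kraus_pow p K A \<in> psd"
  unfolding kraus_pow_def by (intro psd_sum psd_congruence mpow_in_psd) auto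

lemma kraus_pow_trace:
  "Re (trace (kraus_pow p K A ** G)) = (\<Sum>j\<in>UNIV. Re (trace (adj (K j) ** mpow (A j) p ** K j ** G)))"
  by (simp add: kraus_pow_def matrix_sum_left trace_sum)

lemma trace_powr_ge:
  fixes Y X :: "complex^'n^'n"
  assumes Y: "Y \<in> psd" and X: "X \<in> psd" and r: "1 \<le> r"
  shows "r * Re (trace (Y ** fun_calc (\<lambda>x. pw x (1 - 1 / r)) X)) - (r - 1) * Re (trace X)
       \<le> Re (trace (mpow Y r))"
proof -
  obtain y x :: "'n \<Rightarrow> real" and w :: "'n \<Rightarrow> 'n \<Rightarrow> real" where yx: "\<And>i. 0 \<le> y i" "\<And>j. 0 \<le> x j" "\<And>i j. 0 \<le> w i j"
    and tr: "\<And>f g. Re (trace (fun_calc f Y ** fun_calc g X)) = (\<Sum>i\<in>UNIV. \<Sum>j\<in>UNIV. f (y i) * g (x j) * w i j)"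
    and trY: "\<And>f. Re (trace (fun_calc f Y)) = (\<Sum>i\<in>UNIV. \<Sum>j\<in>UNIV. f (y i) * w i j)"
    and trX: "\<And>g. Re (trace (fun_calc g X)) = (\<Sum>i\<in>UNIV. \<Sum>j\<in>UNIV. g (x j) * w i j)"
    using that by (rule joint_spectrum[OF Y X])
  have "(\<Sum>i\<in>UNIV. \<Sum>j\<in>UNIV. r * (y i * pw (x j) (1 - 1 / r)) * w i j)
     \<le> (\<Sum>i\<in>UNIV. \<Sum>j\<in>UNIV. (y i powr r + (r - 1) * x j) * w i j)"
    using r yx by (intro sum_mono mult_right_mono Young_powr) auto
  then show ?thesis
    using tr[of "\<lambda>x. x" "\<lambda>x. pw x (1 - 1 / r)"] trX[of "\<lambda>x. x"] trY[of "\<lambda>y. y powr r"] Y X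
    by (simp add: mpow_def distrib_right sum.distrib sum_distrib_left mult.assoc)
qed

lemma trace_powr_eq:
  assumes Y: "Y \<in> psd" and r: "1 \<le> r"
  shows "r * Re (trace (Y ** fun_calc (\<lambda>x. pw x (1 - 1 / r)) (mpow Y r))) - (r - 1) * Re (trace (mpow Y r))
       = Re (trace (mpow Y r))"
proof -
  have "Y ** fun_calc (\<lambda>x. pw x (1 - 1 / r)) (mpow Y r)
      = fun_calc (\<lambda>y. y) Y ** fun_calc (\<lambda>y. pw (y powr r) (1 - 1 / r)) Y"
    using Y by (simp add: mpow_def fun_calc_comp)
  also have "\<dots> = fun_calc (\<lambda>y. y * pw (y powr r) (1 - 1 / r)) Y"
    using Y by (rule fun_calc_mult)
  also have "\<dots> = mpow Y r"
    unfolding mpow_def using Y r by (intro fun_calc_cong Young_powr_eq)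
  finally show ?thesis
    by (simp add: algebra_simps)
qed

lemma trace_powr_le:
  fixes Y X :: "complex^'n^'n"
  assumes Y: "Y \<in> psd" and X: "X \<in> psd" and r: "0 < r" "r < 1" and e: "0 < e"
  shows "Re (trace (mpow Y r)) \<le> r * Re (trace (Y ** fun_calc (\<lambda>x. (x + e) powr (- (1 / r - 1))) X))
       + (1 - r) * Re (trace (fun_calc (\<lambda>x. x + e) X))"
proof -
  obtain y x :: "'n \<Rightarrow> real" and w :: "'n \<Rightarrow> 'n \<Rightarrow> real" where yx: "\<And>i. 0 \<le> y i" "\<And>j. 0 \<le> x j" "\<And>i j. 0 \<le> w i j"
    and tr: "\<And>f g. Re (trace (fun_calc f Y ** fun_calc g X)) = (\<Sum>i\<in>UNIV. \<Sum>j\<in>UNIV. f (y i) * g (x j) * w i j)"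
    and trY: "\<And>f. Re (trace (fun_calc f Y)) = (\<Sum>i\<in>UNIV. \<Sum>j\<in>UNIV. f (y i) * w i j)"
    and trX: "\<And>g. Re (trace (fun_calc g X)) = (\<Sum>i\<in>UNIV. \<Sum>j\<in>UNIV. g (x j) * w i j)"
    using that by (rule joint_spectrum[OF Y X])
  have "(\<Sum>i\<in>UNIV. \<Sum>j\<in>UNIV. y i powr r * w i j)
     \<le> (\<Sum>i\<in>UNIV. \<Sum>j\<in>UNIV. (r * (y i * (x j + e) powr (- (1 / r - 1))) + (1 - r) * (x j + e)) * w i j)"
    using r yx e by (intro sum_mono mult_right_mono Young_powr_neg) (auto simp: add_nonneg_pos)
  also have "\<dots> = r * (\<Sum>i\<in>UNIV. \<Sum>j\<in>UNIV. y i * (x j + e) powr (- (1 / r - 1)) * w i j)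
      + (1 - r) * (\<Sum>i\<in>UNIV. \<Sum>j\<in>UNIV. (x j + e) * w i j)"
    unfolding sum_distrib_left sum.distrib[symmetric]
    by (intro sum.cong refl) (simp add: algebra_simps)
  finally show ?thesis
    using tr[of "\<lambda>x. x" "\<lambda>x. (x + e) powr (- (1 / r - 1))"] trX[of "\<lambda>x. x + e"] trY[of "\<lambda>y. y powr r"] Y X
    by (simp add: mpow_def)
qed

lemma trace_fun_calc_mono:
  assumes "Y \<in> psd" "\<And>y. 0 \<le> y \<Longrightarrow> f y \<le> g y"
  shows "Re (trace (fun_calc f Y)) \<le> Re (trace (fun_calc g Y))"
  using psd_spec[OF assms(1)]
  by (metis (no_types, lifting) Re_complex_of_real assms(2) fun_calc_spec sum_mono trace_spec)

lemma trace_shift: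
  fixes Y :: "complex^'n^'n"
  assumes "Y \<in> psd" shows "Re (trace (fun_calc (\<lambda>x. f x + e) Y)) = Re (trace (fun_calc f Y)) + real CARD('n) * e"
proof -
  obtain U d where "unitary U" "Y = spec U d"
    using assms psd_spec by metis
  then show ?thesis
    by (simp add: fun_calc_spec trace_spec sum.distrib)
qed

context
  fixes K :: "'j::finite \<Rightarrow> complex^'m^'n" and A1 A2 :: "'j \<Rightarrow> complex^'n^'n" and u v :: real
  assumes A1: "\<And>j. A1 j \<in> psd" and A2: "\<And>j. A2 j \<in> psd" and uv: "0 \<le> u" "0 \<le> v" "u + v = 1"
begin

abbreviation mix :: "'j \<Rightarrow> complex^'n^'n" where
  "mix \<equiv> \<lambda>j. u *\<^sub>R A1 j + v *\<^sub>R A2 j"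

lemma mix_psd: "mix j \<in> psd"
  using A1 A2 uv by (intro psd_add psd_scaleR) auto

lemma uv_cancel: "u * (x - c) + v * (y - c) = (u * x + v * y) - c"
proof -
  have "u * (x - c) + v * (y - c) = (u * x + v * y) - (u + v) * c"
    by (simp add: algebra_simps)
  with uv show ?thesis by simp
qed

text \<open>A supremum over \<open>X\<close> of a function jointly concave in \<open>A\<close> and
  \<open>X\<close> is concave in \<open>A\<close>: the mixture of the maximisers \<open>X1\<close>
  and \<open>X2\<close> of the two ends is a candidate in the middle.\<close>

theorem kraus_trace_concave:
  assumes pq: "0 < p" "p \<le> q" "q \<le> 1"
  shows "u * kraus_trace p q K A1 + v * kraus_trace p q K A2 \<le> kraus_trace p q K mix"
proof -
  define r where "r = q / p"
  have r: "1 \<le> r" using pq by (simp add: r_def)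
  define t where "t = 1 - 1 / r"
  have t: "0 \<le> t" "p + t \<le> 1"
  proof -
    \<comment> \<open>Here p + t = 1 + p - p/q, so Lieb's condition p + t \<le> 1 amounts to q \<le>
      1.\<close>
    have "p \<le> p / q" using pq by (simp add: field_simps)
    then show "p + t \<le> 1" using pq by (simp add: t_def r_def)
  qed (use r in \<open>simp add: t_def\<close>)
  define Y where "Y A = kraus_pow p K A" for A
  have Y: "Y A1 \<in> psd" "Y A2 \<in> psd" "Y mix \<in> psd"
    using A1 A2 mix_psd by (simp_all add: Y_def kraus_pow_psd)
  define X1 X2 where "X1 = mpow (Y A1) r" and "X2 = mpow (Y A2) r"
  have X: "X1 \<in> psd" "X2 \<in> psd" "u *\<^sub>R X1 + v *\<^sub>R X2 \<in> psd"
    using Y uv by (simp_all add: X1_def X2_def mpow_in_psd psd_add psd_scaleR)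
  define L where "L A X = Re (trace (Y A ** fun_calc (\<lambda>x. pw x t) X))" for A X
  have mp: "mpow A p = fun_calc (\<lambda>x. pw x p) A" for A :: "complex^'n^'n"
    using pq by (simp add: mpow_def pw_def)
  have "u * L A1 X1 + v * L A2 X2 \<le> L mix (u *\<^sub>R X1 + v *\<^sub>R X2)"
    unfolding L_def Y_def kraus_pow_trace sum_distrib_left sum.distrib[symmetric] mp
    using pq t by (intro sum_mono Lieb_concavity A1 A2 X uv) auto
  then have *: "r * (u * L A1 X1 + v * L A2 X2) \<le> r * L mix (u *\<^sub>R X1 + v *\<^sub>R X2)"
    using r by simp
  have "u * kraus_trace p q K A1 + v * kraus_trace p q K A2
      = u * (r * L A1 X1 - (r - 1) * Re (trace X1)) + v * (r * L A2 X2 - (r - 1) * Re (trace X2))"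
    using trace_powr_eq[OF Y(1) r] trace_powr_eq[OF Y(2) r]
    by (simp add: kraus_trace_def L_def X1_def X2_def Y_def r_def t_def)
  also have "\<dots> = r * (u * L A1 X1 + v * L A2 X2) - (r - 1) * Re (trace (u *\<^sub>R X1 + v *\<^sub>R X2))"
    by (simp add: trace_add trace_scaleR algebra_simps)
  also have "\<dots> \<le> r * L mix (u *\<^sub>R X1 + v *\<^sub>R X2) - (r - 1) * Re (trace (u *\<^sub>R X1 + v *\<^sub>R X2))"
    using * by simp
  also have "\<dots> \<le> kraus_trace p q K mix"
    using trace_powr_ge[OF Y(3) X(3) r] by (simp add: kraus_trace_def L_def Y_def r_def t_def)
  finally show ?thesis .
qed

text \<open>For q \<ge> p the trace is a supremum over \<open>X\<close> of functions convex in
  \<open>A\<close> for fixed \<open>X\<close>, and the maximiser of the middle is used at both ends.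
  For q < p it is an infimum of a jointly convex function, and nearly optimal choices at the ends
  are mixed to give a candidate in the middle.\<close>

theorem kraus_trace_convex:
  assumes pq: "1 \<le> p" "p \<le> 2" "1 \<le> q"
  shows "kraus_trace p q K mix \<le> u * kraus_trace p q K A1 + v * kraus_trace p q K A2"
proof -
  define r where "r = q / p"
  define Y where "Y A = kraus_pow p K A" for A
  have Y: "Y A1 \<in> psd" "Y A2 \<in> psd" "Y mix \<in> psd"
    using A1 A2 mix_psd by (simp_all add: Y_def kraus_pow_psd)
  show ?thesis
  proof (cases "1 \<le> r")
    case r: True
    define t where "t = 1 - 1 / r"
    define X where "X = mpow (Y mix) r"
    have X: "X \<in> psd"
      using Y by (simp add: X_def mpow_in_psd)
    define L where "L A = Re (trace (Y A ** fun_calc (\<lambda>x. pw x t) X))" for A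
    have "L mix \<le> u * L A1 + v * L A2"
      unfolding L_def Y_def kraus_pow_trace sum_distrib_left sum.distrib[symmetric]
      using pq by (intro sum_mono mpow_operator_convex A1 A2 X uv) auto
    then have *: "r * L mix \<le> r * (u * L A1 + v * L A2)"
      using r by simp
    have "kraus_trace p q K mix = r * L mix - (r - 1) * Re (trace X)"
      using trace_powr_eq[OF Y(3) r]
      by (simp add: kraus_trace_def L_def X_def Y_def r_def t_def)
    also have "\<dots> \<le> r * (u * L A1 + v * L A2) - (r - 1) * Re (trace X)"
      using * by simp
    also have "\<dots> = u * (r * L A1 - (r - 1) * Re (trace X)) + v * (r * L A2 - (r - 1) * Re (trace X))"
      unfolding uv_cancel by (simp add: algebra_simps)
    also have "\<dots> \<le> u * kraus_trace p q K A1 + v * kraus_trace p q K A2"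
      using trace_powr_ge[OF Y(1) X r] trace_powr_ge[OF Y(2) X r] uv
      by (intro add_mono mult_left_mono) (auto simp: kraus_trace_def L_def Y_def r_def t_def)
    finally show ?thesis .
  next
    case False
    then have r: "0 < r" "r < 1" using pq by (auto simp: r_def)
    define t where "t = 1 / r - 1"
    \<comment> \<open>With t = p/q - 1, the condition t \<le> p - 1 of Ando's theorem follows from q
      \<ge> 1.\<close>
    have "p / q \<le> p" using pq by (simp add: field_simps)
    then have t: "0 \<le> t" "t \<le> p - 1"
      using r pq by (auto simp: t_def r_def field_simps)
    define X1 X2 where "X1 = mpow (Y A1) r" and "X2 = mpow (Y A2) r"
    have X: "X1 \<in> psd" "X2 \<in> psd" "u *\<^sub>R X1 + v *\<^sub>R X2 \<in> psd"
      using Y uv by (simp_all add: X1_def X2_def mpow_in_psd psd_add psd_scaleR)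
    \<comment> \<open>The shift by \<open>e\<close> enters the linear term once for each eigenvalue;
      this error is removed at the end, \<open>e\<close> being arbitrarily small.\<close>
    have bound: "kraus_trace p q K mix
        \<le> u * kraus_trace p q K A1 + v * kraus_trace p q K A2 + (1 - r) * (real CARD('m) * e)"
      if e: "0 < e" for e
    proof -
      define L where "L A X = Re (trace (Y A ** fun_calc (\<lambda>x. (x + e) powr (- t)) X))" for A X
      have "L mix (u *\<^sub>R X1 + v *\<^sub>R X2) \<le> u * L A1 X1 + v * L A2 X2"
        unfolding L_def Y_def kraus_pow_trace sum_distrib_left sum.distrib[symmetric]
        using pq t e by (intro sum_mono Ando_convexity A1 A2 X uv) auto
      then have 1: "r * L mix (u *\<^sub>R X1 + v *\<^sub>R X2) \<le> r * (u * L A1 X1 + v * L A2 X2)"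
        using r by simp
      have 2: "r * L A (mpow (Y A) r) \<le> r * Re (trace (mpow (Y A) r))" if "Y A \<in> psd" for A
      proof -
        have "L A (mpow (Y A) r) = Re (trace (fun_calc (\<lambda>y. y * (y powr r + e) powr (- t)) (Y A)))"
          using that fun_calc_mult[of "Y A" "\<lambda>y. y" "\<lambda>y. (y powr r + e) powr (- t)"]
          by (simp add: L_def mpow_def fun_calc_comp)
        also have "\<dots> \<le> Re (trace (mpow (Y A) r))"
          unfolding mpow_def
          using that r e Young_powr_neg_shift[OF r _ e]
          by (intro trace_fun_calc_mono) (auto simp: t_def)
        finally show ?thesis using r by simp
      qed
      have 3: "r * L A (mpow (Y A) r) + (1 - r) * Re (trace (mpow (Y A) r)) \<le> kraus_trace p q K A"
        if "Y A \<in> psd" for A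
        using 2[OF that] by (simp only: kraus_trace_def Y_def r_def left_diff_distrib)
      have sh: "Re (trace (fun_calc (\<lambda>x. x + e) X)) = Re (trace X) + real CARD('m) * e"
        if "X \<in> psd" for X :: "complex^'m^'m"
        using trace_shift[OF that, of "\<lambda>x. x" e] that by simp
      have tr: "Re (trace (u *\<^sub>R X1 + v *\<^sub>R X2)) = u * Re (trace X1) + v * Re (trace X2)"
        by (simp add: trace_add trace_scaleR)
      have "kraus_trace p q K mix \<le> r * L mix (u *\<^sub>R X1 + v *\<^sub>R X2)
          + (1 - r) * (Re (trace (u *\<^sub>R X1 + v *\<^sub>R X2)) + real CARD('m) * e)"
        using trace_powr_le[OF Y(3) X(3) r e] unfolding sh[OF X(3)]
        by (simp only: kraus_trace_def L_def Y_def r_def t_def)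
      also have "\<dots> \<le> r * (u * L A1 X1 + v * L A2 X2)
          + (1 - r) * (Re (trace (u *\<^sub>R X1 + v *\<^sub>R X2)) + real CARD('m) * e)"
        using 1 by simp
      also have "\<dots> = u * (r * L A1 X1 + (1 - r) * Re (trace X1)) + v * (r * L A2 X2 + (1 - r) * Re (trace X2))
          + (1 - r) * (real CARD('m) * e)"
        unfolding tr by (simp add: algebra_simps)
      also have "\<dots> \<le> u * kraus_trace p q K A1 + v * kraus_trace p q K A2 + (1 - r) * (real CARD('m) * e)"
        using 3[OF Y(1)] 3[OF Y(2)] uv unfolding X1_def X2_def
        by (intro add_mono mult_left_mono order_refl)
      finally show ?thesis .
    qed
    show ?thesis
    proof (rule field_le_epsilon)
      fix d :: real assume d: "0 < d"
      have c: "0 < (1 - r) * real CARD('m)" using r by simp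
      have "kraus_trace p q K mix \<le> u * kraus_trace p q K A1 + v * kraus_trace p q K A2
          + (1 - r) * (real CARD('m) * (d / ((1 - r) * real CARD('m))))"
        using c d by (intro bound) simp
      also have "(1 - r) * (real CARD('m) * (d / ((1 - r) * real CARD('m)))) = d"
        using r by simp
      finally show "kraus_trace p q K mix \<le> u * kraus_trace p q K A1 + v * kraus_trace p q K A2 + d" .
    qed
  qed
qed

end

section \<open>Convexity and concavity of the three functions\<close>

lemma homogeneous_root_scale:
  fixes N :: "'a::real_vector \<Rightarrow> real"
  assumes "0 < q" and hom: "N (c *\<^sub>R x) = c powr q * N x" and "0 < c" "0 \<le> N x"
  shows "N (c *\<^sub>R x) powr (1 / q) = c * N x powr (1 / q)"
  using assms by (simp add: powr_mult powr_powr)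

text \<open>A nonnegative function that is homogeneous of degree one is convex (concave) as soon as one
  of its positive powers is, because convexity then only concerns its sublevel (superlevel) sets.\<close>

lemma homogeneous_root_convex:
  fixes N :: "'a::real_vector \<Rightarrow> real"
  assumes q: "0 < q" and N: "convex_on S N"
    and cone: "\<And>x c. x \<in> S \<Longrightarrow> 0 < c \<Longrightarrow> c *\<^sub>R x \<in> S"
    and nonneg: "\<And>x. x \<in> S \<Longrightarrow> 0 \<le> N x"
    and hom: "\<And>x c. x \<in> S \<Longrightarrow> 0 < c \<Longrightarrow> N (c *\<^sub>R x) = c powr q * N x"
  shows "convex_on S (\<lambda>x. N x powr (1 / q))"
proof (rule convex_onI)
  show "convex S" using N by (simp add: convex_on_def)
  define f where "f x = N x powr (1 / q)" for x
  have scale: "f (c *\<^sub>R x) = c * f x" if "x \<in> S" "0 < c" for x c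
    unfolding f_def using that by (intro homogeneous_root_scale q hom nonneg)
  have fN: "N x = f x powr q" if "x \<in> S" for x
    using q nonneg[OF that] by (simp add: f_def powr_powr)
  have f_ge0: "0 \<le> f x" for x
    by (simp add: f_def)
  have sub: "f (x + y) \<le> f x + f y" if x: "x \<in> S" and y: "y \<in> S" for x y
  proof (rule field_le_epsilon)
    fix e :: real assume "0 < e"
    \<comment> \<open>After the shift both scales are positive even where \<open>f\<close> vanishes.
      Then x / a and y / b lie in the sublevel set N \<le> 1, and (x + y) / (a + b) is a convex
      combination of them.\<close>
    define a b where "a = f x + e / 2" and "b = f y + e / 2"
    have f0: "0 \<le> f x" "0 \<le> f y" by (auto simp: f_def)
    have ab: "0 < a" "0 < b" "f x \<le> a" "f y \<le> b"
      using \<open>0 < e\<close> f0 by (auto simp: a_def b_def add_nonneg_pos)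
    define s where "s = a + b"
    have s: "0 < s" using ab by (simp add: s_def)
    have unit: "a / s + b / s = 1"
      using s by (simp add: s_def add_divide_distrib[symmetric])
    have bound: "N ((1 / c) *\<^sub>R z) \<le> 1" if "z \<in> S" "0 < c" "f z \<le> c" for z c
    proof -
      have "N ((1 / c) *\<^sub>R z) = (f z / c) powr q"
        using that hom[of z "1 / c"] q by (simp add: fN powr_divide f_ge0)
      also have "\<dots> \<le> 1 powr q"
        using that q by (intro powr_mono2) (auto simp: f_def)
      finally show ?thesis by simp
    qed
    have "(a / s) *\<^sub>R ((1 / a) *\<^sub>R x) + (b / s) *\<^sub>R ((1 / b) *\<^sub>R y) = (1 / s) *\<^sub>R (x + y)"
      using ab by (simp add: scaleR_add_right)
    moreover have "N ((a / s) *\<^sub>R ((1 / a) *\<^sub>R x) + (b / s) *\<^sub>R ((1 / b) *\<^sub>R y))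
        \<le> (a / s) * N ((1 / a) *\<^sub>R x) + (b / s) * N ((1 / b) *\<^sub>R y)"
      using ab s x y cone unit by (intro N[unfolded convex_on_def, THEN conjunct2, rule_format]) auto
    moreover have "(a / s) * N ((1 / a) *\<^sub>R x) + (b / s) * N ((1 / b) *\<^sub>R y) \<le> (a / s) * 1 + (b / s) * 1"
      using ab s x y by (intro add_mono mult_left_mono bound) auto
    moreover have "(a / s) * 1 + (b / s) * 1 = 1"
      using unit by simp
    ultimately have "N ((1 / s) *\<^sub>R (x + y)) \<le> 1"
      by simp
    moreover have xy: "x + y \<in> S"
    proof -
      have "(1 / 2) *\<^sub>R (2 *\<^sub>R x) + (1 / 2) *\<^sub>R (2 *\<^sub>R y) \<in> S"
        using x y cone by (intro convexD[OF \<open>convex S\<close>]) auto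
      then show ?thesis by simp
    qed
    ultimately have "(f (x + y) / s) powr q \<le> 1"
      using s hom[of "x + y" "1 / s"] q by (simp add: fN powr_divide f_ge0)
    then have "((f (x + y) / s) powr q) powr (1 / q) \<le> 1 powr (1 / q)"
      using q by (intro powr_mono2) auto
    then have "f (x + y) / s \<le> 1"
      using q s by (simp add: powr_powr f_def)
    then show "f (x + y) \<le> f x + f y + e"
      using s by (simp add: s_def a_def b_def)
  qed
  fix t :: real and x y assume t: "0 < t" "t < 1" and xy: "x \<in> S" "y \<in> S"
  have "f ((1 - t) *\<^sub>R x + t *\<^sub>R y) \<le> f ((1 - t) *\<^sub>R x) + f (t *\<^sub>R y)"
    using t xy cone by (intro sub) auto
  also have "\<dots> = (1 - t) * f x + t * f y"
    using t xy by (simp only: scale diff_gt_0_iff_gt)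
  finally show "N ((1 - t) *\<^sub>R x + t *\<^sub>R y) powr (1 / q) \<le> (1 - t) * N x powr (1 / q) + t * N y powr (1 / q)"
    by (simp add: f_def)
qed

text \<open>Superlevel sets do not tolerate the shift used in the convex case. Points with f = 0 are
  handled by monotonicity along the cone instead, which concavity yields by giving almost all the
  weight to one summand.\<close>

lemma homogeneous_root_concave:
  fixes N :: "'a::real_vector \<Rightarrow> real"
  assumes q: "0 < q" "q \<le> 1" and N: "concave_on S N"
    and cone: "\<And>x c. x \<in> S \<Longrightarrow> 0 < c \<Longrightarrow> c *\<^sub>R x \<in> S"
    and nonneg: "\<And>x. x \<in> S \<Longrightarrow> 0 \<le> N x"
    and hom: "\<And>x c. x \<in> S \<Longrightarrow> 0 < c \<Longrightarrow> N (c *\<^sub>R x) = c powr q * N x"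
  shows "concave_on S (\<lambda>x. N x powr (1 / q))"
proof -
  have S: "convex S" using N by (simp add: concave_on_iff)
  define f where "f x = N x powr (1 / q)" for x
  have f0: "0 \<le> f x" for x by (simp add: f_def)
  have scale: "f (c *\<^sub>R x) = c * f x" if "x \<in> S" "0 < c" for x c
    unfolding f_def using that by (intro homogeneous_root_scale q hom nonneg)
  have fN: "N x = f x powr q" if "x \<in> S" for x
    using q nonneg[OF that] by (simp add: f_def powr_powr)
  have lower: "t * N ((1 / t) *\<^sub>R x) + (1 - t) * N ((1 / (1 - t)) *\<^sub>R y) \<le> N (x + y)"
    if "x \<in> S" "y \<in> S" "0 < t" "t < 1" for x y t
  proof -
    have "t * N ((1 / t) *\<^sub>R x) + (1 - t) * N ((1 / (1 - t)) *\<^sub>R y)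
        \<le> N (t *\<^sub>R ((1 / t) *\<^sub>R x) + (1 - t) *\<^sub>R ((1 / (1 - t)) *\<^sub>R y))"
      using that cone by (intro N[unfolded concave_on_iff, THEN conjunct2, rule_format]) auto
    also have "t *\<^sub>R ((1 / t) *\<^sub>R x) + (1 - t) *\<^sub>R ((1 / (1 - t)) *\<^sub>R y) = x + y"
      using that by simp
    finally show ?thesis .
  qed
  have mono: "f y \<le> f (x + y)" if x: "x \<in> S" and y: "y \<in> S" for x y
  proof -
    have "N y \<le> N (x + y)"
    proof (rule field_le_mult_one_interval)
      fix z :: real assume z: "0 < z" "z < 1"
      have "z * N y \<le> z * N ((1 / z) *\<^sub>R y)"
      proof -
        have "1 powr q \<le> (1 / z) powr q"
          using z q by (intro powr_mono2) auto
        then have "1 * N y \<le> (1 / z) powr q * N y"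
          using nonneg[OF y] by (intro mult_right_mono) auto
        then show ?thesis
          using z y hom[of y "1 / z"] by simp
      qed
      also have "\<dots> \<le> (1 - z) * N ((1 / (1 - z)) *\<^sub>R x) + z * N ((1 / z) *\<^sub>R y)"
        using z x cone by (simp add: nonneg)
      also have "\<dots> \<le> N (x + y)"
        using lower[OF x y, of "1 - z"] z by simp
      finally show "z * N y \<le> N (x + y)" .
    qed
    then show ?thesis
      using nonneg[OF y] q by (simp add: f_def powr_mono2)
  qed
  have super: "f x + f y \<le> f (x + y)" if x: "x \<in> S" and y: "y \<in> S" for x y
  proof (cases "f x = 0 \<or> f y = 0")
    case True
    then show ?thesis
      using mono[OF x y] mono[OF y x] by (auto simp: add.commute)
  next
    case False
    then have ab: "0 < f x" "0 < f y"
      using f0[of x] f0[of y] by (auto simp: less_le)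
    define s where "s = f x + f y"
    have s: "0 < s" using ab by (simp add: s_def)
    have scaled: "c * N ((1 / c) *\<^sub>R z) = c * s powr q" if "z \<in> S" "c = f z / s" "0 < f z" for z c
    proof -
      have "N ((1 / c) *\<^sub>R z) = (1 / c) powr q * N z"
        using that s by (intro hom) auto
      also have "\<dots> = (1 / c * f z) powr q"
        using that s by (subst powr_mult) (auto simp: fN)
      also have "1 / c * f z = s"
        using that s by simp
      finally show ?thesis by simp
    qed
    have t: "1 - f x / s = f y / s"
      using s by (simp add: s_def field_simps)
    have "s powr q = f x / s * s powr q + f y / s * s powr q"
      using s by (simp add: s_def add_divide_distrib[symmetric] flip: distrib_right)
    also have "\<dots> = f x / s * N ((1 / (f x / s)) *\<^sub>R x) + (1 - f x / s) * N ((1 / (1 - f x / s)) *\<^sub>R y)"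
      unfolding t scaled[OF x refl ab(1)] scaled[OF y refl ab(2)] ..
    also have "\<dots> \<le> N (x + y)"
      using ab by (intro lower x y) (auto simp: s_def)
    finally have "(s powr q) powr (1 / q) \<le> N (x + y) powr (1 / q)"
      using q by (intro powr_mono2) auto
    then show ?thesis
      using q s by (simp add: powr_powr f_def[of "x + y"] s_def)
  qed
  have "(1 - t) * f x + t * f y \<le> f ((1 - t) *\<^sub>R x + t *\<^sub>R y)"
    if t: "0 < t" "t < 1" and xy: "x \<in> S" "y \<in> S" for t x y
  proof -
    have "(1 - t) * f x + t * f y = f ((1 - t) *\<^sub>R x) + f (t *\<^sub>R y)"
      using t xy by (simp only: scale diff_gt_0_iff_gt)
    also have "\<dots> \<le> f ((1 - t) *\<^sub>R x + t *\<^sub>R y)"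
      using t xy cone by (intro super) auto
    finally show ?thesis .
  qed
  then show ?thesis
    unfolding concave_on_def by (intro convex_onI S) (simp add: f_def algebra_simps)
qed

lemma trace_psd_nonneg: "A \<in> psd \<Longrightarrow> 0 \<le> Re (trace A)"
  by (erule psd_spec) (simp add: trace_spec sum_nonneg)

lemma mpow_mult: "A \<in> psd \<Longrightarrow> mpow A s ** mpow A t = mpow A (s + t)"
  by (simp add: mpow_def fun_calc_mult powr_add)

lemma schatten_mpow:
  assumes S: "S \<in> psd" and "0 < p"
  shows "schatten q (mpow S (1 / p)) = Re (trace (mpow S (q / p))) powr (1 / q)"
proof -
  have "adj (mpow S (1 / p)) = mpow S (1 / p)"
    using mpow_in_psd[OF S] by (simp add: psd_def hermitian_def)
  then have "mpow (adj (mpow S (1 / p)) ** mpow S (1 / p)) (q / 2) = mpow S (q / p)"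
    using S \<open>0 < p\<close> by (simp add: mpow_mult mpow_mpow)
  then show ?thesis
    by (simp add: schatten_def)
qed

lemma kraus_trace_nonneg: "(\<And>j. A j \<in> psd) \<Longrightarrow> 0 \<le> kraus_trace p q K A"
  unfolding kraus_trace_def by (intro trace_psd_nonneg mpow_in_psd kraus_pow_psd)

lemma kraus_pow_scaleR:
  "(\<And>j. A j \<in> psd) \<Longrightarrow> 0 \<le> c \<Longrightarrow> kraus_pow p K (\<lambda>j. c *\<^sub>R A j) = c powr p *\<^sub>R kraus_pow p K A"
  by (simp add: kraus_pow_def mpow_scaleR matrix_scaleR_left matrix_scaleR_right scaleR_sum_right)

lemma kraus_trace_scaleR:
  assumes "\<And>j. A j \<in> psd" "0 < p" "0 < c"
  shows "kraus_trace p q K (\<lambda>j. c *\<^sub>R A j) = c powr q * kraus_trace p q K A"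
  using assms by (simp add: kraus_trace_def kraus_pow_scaleR mpow_scaleR kraus_pow_psd trace_scaleR powr_powr)

lemma Upsilon_kraus_trace: "Upsilon B p q A = kraus_trace p q (\<lambda>_::unit. B) (\<lambda>_. A)"
  by (simp add: Upsilon_def kraus_trace_def kraus_pow_def UNIV_unit)

lemma Phi_kraus_trace:
  assumes "A \<in> psd_tuples" "0 < p"
  shows "Phi p q A = kraus_trace p q (\<lambda>_. mat 1) (\<lambda>j. A $ j) powr (1 / q)"
proof -
  have "(\<Sum>j\<in>UNIV. mpow (A $ j) p) = kraus_pow p (\<lambda>_. mat 1) (\<lambda>j. A $ j)"
    by (simp add: kraus_pow_def)
  moreover have "kraus_pow p (\<lambda>_. mat 1) (\<lambda>j. A $ j) \<in> psd"
    using assms(1) by (intro kraus_pow_psd) (simp add: psd_tuples_def)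
  ultimately show ?thesis
    using assms(2) by (simp add: Phi_def schatten_mpow kraus_trace_def)
qed

text \<open>The isometry \<open>x \<mapsto> x \<otimes> e\<^sub>k\<close>.\<close>

definition tensor_unit :: "'n::finite \<Rightarrow> complex^'m^('m::finite \<times> 'n)" where
  "tensor_unit k = (\<chi> a j. if a = (j, k) then 1 else 0)"

lemma ptrace2_kraus: "ptrace2 A = (\<Sum>k\<in>UNIV. adj (tensor_unit k) ** A ** tensor_unit k)"
proof -
  have l: "(adj (tensor_unit k) ** A) $ i $ b = A $ (i, k) $ b"
    for A :: "complex^('m::finite \<times> 'n::finite)^('m \<times> 'n)" and k i b
  proof -
    have "(adj (tensor_unit k) ** A) $ i $ b = (\<Sum>a\<in>UNIV. if a = (i, k) then A $ a $ b else 0)"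
      unfolding matrix_matrix_mult_def vec_lambda_beta
      by (intro sum.cong refl) (simp add: tensor_unit_def)
    then show ?thesis by simp
  qed
  have r: "(A ** tensor_unit k) $ b $ j = A $ b $ (j, k)" for A :: "complex^('m::finite \<times> 'n::finite)^'m" and k b j
  proof -
    have "(A ** tensor_unit k) $ b $ j = (\<Sum>a\<in>UNIV. if a = (j, k) then A $ b $ a else 0)"
      unfolding matrix_matrix_mult_def vec_lambda_beta
      by (intro sum.cong refl) (simp add: tensor_unit_def)
    then show ?thesis by simp
  qed
  show ?thesis
    by (simp add: ptrace2_eq vec_eq_iff r l)
qed

lemma Psi_kraus_trace:
  fixes A :: "complex^('m::finite \<times> 'n::finite)^('m \<times> 'n)"
  assumes "A \<in> psd" "0 < p"
  shows "Psi p q A = kraus_trace p q tensor_unit (\<lambda>_::'n. A) powr (1 / q)"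
proof -
  have "ptrace2 (mpow A p) = kraus_pow p tensor_unit (\<lambda>_::'n. A)"
    by (simp add: ptrace2_kraus kraus_pow_def)
  moreover have "kraus_pow p tensor_unit (\<lambda>_::'n. A) \<in> psd"
    using assms(1) by (intro kraus_pow_psd)
  ultimately show ?thesis
    using assms(2) by (simp add: Psi_def schatten_mpow kraus_trace_def)
qed

lemma convex_on_cong_set: "(\<And>x. x \<in> S \<Longrightarrow> f x = g x) \<Longrightarrow> convex_on S g \<Longrightarrow> convex_on S f"
  by (simp add: convex_on_def convexD)

lemma concave_on_cong_set: "(\<And>x. x \<in> S \<Longrightarrow> f x = g x) \<Longrightarrow> concave_on S g \<Longrightarrow> concave_on S f"
  by (simp add: concave_on_iff convexD)

lemma Upsilon_convex: "1 \<le> p \<Longrightarrow> p \<le> 2 \<Longrightarrow> 1 \<le> q \<Longrightarrow> convex_on psd (Upsilon B p q)"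
  unfolding convex_on_def Upsilon_kraus_trace
  by (intro conjI convex_psd ballI allI impI kraus_trace_convex) auto

lemma Upsilon_concave: "0 < p \<Longrightarrow> p \<le> q \<Longrightarrow> q \<le> 1 \<Longrightarrow> concave_on psd (Upsilon B p q)"
  unfolding concave_on_iff Upsilon_kraus_trace
  by (intro conjI convex_psd ballI allI impI kraus_trace_concave) auto

lemma Phi_convex:
  assumes "1 \<le> p" "p \<le> 2" "1 \<le> q" shows "convex_on psd_tuples (Phi p q)"
proof (rule convex_on_cong_set)
  show "convex_on psd_tuples (\<lambda>A. kraus_trace p q (\<lambda>_. mat 1) (\<lambda>j. A $ j) powr (1 / q))"
  proof (rule homogeneous_root_convex)
    show "convex_on psd_tuples (\<lambda>A. kraus_trace p q (\<lambda>_. mat 1) (\<lambda>j. A $ j))"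
      using assms unfolding convex_on_def vector_add_component vector_scaleR_component
      by (intro conjI convex_psd_tuples ballI allI impI kraus_trace_convex) (auto simp: psd_tuples_def)
  qed (use assms in \<open>simp_all add: psd_scaleR psd_tuples_def kraus_trace_nonneg kraus_trace_scaleR\<close>)
qed (use assms in \<open>simp add: Phi_kraus_trace\<close>)

lemma Phi_concave:
  assumes "0 < p" "p \<le> q" "q \<le> 1" shows "concave_on psd_tuples (Phi p q)"
proof (rule concave_on_cong_set)
  show "concave_on psd_tuples (\<lambda>A. kraus_trace p q (\<lambda>_. mat 1) (\<lambda>j. A $ j) powr (1 / q))"
  proof (rule homogeneous_root_concave)
    show "concave_on psd_tuples (\<lambda>A. kraus_trace p q (\<lambda>_. mat 1) (\<lambda>j. A $ j))"
      using assms unfolding concave_on_iff vector_add_component vector_scaleR_component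
      by (intro conjI convex_psd_tuples ballI allI impI kraus_trace_concave) (auto simp: psd_tuples_def)
  qed (use assms in \<open>simp_all add: psd_scaleR psd_tuples_def kraus_trace_nonneg kraus_trace_scaleR\<close>)
qed (use assms in \<open>simp add: Phi_kraus_trace\<close>)

lemma Psi_convex:
  assumes "1 \<le> p" "p \<le> 2" "1 \<le> q" shows "convex_on psd (Psi p q)"
proof (rule convex_on_cong_set)
  show "convex_on psd (\<lambda>A. kraus_trace p q tensor_unit (\<lambda>_. A) powr (1 / q))"
  proof (rule homogeneous_root_convex)
    show "convex_on psd (\<lambda>A. kraus_trace p q tensor_unit (\<lambda>_. A))"
      using assms unfolding convex_on_def
      by (intro conjI convex_psd ballI allI impI kraus_trace_convex) auto
  qed (use assms in \<open>simp_all add: psd_scaleR kraus_trace_nonneg kraus_trace_scaleR\<close>)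
qed (use assms in \<open>simp add: Psi_kraus_trace\<close>)

lemma Psi_concave:
  assumes "0 < p" "p \<le> q" "q \<le> 1" shows "concave_on psd (Psi p q)"
proof (rule concave_on_cong_set)
  show "concave_on psd (\<lambda>A. kraus_trace p q tensor_unit (\<lambda>_. A) powr (1 / q))"
  proof (rule homogeneous_root_concave)
    show "concave_on psd (\<lambda>A. kraus_trace p q tensor_unit (\<lambda>_. A))"
      using assms unfolding concave_on_iff
      by (intro conjI convex_psd ballI allI impI kraus_trace_concave) auto
  qed (use assms in \<open>simp_all add: psd_scaleR kraus_trace_nonneg kraus_trace_scaleR\<close>)
qed (use assms in \<open>simp add: Psi_kraus_trace\<close>)

section \<open>Failure for exponents above two\<close>

text \<open>The matrices used below are padded with zeros, so 0 may be an eigenvalue, and their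
  annihilating polynomials are taken without constant term.\<close>

lemma fun_calc_cubic:
  "A \<in> psd \<Longrightarrow> fun_calc (\<lambda>x. u * (x * x * x) + v * (x * x) + w * x) A
    = u *\<^sub>R (A ** A ** A) + v *\<^sub>R (A ** A) + w *\<^sub>R A"
  by (erule psd_spec) (simp add: fun_calc_spec spec_mult spec_scaleR spec_add)

text \<open>If \<open>g\<close> annihilates \<open>A\<close>, the spectrum consists of zeros of
  \<open>g\<close>. Powers of concrete matrices can thus be read off an annihilating polynomial,
  without exhibiting eigenvectors.\<close>

lemma fun_calc_eq_on_zeros:
  assumes A: "A \<in> psd" and g: "fun_calc g A = 0" and fh: "\<And>x. 0 \<le> x \<Longrightarrow> g x = 0 \<Longrightarrow> f x = h x"
  shows "fun_calc f A = fun_calc h A"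
proof -
  obtain U d where U: "unitary U" "A = spec U d" and d: "\<And>i. 0 \<le> d i"
    using psd_spec[OF A] by metis
  have "adj U ** spec U (\<lambda>i. g (d i)) ** U = (adj U ** U) ** diag_real (\<lambda>i. g (d i)) ** (adj U ** U)"
    by (simp add: spec_def matrix_mul_assoc)
  then have "diag_real (\<lambda>i. g (d i)) = 0"
    using g U by (simp add: fun_calc_spec unitary_def)
  then have "diag_real (\<lambda>i. g (d i)) $ i $ i = 0" for i
    by simp
  then have "g (d i) = 0" for i
    by (simp add: diag_real_def)
  then have "f (d i) = h (d i)" for i
    using d fh by blast
  then show ?thesis
    by (simp add: U fun_calc_spec)
qed

lemma mpow_quadratic:
  assumes A: "A \<in> psd" "A ** A = k *\<^sub>R A" and k: "0 < k"
  shows "mpow A p = k powr (p - 1) *\<^sub>R A"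
proof -
  have "fun_calc (\<lambda>x. 0 * (x * x * x) + 1 * (x * x) + - k * x) A = 0"
    unfolding fun_calc_cubic[OF A(1)] using A(2) by simp
  then have "mpow A p = fun_calc (\<lambda>x. 0 * (x * x * x) + 0 * (x * x) + k powr (p - 1) * x) A"
    unfolding mpow_def
  proof (rule fun_calc_eq_on_zeros[OF A(1)])
    fix x :: real assume "0 * (x * x * x) + 1 * (x * x) + - k * x = 0"
    then have "x * (x - k) = 0" by (simp add: algebra_simps)
    then have "x = 0 \<or> x = k" by simp
    then show "x powr p = 0 * (x * x * x) + 0 * (x * x) + k powr (p - 1) * x"
      using k by (auto simp: powr_diff)
  qed
  then show ?thesis
    unfolding fun_calc_cubic[OF A(1)] by simp
qed

section \<open>Counterexamples on two coordinates\<close>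

text \<open>The padding with zeros lets one two by two computation serve every dimension from two
  on.\<close>

definition block2 :: "'n \<Rightarrow> 'n \<Rightarrow> real \<Rightarrow> real \<Rightarrow> real \<Rightarrow> real \<Rightarrow> complex^'n^'n" where
  "block2 a b x y z w = (\<chi> i j. of_real
     (if i = a then if j = a then x else if j = b then y else 0
      else if i = b then if j = a then z else if j = b then w else 0 else 0))"

context
  fixes a b :: "'n::finite"
  assumes ab: "a \<noteq> b"
begin

lemma block2_nth:
  "block2 a b x y z w $ a $ a = of_real x" "block2 a b x y z w $ a $ b = of_real y"
  "block2 a b x y z w $ b $ a = of_real z" "block2 a b x y z w $ b $ b = of_real w"
  "i \<noteq> a \<Longrightarrow> i \<noteq> b \<Longrightarrow> block2 a b x y z w $ i $ j = 0"
  "j \<noteq> a \<Longrightarrow> j \<noteq> b \<Longrightarrow> block2 a b x y z w $ i $ j = 0"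
  using ab by (auto simp: block2_def)

lemma matrix_eq_block2I:
  assumes "A $ a $ a = of_real x" "A $ a $ b = of_real y" "A $ b $ a = of_real z" "A $ b $ b = of_real w"
    "\<And>i j. i \<noteq> a \<Longrightarrow> i \<noteq> b \<Longrightarrow> A $ i $ j = 0" "\<And>i j. j \<noteq> a \<Longrightarrow> j \<noteq> b \<Longrightarrow> A $ i $ j = 0"
  shows "A = block2 a b x y z w"
proof -
  have "A $ i $ j = block2 a b x y z w $ i $ j" for i j
  proof (cases "(i = a \<or> i = b) \<and> (j = a \<or> j = b)")
    case True
    then show ?thesis using assms by (elim conjE disjE) (simp_all add: block2_nth)
  next
    case False
    then show ?thesis using assms by (auto simp: block2_nth)
  qed
  then show ?thesis by (simp add: vec_eq_iff)
qed

lemma block2_mult: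
  "block2 a b x y z w ** block2 a b x' y' z' w'
   = block2 a b (x * x' + y * z') (x * y' + y * w') (z * x' + w * z') (z * y' + w * w')"
proof -
  have e: "(block2 a b x y z w ** block2 a b x' y' z' w') $ i $ j
      = block2 a b x y z w $ i $ a * block2 a b x' y' z' w' $ a $ j
      + block2 a b x y z w $ i $ b * block2 a b x' y' z' w' $ b $ j" for i j
  proof -
    have "(block2 a b x y z w ** block2 a b x' y' z' w') $ i $ j
        = (\<Sum>k\<in>{a, b}. block2 a b x y z w $ i $ k * block2 a b x' y' z' w' $ k $ j)"
      unfolding matrix_matrix_mult_def vec_lambda_beta
      by (rule sum.mono_neutral_right) (auto simp: block2_nth)
    then show ?thesis using ab by simp
  qed
  show ?thesis
    by (rule matrix_eq_block2I) (simp_all add: e block2_nth)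
qed

lemma block2_add:
  "block2 a b x y z w + block2 a b x' y' z' w' = block2 a b (x + x') (y + y') (z + z') (w + w')"
  by (rule matrix_eq_block2I) (simp_all add: block2_nth)

lemma block2_scaleR: "c *\<^sub>R block2 a b x y z w = block2 a b (c * x) (c * y) (c * z) (c * w)"
  by (rule matrix_eq_block2I) (simp_all add: block2_nth scaleR_conv_of_real[where 'a = complex])

lemma adj_block2: "adj (block2 a b x y z w) = block2 a b x z y w"
  by (rule matrix_eq_block2I) (simp_all add: block2_nth)

lemma trace_block2: "trace (block2 a b x y z w) = of_real (x + w)"
proof -
  have "trace (block2 a b x y z w) = (\<Sum>i\<in>{a, b}. block2 a b x y z w $ i $ i)"
    unfolding trace_def by (rule sum.mono_neutral_right) (auto simp: block2_nth)
  then show ?thesis using ab by (simp add: block2_nth)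
qed

lemma block2_square_psd: "block2 a b (x\<^sup>2) (x * y) (x * y) (y\<^sup>2) \<in> psd"
proof -
  have "(mat 1 :: complex^'n^'n) \<in> psd"
    using spec_in_psd[of "\<lambda>_. 1" "mat 1"] by simp
  from psd_congruence[OF this, of "block2 a b x y 0 0"] show ?thesis
    by (simp add: adj_block2 block2_mult power2_eq_square mult.commute)
qed

abbreviation corner where "corner \<equiv> block2 a b 1 0 0 0"

lemma corner_psd: "corner \<in> psd"
  using block2_square_psd[of 1 0] by simp

lemma mpow_corner: "0 \<le> k \<Longrightarrow> mpow (k *\<^sub>R corner) p = k powr p *\<^sub>R corner"
  using mpow_quadratic[OF corner_psd, of 1] by (simp add: mpow_scaleR corner_psd block2_mult)

lemma corner_compress:
  assumes "P \<in> psd"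
  shows "adj corner ** P ** corner = Re (P $ a $ a) *\<^sub>R corner"
proof -
  have "(adj corner ** P) $ i $ j = (if i = a then P $ a $ j else 0)" for i j
  proof -
    have "(adj corner ** P) $ i $ j = (\<Sum>k\<in>{a}. adj corner $ i $ k * P $ k $ j)"
      unfolding matrix_matrix_mult_def vec_lambda_beta
      by (rule sum.mono_neutral_right) (auto simp: block2_def)
    then show ?thesis by (simp add: block2_def)
  qed
  moreover have "(Q ** corner) $ i $ j = (if j = a then Q $ i $ a else 0)" for Q :: "complex^'n^'n" and i j
  proof -
    have "(Q ** corner) $ i $ j = (\<Sum>k\<in>{a}. Q $ i $ k * corner $ k $ j)"
      unfolding matrix_matrix_mult_def vec_lambda_beta
      by (rule sum.mono_neutral_right) (auto simp: block2_def)
    then show ?thesis by (simp add: block2_def)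
  qed
  moreover have "P $ a $ a = of_real (Re (P $ a $ a))"
    using assms by (simp add: psd_def hermitian_def complex_eq_iff)
      (metis adj_nth cnj.sel(2) neg_equal_zero)
  ultimately show ?thesis
    unfolding block2_scaleR by (intro matrix_eq_block2I) (simp_all add: ab[symmetric])
qed

lemma psd_diag_nonneg: "P \<in> psd \<Longrightarrow> 0 \<le> Re (P $ a $ a)"
  using trace_psd_nonneg[OF psd_congruence, of P corner] by (simp add: corner_compress trace_scaleR trace_block2)

lemma Upsilon_corner:
  assumes "A \<in> psd"
  shows "Upsilon corner p q A = Re (mpow A p $ a $ a) powr (q / p)"
  using assms psd_diag_nonneg[OF mpow_in_psd[OF assms, of p]]
  by (simp add: Upsilon_def corner_compress mpow_in_psd mpow_corner trace_scaleR trace_block2)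

text \<open>The two ends are twice the projections onto (1, 1) and (1, -1), and their average is the
  identity of the block. Taking powers inflates the eigenvalue 2 but not the eigenvalue 1.\<close>

lemma Upsilon_corner_not_concave:
  assumes p: "2 < p" "0 < q" shows "\<not> concave_on psd (Upsilon corner p q)"
proof
  assume conc: "concave_on psd (Upsilon corner p q)"
  have psd: "block2 a b 1 1 1 1 \<in> psd" "block2 a b 1 (-1) (-1) 1 \<in> psd"
    using block2_square_psd[of 1 1] block2_square_psd[of 1 "-1"] by simp_all
  have mp: "mpow (block2 a b 1 1 1 1) p = 2 powr (p - 1) *\<^sub>R block2 a b 1 1 1 1"
    "mpow (block2 a b 1 (-1) (-1) 1) p = 2 powr (p - 1) *\<^sub>R block2 a b 1 (-1) (-1) 1"
    by (rule mpow_quadratic; simp add: psd block2_mult block2_scaleR)+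
  have mid: "(1/2) *\<^sub>R block2 a b 1 1 1 1 + (1/2) *\<^sub>R block2 a b 1 (-1) (-1) 1 = block2 a b 1 0 0 1"
    by (simp add: block2_add block2_scaleR)
  have mid_psd: "block2 a b 1 0 0 1 \<in> psd"
    unfolding mid[symmetric] by (intro psd_add psd_scaleR psd) auto
  have mid_p: "mpow (block2 a b 1 0 0 1) p = block2 a b 1 0 0 1"
    using mpow_quadratic[OF mid_psd, of 1] by (simp add: block2_mult)
  have "(1/2) * Upsilon corner p q (block2 a b 1 1 1 1) + (1/2) * Upsilon corner p q (block2 a b 1 (-1) (-1) 1)
      \<le> Upsilon corner p q ((1/2) *\<^sub>R block2 a b 1 1 1 1 + (1/2) *\<^sub>R block2 a b 1 (-1) (-1) 1)"
    using conc psd by (intro conc[unfolded concave_on_iff, THEN conjunct2, rule_format]) auto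
  then have "(2 powr (p - 1)) powr (q / p) \<le> 1"
    by (simp add: Upsilon_corner psd mid mid_psd mid_p mp block2_nth)
  moreover have "1 < (2 powr (p - 1)) powr (q / p)"
    using p by (simp add: powr_powr)
  ultimately show False by simp
qed

text \<open>Since 5 = (3 * 6 + 2) / 4, this is strict convexity of x^(p-1) between 2 and 6,
  multiplied out. The numbers are the nonzero eigenvalues of the matrices \<open>A\<close> (5) and
  \<open>M\<close> (6 and 2) in the next lemma; at p = 2 there would be equality.\<close>

lemma powr_5_less:
  assumes "2 < (p::real)" shows "4 * 5 powr (p - 1) < (6 powr p + 2 powr p) / 2"
proof -
  define s where "s = p - 1"
  have s: "1 < s" using assms by (simp add: s_def)
  have "\<exists>x. 5 < x \<and> x < 6 \<and> 6 powr s - 5 powr s = (6 - 5) * (s * x powr (s - 1))"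
    by (rule MVT2) (auto intro!: has_real_derivative_powr)
  then obtain x where x: "5 < x" "6 powr s - 5 powr s = s * x powr (s - 1)"
    by auto
  have "\<exists>y. 2 < y \<and> y < 5 \<and> 5 powr s - 2 powr s = (5 - 2) * (s * y powr (s - 1))"
    by (rule MVT2) (auto intro!: has_real_derivative_powr)
  then obtain y where y: "2 < y" "y < 5" "5 powr s - 2 powr s = 3 * (s * y powr (s - 1))"
    by auto
  have "y powr (s - 1) < x powr (s - 1)"
    using x y s by (intro powr_less_mono2) auto
  then have "3 * (s * y powr (s - 1)) < 3 * (s * x powr (s - 1))"
    using s by simp
  define c6 c5 c2 where "c6 = 6 powr s" and "c5 = 5 powr s" and "c2 = 2 powr s"
  have "c5 - c2 < 3 * (c6 - c5)"
    unfolding c6_def c5_def c2_def x(2) y(3) by fact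
  then have "4 * c5 < (6 * c6 + 2 * c2) / 2"
    by (simp add: field_simps)
  moreover have "6 powr p = 6 * c6" "2 powr p = 2 * c2"
    using powr_add[of 6 1 s] powr_add[of 2 1 s] by (simp_all add: s_def c6_def c2_def)
  moreover have "5 powr (p - 1) = c5"
    by (simp add: c5_def s_def)
  ultimately show ?thesis
    by (simp only:)
qed

text \<open>With \<open>M = A + C\<close>, where \<open>A\<close> has rank one and \<open>C\<close> does not see the first basis vector, the
  first diagonal entry of \<open>M\<^sup>p\<close> exceeds that of \<open>A\<^sup>p\<close> if \<open>p > 2\<close>.\<close>

lemma compressed_power_not_convex:
  assumes p: "2 < p" and r: "0 < r"
  obtains N1 N2 :: "complex^'n^'n" and t :: real where "N1 \<in> psd" "N2 \<in> psd" "0 < t" "t < 1"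
    "t * Re (mpow N1 p $ a $ a) powr r < Re (mpow (t *\<^sub>R N1 + (1 - t) *\<^sub>R N2) p $ a $ a) powr r"
    "mpow N2 p $ a $ a = 0"
proof -
  \<comment> \<open>\<open>A\<close> is the rank-one matrix of the vector (2, 1), and
    \<open>C\<close> raises the second diagonal entry so that \<open>M\<close> has eigenvectors (1,
    1) and (1, -1) with eigenvalues 6 and 2.\<close>
  define A C M where "A = block2 a b 4 2 2 1" and "C = block2 a b 0 0 0 3" and "M = block2 a b 4 2 2 4"
  have MAC: "M = A + C"
    by (simp add: M_def A_def C_def block2_add)
  have A: "A \<in> psd"
    using block2_square_psd[of 2 1] by (simp add: A_def)
  have C: "C \<in> psd"
    using block2_square_psd[of 0 "sqrt 3"] by (simp add: C_def)
  have M: "M \<in> psd"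
    unfolding MAC by (rule psd_add[OF A C])
  have Ap: "mpow A p = 5 powr (p - 1) *\<^sub>R A"
    using A by (rule mpow_quadratic) (simp_all add: A_def block2_mult block2_scaleR)
  have Cp: "mpow C p = 3 powr (p - 1) *\<^sub>R C"
    using C by (rule mpow_quadratic) (simp_all add: C_def block2_mult block2_scaleR)
  have Mp: "Re (mpow M p $ a $ a) = (6 powr p + 2 powr p) / 2"
  proof -
    \<comment> \<open>The polynomial \<open>al * x^2 + be * x\<close> interpolates
      \<open>x powr p\<close> at 6 and 2, the nonzero eigenvalues of \<open>M\<close>.\<close>
    define al be where "al = (6 powr p - 3 * 2 powr p) / 24" and "be = (2 powr p - 4 * al) / 2"
    have "fun_calc (\<lambda>x. 1 * (x * x * x) + - 8 * (x * x) + 12 * x) M = 0"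
      unfolding fun_calc_cubic[OF M] by (simp only: M_def block2_mult block2_scaleR block2_add)
        (simp add: block2_def vec_eq_iff)
    then have "mpow M p = fun_calc (\<lambda>x. 0 * (x * x * x) + al * (x * x) + be * x) M"
      unfolding mpow_def
    proof (rule fun_calc_eq_on_zeros[OF M])
      fix x :: real assume "1 * (x * x * x) + - 8 * (x * x) + 12 * x = 0"
      then have "x * ((x - 6) * (x - 2)) = 0" by (simp add: algebra_simps)
      then have "x = 0 \<or> x = 6 \<or> x = 2" by simp
      then show "x powr p = 0 * (x * x * x) + al * (x * x) + be * x"
        by (auto simp: al_def be_def field_simps)
    qed
    then have "mpow M p = al *\<^sub>R (M ** M) + be *\<^sub>R M"
      unfolding fun_calc_cubic[OF M] by simp
    then have "Re (mpow M p $ a $ a) = al * 20 + be * 4"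
      by (simp add: M_def block2_mult block2_nth)
    then show ?thesis
      by (simp add: al_def be_def field_simps)
  qed
  define al where "al = 4 * 5 powr (p - 1)"
  have al: "0 < al" "al < (6 powr p + 2 powr p) / 2"
    using powr_5_less[OF p] by (simp_all add: al_def)
  \<comment> \<open>The matrices A / t and C / (1 - t) mix to \<open>M\<close>. As t tends to 1 the
    scaling of \<open>A\<close> disappears, while \<open>C\<close> contributes 0 however large its
    factor is, so the strict inequality between \<open>A\<close> and \<open>M\<close> survives for
    every exponent \<open>r\<close>.\<close>
  have "((\<lambda>t. t * (t powr (- p) * al) powr r) \<longlongrightarrow> 1 * (1 powr (- p) * al) powr r) (at_left (1::real))"
    using al by (intro tendsto_intros) auto
  moreover have "1 * (1 powr (- p) * al) powr r < ((6 powr p + 2 powr p) / 2) powr r"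
    using al r by (simp add: powr_less_mono2)
  ultimately have "\<forall>\<^sub>F t in at_left 1. t * (t powr (- p) * al) powr r < ((6 powr p + 2 powr p) / 2) powr r"
    by (rule order_tendstoD)
  moreover have "\<forall>\<^sub>F t in at_left 1. 0 < t \<and> t < (1::real)"
    using eventually_at_left_real[of 0 1] by (simp add: eventually_mono)
  ultimately have "\<forall>\<^sub>F t in at_left 1. 0 < t \<and> t < 1
      \<and> t * (t powr (- p) * al) powr r < ((6 powr p + 2 powr p) / 2) powr r"
    by eventually_elim simp
  then obtain t where t: "0 < t" "t < 1" "t * (t powr (- p) * al) powr r < ((6 powr p + 2 powr p) / 2) powr r"
    using eventually_happens'[OF trivial_limit_at_left_real] by blast
  show thesis
  proof (rule that[of "(1 / t) *\<^sub>R A" "(1 / (1 - t)) *\<^sub>R C" t])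
    show "(1 / t) *\<^sub>R A \<in> psd" "(1 / (1 - t)) *\<^sub>R C \<in> psd"
      using A C t by (simp_all add: psd_scaleR)
    have "Re (mpow A p $ a $ a) = al"
      by (simp add: Ap) (simp add: A_def block2_nth al_def)
    moreover have "mpow ((1 / t) *\<^sub>R A) p = t powr (- p) *\<^sub>R mpow A p"
      using A t by (simp add: mpow_scaleR powr_divide powr_minus_divide)
    moreover have mix: "t *\<^sub>R ((1 / t) *\<^sub>R A) + (1 - t) *\<^sub>R ((1 / (1 - t)) *\<^sub>R C) = M"
      using t MAC by simp
    ultimately have "Re (mpow ((1 / t) *\<^sub>R A) p $ a $ a) = t powr (- p) * al"
      by simp
    then show "t * Re (mpow ((1 / t) *\<^sub>R A) p $ a $ a) powr r
        < Re (mpow (t *\<^sub>R ((1 / t) *\<^sub>R A) + (1 - t) *\<^sub>R ((1 / (1 - t)) *\<^sub>R C)) p $ a $ a) powr r"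
      using t(3) unfolding mix Mp by (simp only:)
    show "mpow ((1 / (1 - t)) *\<^sub>R C) p $ a $ a = 0"
      using C t by (simp add: mpow_scaleR Cp) (simp add: C_def block2_nth)
  qed (use t in auto)
qed

lemma Upsilon_corner_not_convex:
  assumes p: "2 < p" "0 < q" shows "\<not> convex_on psd (Upsilon corner p q)"
proof
  assume conv: "convex_on psd (Upsilon corner p q)"
  have qp: "0 < q / p"
    using p by simp
  obtain N1 N2 :: "complex^'n^'n" and t :: real where N: "N1 \<in> psd" "N2 \<in> psd" and t: "0 < t" "t < 1"
    and less: "t * Re (mpow N1 p $ a $ a) powr (q / p)
      < Re (mpow (t *\<^sub>R N1 + (1 - t) *\<^sub>R N2) p $ a $ a) powr (q / p)"
    and zero: "mpow N2 p $ a $ a = 0"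
    using that by (rule compressed_power_not_convex[OF p(1) qp])
  have "Upsilon corner p q (t *\<^sub>R N1 + (1 - t) *\<^sub>R N2) \<le> t * Upsilon corner p q N1 + (1 - t) * Upsilon corner p q N2"
    using N t by (intro conv[unfolded convex_on_def, THEN conjunct2, rule_format]) auto
  moreover have "t *\<^sub>R N1 + (1 - t) *\<^sub>R N2 \<in> psd"
    using N t by (intro psd_add psd_scaleR) auto
  ultimately show False
    using less zero by (simp add: Upsilon_corner N)
qed

end

section \<open>First-order expansion of traces of powers\<close>

text \<open>Taylor's theorem gives the bound only away from 0, where derivatives of y^r may be
  singular. For y < z / 2 the remainder is merely bounded, but there (y - z)^2 is at least z^2 / 4,
  so a larger constant suffices.\<close>

lemma powr_quadratic_remainder:
  fixes z R r :: real
  assumes z: "0 < z" and r: "0 \<le> r"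
  obtains c where "0 \<le> c" "\<And>y. 0 \<le> y \<Longrightarrow> y \<le> R \<Longrightarrow>
    \<bar>y powr r - z powr r - r * z powr (r - 1) * (y - z)\<bar> \<le> c * (y - z)\<^sup>2"
proof -
  define rem where "rem y = y powr r - z powr r - r * z powr (r - 1) * (y - z)" for y
  define d where "d m y = (if m = 0 then y powr r else if m = 1 then r * y powr (r - 1)
      else r * (r - 1) * y powr (r - 2))" for m :: nat and y :: real
  define I where "I = {z / 2..max R (2 * z)}"
  have "continuous_on I (d 2)"
    unfolding d_def I_def using z by (auto intro!: continuous_intros)
  then have "bounded (d 2 ` I)"
    unfolding I_def by (intro compact_imp_bounded compact_continuous_image compact_Icc)
  then obtain B where B: "\<And>y. y \<in> I \<Longrightarrow> \<bar>d 2 y\<bar> \<le> B"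
    by (auto simp: bounded_iff)
  have zI: "z \<in> I"
    using z by (simp add: I_def le_max_iff_disj)
  have near: "\<bar>rem y\<bar> \<le> B * (y - z)\<^sup>2" if y: "y \<in> I" for y
  proof (cases "y = z")
    case False
    have "\<exists>t. (if y < z then y < t \<and> t < z else z < t \<and> t < y)
        \<and> y powr r = (\<Sum>m<2. d m z / fact m * (y - z) ^ m) + d 2 t / fact 2 * (y - z) ^ 2"
    proof (rule Taylor[where a = "z / 2" and b = "max R (2 * z)"])
      show "d 0 = (\<lambda>y. y powr r)" by (simp add: d_def fun_eq_iff)
      show "\<forall>m t. m < 2 \<and> z / 2 \<le> t \<and> t \<le> max R (2 * z) \<longrightarrow> (d m has_real_derivative d (Suc m) t) (at t)"
      proof (intro allI impI, elim conjE)
        fix m :: nat and t assume m: "m < 2" and "z / 2 \<le> t"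
        then have t: "0 < t" using z by simp
        have "m = 0 \<or> m = 1" using m by auto
        then show "(d m has_real_derivative d (Suc m) t) (at t)"
        proof
          assume "m = 0"
          then show ?thesis
            using has_real_derivative_powr[OF t, of r] by (simp add: d_def[abs_def])
        next
          assume "m = 1"
          then show ?thesis
            using DERIV_cmult[OF has_real_derivative_powr[OF t, of "r - 1"], of r]
            by (simp add: d_def[abs_def] mult.assoc)
        qed
      qed
    qed (use z y False in \<open>auto simp: I_def\<close>)
    then obtain t where t: "if y < z then y < t \<and> t < z else z < t \<and> t < y"
      and eq: "y powr r = (\<Sum>m<2. d m z / fact m * (y - z) ^ m) + d 2 t / fact 2 * (y - z) ^ 2"
      by blast
    have "t \<in> I"
      using t y z by (auto simp: I_def split: if_splits)
    have "rem y = d 2 t / 2 * (y - z)\<^sup>2"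
      unfolding rem_def eq by (simp add: lessThan_nat_numeral lessThan_Suc numeral_2_eq_2 d_def)
    then have "\<bar>rem y\<bar> = \<bar>d 2 t\<bar> / 2 * (y - z)\<^sup>2"
      by (simp only: abs_mult abs_divide) simp
    also have "\<dots> \<le> B * (y - z)\<^sup>2"
      using B[OF \<open>t \<in> I\<close>] by (intro mult_right_mono) auto
    finally show ?thesis .
  qed (simp add: rem_def)
  define C where "C = \<bar>z powr r\<bar> + \<bar>(z / 2) powr r\<bar> + 1 + \<bar>r * z powr (r - 1)\<bar> * z"
  show thesis
  proof (rule that)
    have B0: "0 \<le> B"
      using order_trans[OF abs_ge_zero B[OF zI]] .
    have C0: "0 \<le> C"
      using z by (simp add: C_def)
    show "0 \<le> B + C * (4 / z\<^sup>2)"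
      using B0 C0 by simp
    fix y assume y: "0 \<le> y" "y \<le> R"
    show "\<bar>y powr r - z powr r - r * z powr (r - 1) * (y - z)\<bar> \<le> (B + C * (4 / z\<^sup>2)) * (y - z)\<^sup>2"
    proof (cases "z / 2 \<le> y")
      case True
      then have "\<bar>rem y\<bar> \<le> B * (y - z)\<^sup>2"
        using y z by (intro near) (auto simp: I_def)
      also have "\<dots> \<le> (B + C * (4 / z\<^sup>2)) * (y - z)\<^sup>2"
        using C0 by (intro mult_right_mono) auto
      finally show ?thesis by (simp add: rem_def)
    next
      case False
      have "y powr r \<le> (z / 2) powr r"
        using False y r by (intro powr_mono2) auto
      moreover have "\<bar>r * z powr (r - 1) * (y - z)\<bar> \<le> \<bar>r * z powr (r - 1)\<bar> * z"
        unfolding abs_mult[of _ "y - z"] using False y by (intro mult_left_mono) auto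
      ultimately have "\<bar>rem y\<bar> \<le> C"
        unfolding rem_def C_def using powr_ge_zero[of y r] by linarith
      also have "\<dots> \<le> C * (4 / z\<^sup>2) * (y - z)\<^sup>2"
      proof -
        have "(z / 2)\<^sup>2 \<le> (z - y)\<^sup>2"
          using False z by (intro power_mono) auto
        then have "1 \<le> 4 / z\<^sup>2 * (y - z)\<^sup>2"
          using z by (simp add: field_simps power2_commute)
        then show ?thesis
          using mult_left_mono[OF _ C0] by fastforce
      qed
      also have "\<dots> \<le> (B + C * (4 / z\<^sup>2)) * (y - z)\<^sup>2"
        using B0 by (intro mult_right_mono) auto
      finally show ?thesis by (simp add: rem_def)
    qed
  qed
qed


lemma has_real_derivative_quadratic_remainder:
  fixes T :: "real \<Rightarrow> real"
  assumes "\<And>s. 0 \<le> s \<Longrightarrow> s \<le> 1 \<Longrightarrow> \<bar>T s - T 0 - s * L\<bar> \<le> C * s\<^sup>2"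
  shows "(T has_real_derivative L) (at 0 within {0..1})"
proof -
  have "((\<lambda>s. (T s - T 0) / s - L) \<longlongrightarrow> 0) (at 0 within {0..1})"
  proof (rule Lim_null_comparison)
    show "\<forall>\<^sub>F s in at 0 within {0..1}. norm ((T s - T 0) / s - L) \<le> C * s"
      unfolding eventually_at_filter
    proof (intro always_eventually allI impI)
      fix s :: real assume "s \<noteq> 0" "s \<in> {0..1}"
      then have s: "0 < s" "s \<le> 1" by auto
      have "norm ((T s - T 0) / s - L) = \<bar>T s - T 0 - s * L\<bar> / s"
        using s by (simp add: field_simps)
      also have "\<dots> \<le> C * s\<^sup>2 / s"
        using s assms[of s] by (intro divide_right_mono) auto
      finally show "norm ((T s - T 0) / s - L) \<le> C * s"
        using s by (simp add: power2_eq_square)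
    qed
    show "((\<lambda>s. C * s) \<longlongrightarrow> 0) (at 0 within {0..1})"
      by (auto intro!: tendsto_eq_intros)
  qed
  then show ?thesis
    unfolding has_field_derivative_iff by (simp add: LIM_zero_iff)
qed

text \<open>Noncommutativity does not affect the first order of the trace. The scalar Taylor bound
  is summed with the nonnegative weights given by the two eigenbases, and the error becomes a
  multiple of the trace of (Y - Z)^2, with Z the diagonal matrix; this is s^2 times the trace of
  K^2.\<close>

lemma trace_powr_derivative:
  fixes K :: "complex^'n^'n" and z :: "'n \<Rightarrow> real"
  assumes z: "\<And>i. 0 < z i" and K: "K \<in> psd" and r: "0 \<le> r"
  shows "((\<lambda>s. Re (trace (mpow (diag_real z + s *\<^sub>R K) r))) has_real_derivative
     r * (\<Sum>i\<in>UNIV. z i powr (r - 1) * Re (K $ i $ i))) (at 0 within {0..1})"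
proof -
  \<comment> \<open>The trace bounds every eigenvalue of the perturbed matrix, uniformly for s in
    the unit interval.\<close>
  define R where "R = (\<Sum>i\<in>UNIV. z i) + Re (trace K)"
  have "\<forall>i. \<exists>c. 0 \<le> c \<and> (\<forall>y. 0 \<le> y \<longrightarrow> y \<le> R \<longrightarrow>
      \<bar>y powr r - z i powr r - r * z i powr (r - 1) * (y - z i)\<bar> \<le> c * (y - z i)\<^sup>2)"
    by (intro allI, rule powr_quadratic_remainder[OF z r, where R = R]) blast
  then obtain c where c0: "\<And>i. 0 \<le> c i" and c: "\<And>i y. 0 \<le> y \<Longrightarrow> y \<le> R \<Longrightarrow>
      \<bar>y powr r - z i powr r - r * z i powr (r - 1) * (y - z i)\<bar> \<le> c i * (y - z i)\<^sup>2"
    by metis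
  define C where "C = (\<Sum>i\<in>UNIV. c i)"
  have Z: "diag_real z \<in> psd"
    using spec_in_psd[of z "mat 1"] z by (simp add: less_imp_le)
  have mpZ: "mpow (diag_real z) r = diag_real (\<lambda>i. z i powr r)"
    using fun_calc_spec[of "mat 1" "\<lambda>x. x powr r" z] by (simp add: mpow_def)
  define L where "L = r * (\<Sum>i\<in>UNIV. z i powr (r - 1) * Re (K $ i $ i))"
  show ?thesis
    unfolding L_def[symmetric]
  proof (rule has_real_derivative_quadratic_remainder)
    fix s :: real assume s: "0 \<le> s" "s \<le> 1"
    define Y where "Y = diag_real z + s *\<^sub>R K"
    have Y: "Y \<in> psd"
      unfolding Y_def by (intro psd_add psd_scaleR Z K s)
    obtain U y where U: "unitary U" and Yy: "Y = spec U y" and y: "\<And>i. 0 \<le> y i"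
      using psd_spec[OF Y] by metis
    have "y i \<le> R" for i
    proof -
      have "y i \<le> Re (trace Y)"
        using y U member_le_sum[of i UNIV y] by (simp add: Yy trace_spec)
      also have "\<dots> = (\<Sum>i\<in>UNIV. z i) + s * Re (trace K)"
        by (simp add: Y_def trace_add trace_scaleR trace_diag_real)
      also have "\<dots> \<le> R"
        using s trace_psd_nonneg[OF K] by (simp add: R_def mult_left_le_one_le)
      finally show ?thesis .
    qed
    define w where "w i j = (cmod ((adj U) $ i $ j))\<^sup>2" for i j
    have tr: "Re (trace (spec U f ** diag_real g)) = (\<Sum>i\<in>UNIV. \<Sum>j\<in>UNIV. f i * g j * w i j)" for f g
      using trace_sandwich[of "mat 1" U f "mat 1" g] by (simp add: w_def)
    have trY: "Re (trace (spec U f)) = (\<Sum>i\<in>UNIV. \<Sum>j\<in>UNIV. f i * w i j)" for f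
      using tr[of f "\<lambda>_. 1"] by simp
    have trZ: "Re (trace (diag_real g)) = (\<Sum>i\<in>UNIV. \<Sum>j\<in>UNIV. g j * w i j)" for g
      using tr[of "\<lambda>_. 1" g] U by simp
    define G where "G = diag_real (\<lambda>i. z i powr (r - 1))"
    have "Re (trace (mpow Y r)) - Re (trace (mpow (diag_real z) r))
        - r * (Re (trace (Y ** G)) - Re (trace (diag_real z ** G)))
      = (\<Sum>i\<in>UNIV. \<Sum>j\<in>UNIV. (y i powr r - z j powr r - r * z j powr (r - 1) * (y i - z j)) * w i j)"
      unfolding mpow_def Yy fun_calc_spec[OF U] mpZ[unfolded mpow_def] G_def tr diag_real_mult trY trZ
      by (simp only: sum_subtractf[symmetric] sum_distrib_left) (simp add: algebra_simps)
    moreover have "\<bar>\<Sum>i\<in>UNIV. \<Sum>j\<in>UNIV. (y i powr r - z j powr r - r * z j powr (r - 1) * (y i - z j)) * w i j\<bar>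
        \<le> (\<Sum>i\<in>UNIV. \<Sum>j\<in>UNIV. C * (y i - z j)\<^sup>2 * w i j)"
    proof (intro order_trans[OF sum_abs] sum_mono)
      fix i j
      have "c j \<le> C"
        unfolding C_def using c0 by (intro member_le_sum) auto
      then have "\<bar>y i powr r - z j powr r - r * z j powr (r - 1) * (y i - z j)\<bar> \<le> C * (y i - z j)\<^sup>2"
        using c[OF y \<open>y i \<le> R\<close>, of j] by (meson mult_right_mono order_trans zero_le_power2)
      then show "\<bar>(y i powr r - z j powr r - r * z j powr (r - 1) * (y i - z j)) * w i j\<bar> \<le> C * (y i - z j)\<^sup>2 * w i j"
        unfolding abs_mult by (simp add: w_def mult_right_mono)
    qed
    moreover have "(\<Sum>i\<in>UNIV. \<Sum>j\<in>UNIV. C * (y i - z j)\<^sup>2 * w i j)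
        = C * (Re (trace (Y ** Y)) - 2 * Re (trace (Y ** diag_real z)) + Re (trace (diag_real z ** diag_real z)))"
      unfolding Yy spec_mult[OF U] tr diag_real_mult trY trZ
      by (simp only: sum_distrib_left sum_subtractf[symmetric] sum.distrib[symmetric])
        (simp add: algebra_simps power2_eq_square)
    moreover have "Re (trace (Y ** Y)) - 2 * Re (trace (Y ** diag_real z)) + Re (trace (diag_real z ** diag_real z))
        = s\<^sup>2 * Re (trace (K ** K))"
      using trace_mult_comm[of "diag_real z" K]
      by (simp add: Y_def matrix_add_left matrix_add_right matrix_scaleR_left matrix_scaleR_right
          trace_add trace_scaleR power2_eq_square algebra_simps)
    moreover have "r * (Re (trace (Y ** G)) - Re (trace (diag_real z ** G))) = s * L"
    proof -
      have "Re (trace (K ** G)) = (\<Sum>i\<in>UNIV. z i powr (r - 1) * Re (K $ i $ i))"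
        by (simp add: G_def trace_def diag_mult_right mult.commute)
      then show ?thesis
        by (simp add: Y_def matrix_add_left matrix_scaleR_left trace_add trace_scaleR L_def)
    qed
    ultimately have "\<bar>Re (trace (mpow Y r)) - Re (trace (mpow (diag_real z) r)) - s * L\<bar>
        \<le> C * (s\<^sup>2 * Re (trace (K ** K)))"
      by simp
    then show "\<bar>Re (trace (mpow (diag_real z + s *\<^sub>R K) r)) - Re (trace (mpow (diag_real z + 0 *\<^sub>R K) r)) - s * L\<bar>
        \<le> (C * Re (trace (K ** K))) * s\<^sup>2"
      by (simp add: Y_def mult_ac)
  qed
qed

section \<open>Tuples with at most two nonzero entries\<close>

definition pair :: "'m \<Rightarrow> 'm \<Rightarrow> complex^'n^'n \<Rightarrow> complex^'n^'n \<Rightarrow> complex^'n^'n^'m" where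
  "pair j k X Y = (\<chi> i. if i = j then X else if i = k then Y else 0)"

lemma mpow_0: "mpow 0 p = 0"
  using mpow_scaleR[OF psd_0, of 0 p] by simp

lemma pair_psd: "X \<in> psd \<Longrightarrow> Y \<in> psd \<Longrightarrow> pair j k X Y \<in> psd_tuples"
  by (simp add: psd_tuples_def pair_def psd_0)

lemma pair_mix: "u *\<^sub>R pair j k X Y + v *\<^sub>R pair j k X' Y' = pair j k (u *\<^sub>R X + v *\<^sub>R X') (u *\<^sub>R Y + v *\<^sub>R Y')"
  by (simp add: pair_def vec_eq_iff)

lemma Phi_pair:
  assumes jk: "j \<noteq> k" and psd: "X \<in> psd" "Y \<in> psd" and "0 < p"
  shows "Phi p q (pair j k X Y) = Re (trace (mpow (mpow X p + mpow Y p) (q / p))) powr (1 / q)"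
proof -
  have "(\<Sum>i\<in>UNIV. mpow (pair j k X Y $ i) p) = (\<Sum>i\<in>{j, k}. mpow (pair j k X Y $ i) p)"
    by (rule sum.mono_neutral_right) (auto simp: pair_def mpow_0)
  also have "\<dots> = mpow X p + mpow Y p"
    using jk by (simp add: pair_def)
  finally show ?thesis
    using psd \<open>0 < p\<close> by (simp add: Phi_def schatten_mpow psd_add mpow_in_psd)
qed

text \<open>On multiples of a single projection \<open>Phi\<close> is the l^p norm of the two
  coefficients, whose value at the midpoint of the unit vectors is 2^(1/p - 1) < 1.\<close>

lemma Phi_not_concave:
  fixes j k :: "'m::finite" and a b :: "'n::finite"
  assumes jk: "j \<noteq> k" and ab: "a \<noteq> b" and p: "2 < p" "0 < q"
  shows "\<not> concave_on psd_tuples (Phi p q :: complex^'n^'n^'m \<Rightarrow> real)"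
proof
  assume conc: "concave_on psd_tuples (Phi p q :: complex^'n^'n^'m \<Rightarrow> real)"
  let ?corner = "corner a b"
  have Es: "c *\<^sub>R ?corner \<in> psd" if "0 \<le> c" for c
    using that corner_psd[OF ab] by (rule psd_scaleR[rotated])
  have val: "Phi p q (pair j k (c *\<^sub>R ?corner) (d *\<^sub>R ?corner)) = ((c powr p + d powr p) powr (q / p)) powr (1 / q)"
    if "0 \<le> c" "0 \<le> d" for c d
    using that p by (simp add: Phi_pair[OF jk] Es mpow_corner[OF ab] trace_scaleR trace_block2[OF ab]
        flip: scaleR_add_left)
  have "(1/2) * Phi p q (pair j k (1 *\<^sub>R ?corner) (0 *\<^sub>R ?corner)) + (1/2) * Phi p q (pair j k (0 *\<^sub>R ?corner) (1 *\<^sub>R ?corner))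
      \<le> Phi p q ((1/2) *\<^sub>R pair j k (1 *\<^sub>R ?corner) (0 *\<^sub>R ?corner) + (1/2) *\<^sub>R pair j k (0 *\<^sub>R ?corner) (1 *\<^sub>R ?corner))"
    by (intro conc[unfolded concave_on_iff, THEN conjunct2, rule_format] pair_psd Es) auto
  also have "(1/2) *\<^sub>R pair j k (1 *\<^sub>R ?corner) (0 *\<^sub>R ?corner) + (1/2) *\<^sub>R pair j k (0 *\<^sub>R ?corner) (1 *\<^sub>R ?corner)
      = pair j k ((1/2) *\<^sub>R ?corner) ((1/2) *\<^sub>R ?corner)"
    by (simp add: pair_mix)
  also have "Phi p q (pair j k (1 *\<^sub>R ?corner) (0 *\<^sub>R ?corner)) = 1"
    using p by (subst val) auto
  also have "Phi p q (pair j k (0 *\<^sub>R ?corner) (1 *\<^sub>R ?corner)) = 1"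
    using p by (subst val) auto
  also have "Phi p q (pair j k ((1/2) *\<^sub>R ?corner) ((1/2) *\<^sub>R ?corner)) = (2 * (1/2) powr p) powr (1 / p)"
    using p by (simp add: val powr_powr)
  finally have "1 \<le> (2 * (1/2) powr p) powr (1 / p)"
    by simp
  moreover have "2 * (1/2) powr p < 1"
    using p powr_less_mono[of 1 p 2] by (simp add: powr_divide)
  then have "(2 * (1/2) powr p) powr (1 / p) < 1"
    using p powr_less_mono2[of "1 / p" "2 * (1/2) powr p" 1] by simp
  ultimately show False by simp
qed

text \<open>To first order in \<open>u\<^sup>p\<close>, \<open>Phi\<close> at \<open>(X, u A)\<close> is an increasing affine function of \<open>Tr X\<^sup>q\<^sup>-\<^sup>p A\<^sup>p\<close>, and for
  \<open>q \<noteq> p\<close> the weight \<open>X\<^sup>q\<^sup>-\<^sup>p\<close> can be taken arbitrarily close to a rank-one projection.\<close>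

lemma Phi_not_convex:
  fixes j k :: "'m::finite" and a b :: "'n::finite"
  assumes jk: "j \<noteq> k" and ab: "a \<noteq> b" and p: "2 < p" "0 < q" "q \<noteq> p"
  shows "\<not> convex_on psd_tuples (Phi p q :: complex^'n^'n^'m \<Rightarrow> real)"
proof
  assume conv: "convex_on psd_tuples (Phi p q :: complex^'n^'n^'m \<Rightarrow> real)"
  define r where "r = q / p"
  have r: "0 < r" "r \<noteq> 1" using p by (auto simp: r_def)
  obtain N1 N2 :: "complex^'n^'n" and t :: real where N: "N1 \<in> psd" "N2 \<in> psd" and t: "0 < t" "t < 1"
    and less: "t * Re (mpow N1 p $ a $ a) powr 1
      < Re (mpow (t *\<^sub>R N1 + (1 - t) *\<^sub>R N2) p $ a $ a) powr 1"
    and zero: "mpow N2 p $ a $ a = 0"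
    using that by (rule compressed_power_not_convex[OF ab p(1) zero_less_one])
  define M where "M = t *\<^sub>R N1 + (1 - t) *\<^sub>R N2"
  have M: "M \<in> psd"
    unfolding M_def using N t by (intro psd_add psd_scaleR) auto
  define P where "P A i = Re (mpow A p $ i $ i)" for A :: "complex^'n^'n" and i
  have PM: "t * P N1 a + (1 - t) * P N2 a < P M a"
    using less zero psd_diag_nonneg[OF ab mpow_in_psd[OF N(1), of p]] psd_diag_nonneg[OF ab mpow_in_psd[OF M, of p]]
    by (simp add: P_def M_def)
  define gap where "gap i = P M i - (t * P N1 i + (1 - t) * P N2 i)" for i
  define S where "S = (\<Sum>i\<in>UNIV - {a}. \<bar>gap i\<bar>) + 1"
  have S: "0 < S"
    unfolding S_def by (intro add_nonneg_pos sum_nonneg) auto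
  have gap: "0 < gap a" using PM by (simp add: gap_def)
  \<comment> \<open>\<open>gap\<close> is positive at \<open>a\<close> but of unknown sign
    elsewhere. The weight \<open>e\<close> outside \<open>a\<close> keeps the contribution of the
    other indices to at most half of \<open>gap a\<close>.\<close>
  define e where "e = gap a / (2 * S)"
  have e: "0 < e" using gap S by (simp add: e_def)
  define w where "w i = (if i = a then 1 else e)" for i
  have w: "0 < w i" for i using e by (simp add: w_def)
  have pos: "0 < (\<Sum>i\<in>UNIV. w i * gap i)"
  proof -
    have "(\<Sum>i\<in>UNIV. w i * gap i) = gap a + e * (\<Sum>i\<in>UNIV - {a}. gap i)"
      by (simp add: sum.remove[of UNIV a] w_def sum_distrib_left)
    moreover have "\<bar>\<Sum>i\<in>UNIV - {a}. gap i\<bar> \<le> S"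
      unfolding S_def using sum_abs[of gap "UNIV - {a}"] by linarith
    then have "e * - (\<Sum>i\<in>UNIV - {a}. gap i) \<le> e * S"
      using e by (intro mult_left_mono) auto
    moreover have "e * S = gap a / 2"
      using S by (simp add: e_def)
    ultimately show ?thesis
      using gap by simp
  qed
  \<comment> \<open>Any positive weights have the form z^(r-1) because r \<noteq> 1, that is q
    \<noteq> p. For q = p all weights would be 1.\<close>
  define z where "z i = w i powr (1 / (r - 1))" for i
  have z: "0 < z i" for i using w[of i] by (simp add: z_def)
  have zw: "z i powr (r - 1) = w i" for i
    using r w[of i] by (simp add: z_def powr_powr)
  define X :: "complex^'n^'n" where "X = diag_real (\<lambda>i. z i powr (1 / p))"
  have X: "X \<in> psd"
    using spec_in_psd[of "\<lambda>i. z i powr (1 / p)" "mat 1"] by (simp add: X_def)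
  have Xp: "mpow X p = diag_real z"
    using fun_calc_spec[of "mat 1" "\<lambda>x. x powr p" "\<lambda>i. z i powr (1 / p)"] p
    by (simp add: X_def mpow_def powr_powr abs_of_pos[OF z])
  define h where "h A s = Re (trace (mpow (diag_real z + s *\<^sub>R mpow A p) r)) powr (1 / q)" for A s
  define T0 where "T0 = (\<Sum>i\<in>UNIV. z i powr r)"
  have T0: "Re (trace (mpow (diag_real z + 0 *\<^sub>R K) r)) = T0" for K
    using fun_calc_spec[of "mat 1" "\<lambda>x. x powr r" z] by (simp add: mpow_def T0_def trace_diag_real)
  have T0pos: "0 < T0"
    unfolding T0_def using z by (intro sum_pos) (auto simp: less_imp_neq[symmetric])
  define c where "c = (1 / q) * T0 powr (1 / q - 1) * r"
  have c: "0 < c" using p r T0pos by (simp add: c_def)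
  have deriv: "(h A has_real_derivative c * (\<Sum>i\<in>UNIV. w i * P A i)) (at 0 within {0..1})" if "A \<in> psd" for A
  proof -
    have inner: "((\<lambda>s. Re (trace (mpow (diag_real z + s *\<^sub>R mpow A p) r))) has_real_derivative
        r * (\<Sum>i\<in>UNIV. w i * P A i)) (at 0 within {0..1})"
      using trace_powr_derivative[OF z mpow_in_psd[OF that] less_imp_le[OF r(1)]]
      by (simp add: zw P_def)
    have "((\<lambda>x. x powr (1 / q)) has_real_derivative (1 / q) * T0 powr (1 / q - 1))
        (at (Re (trace (mpow (diag_real z + 0 *\<^sub>R mpow A p) r))))"
      unfolding T0 using T0pos by (rule has_real_derivative_powr)
    from DERIV_chain2[OF this inner] show ?thesis
      unfolding h_def[abs_def] c_def mult.assoc .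
  qed
  \<comment> \<open>\<open>D\<close> is the convexity defect along tuples whose second entry shrinks
    to 0. It vanishes at 0 and convexity would keep it nonnegative, yet its derivative there is
    negative.\<close>
  define D where "D s = t * h N1 s + (1 - t) * h N2 s - h M s" for s
  have "(D has_real_derivative t * (c * (\<Sum>i\<in>UNIV. w i * P N1 i)) + (1 - t) * (c * (\<Sum>i\<in>UNIV. w i * P N2 i))
      - c * (\<Sum>i\<in>UNIV. w i * P M i)) (at 0 within {0..1})"
    unfolding D_def[abs_def] by (intro DERIV_diff DERIV_add DERIV_cmult deriv N M)
  also have "t * (c * (\<Sum>i\<in>UNIV. w i * P N1 i)) + (1 - t) * (c * (\<Sum>i\<in>UNIV. w i * P N2 i))
      - c * (\<Sum>i\<in>UNIV. w i * P M i) = - (c * (\<Sum>i\<in>UNIV. w i * gap i))"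
    unfolding gap_def right_diff_distrib sum_subtractf distrib_left sum.distrib
    by (simp add: sum_distrib_left mult_ac)
  finally have "(D has_real_derivative - (c * (\<Sum>i\<in>UNIV. w i * gap i))) (at 0 within {0..1})" .
  from has_real_derivative_neg_dec_right[OF this] obtain d where d: "0 < d" "\<And>s. 0 < s \<Longrightarrow> 0 + s \<in> {0..1} \<Longrightarrow> s < d \<Longrightarrow> D 0 > D (0 + s)"
    using mult_pos_pos[OF c pos] by auto
  define s where "s = min 1 (d / 2)"
  have s: "0 < s" "s \<le> 1" "s < d" using d(1) by (auto simp: s_def)
  have "D s < D 0" using d(2)[of s] s by simp
  moreover have "D 0 = 0"
    unfolding D_def h_def T0 by (simp add: algebra_simps)
  moreover have "0 \<le> D s"
  proof -
    define u where "u = s powr (1 / p)"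
    have u: "0 \<le> u" "u powr p = s"
      using s p by (simp_all add: u_def powr_powr)
    have val: "Phi p q (pair j k X (u *\<^sub>R A)) = h A s" if "A \<in> psd" for A
      using that u p by (simp add: Phi_pair[OF jk] X psd_scaleR mpow_scaleR Xp h_def r_def)
    have "Phi p q (t *\<^sub>R pair j k X (u *\<^sub>R N1) + (1 - t) *\<^sub>R pair j k X (u *\<^sub>R N2))
        \<le> t * Phi p q (pair j k X (u *\<^sub>R N1)) + (1 - t) * Phi p q (pair j k X (u *\<^sub>R N2))"
      using t by (intro conv[unfolded convex_on_def, THEN conjunct2, rule_format] pair_psd X psd_scaleR N u) auto
    also have "t *\<^sub>R pair j k X (u *\<^sub>R N1) + (1 - t) *\<^sub>R pair j k X (u *\<^sub>R N2) = pair j k X (u *\<^sub>R M)"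
      by (simp add: pair_mix M_def scaleR_add_right mult.commute flip: scaleR_add_left)
    finally show ?thesis
      by (simp add: val N M D_def)
  qed
  ultimately show False by simp
qed

section \<open>Block diagonal matrices and the failure for \<open>Psi\<close>\<close>

text \<open>The tuple index becomes the second tensor factor, so that the partial trace sums the
  blocks.\<close>

definition direct_sum :: "complex^'m^'m^'n \<Rightarrow> complex^('m::finite \<times> 'n::finite)^('m \<times> 'n)" where
  "direct_sum A = (\<chi> x y. if snd x = snd y then A $ snd x $ fst x $ fst y else 0)"

lemma direct_sum_mult: "direct_sum A ** direct_sum B = direct_sum (\<chi> k. A $ k ** B $ k)"
proof -
  have "(direct_sum A ** direct_sum B) $ (i, k) $ (j, l) = direct_sum (\<chi> k. A $ k ** B $ k) $ (i, k) $ (j, l)"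
    for i k j l
  proof -
    have "(direct_sum A ** direct_sum B) $ (i, k) $ (j, l)
        = (\<Sum>x\<in>UNIV. \<Sum>y\<in>UNIV. direct_sum A $ (i, k) $ (x, y) * direct_sum B $ (x, y) $ (j, l))"
      unfolding matrix_matrix_mult_def vec_lambda_beta
      by (simp add: UNIV_Times_UNIV[symmetric] sum.cartesian_product del: UNIV_Times_UNIV)
    also have "\<dots> = (\<Sum>x\<in>UNIV. \<Sum>y\<in>UNIV. if y = k then if k = l then A $ k $ i $ x * B $ k $ x $ j else 0 else 0)"
      by (intro sum.cong refl) (auto simp: direct_sum_def)
    finally show ?thesis
      by (simp add: direct_sum_def matrix_matrix_mult_def)
  qed
  then show ?thesis by (simp add: vec_eq_iff)
qed

lemma adj_direct_sum: "adj (direct_sum A) = direct_sum (\<chi> k. adj (A $ k))"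
  by (simp add: vec_eq_iff direct_sum_def)

lemma direct_sum_diag_real:
  "direct_sum (\<chi> k. diag_real (d k)) = diag_real (\<lambda>x. d (snd x) (fst x))"
  by (auto simp: vec_eq_iff direct_sum_def diag_real_def)

lemma direct_sum_mat_1: "direct_sum (\<chi> k. mat 1) = mat 1"
  using direct_sum_diag_real[of "\<lambda>_ _. 1"] by simp

lemma direct_sum_spec:
  assumes "\<And>k. unitary (U k)"
  shows "unitary (direct_sum (\<chi> k. U k))"
    "direct_sum (\<chi> k. spec (U k) (d k)) = spec (direct_sum (\<chi> k. U k)) (\<lambda>x. d (snd x) (fst x))"
  using assms
  by (simp_all add: unitary_def adj_direct_sum direct_sum_mult direct_sum_mat_1 spec_def
      flip: direct_sum_diag_real)

lemma psd_tuples_spec: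
  assumes "A \<in> psd_tuples"
  obtains U d where "\<And>k. unitary (U k)" "A = (\<chi> k. spec (U k) (d k))" "\<And>k i. 0 \<le> d k i"
proof -
  have "\<forall>k. \<exists>U d. unitary U \<and> A $ k = spec U d \<and> (\<forall>i. 0 \<le> d i)"
    using assms unfolding psd_tuples_def by (metis (mono_tags, lifting) mem_Collect_eq psd_spec)
  then obtain U d where "\<And>k. unitary (U k) \<and> A $ k = spec (U k) (d k) \<and> (\<forall>i. 0 \<le> d k i)"
    by metis
  then show thesis
    by (intro that[of U d]) (simp_all add: vec_eq_iff)
qed

lemma direct_sum_psd: "A \<in> psd_tuples \<Longrightarrow> direct_sum A \<in> psd"
  by (erule psd_tuples_spec) (simp add: direct_sum_spec spec_in_psd)

lemma mpow_direct_sum: "A \<in> psd_tuples \<Longrightarrow> mpow (direct_sum A) p = direct_sum (\<chi> k. mpow (A $ k) p)"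
  by (erule psd_tuples_spec) (simp add: direct_sum_spec mpow_def fun_calc_spec)

lemma Psi_direct_sum: "A \<in> psd_tuples \<Longrightarrow> Psi p q (direct_sum A) = Phi p q A"
proof -
  assume "A \<in> psd_tuples"
  moreover have "ptrace2 (direct_sum B) = (\<Sum>k\<in>UNIV. B $ k)" for B :: "complex^'a^'a^'b"
    by (simp add: ptrace2_eq direct_sum_def vec_eq_iff)
  ultimately show ?thesis
    by (simp add: Psi_def Phi_def mpow_direct_sum)
qed

lemma direct_sum_mix: "direct_sum (u *\<^sub>R A + v *\<^sub>R B) = u *\<^sub>R direct_sum A + v *\<^sub>R direct_sum B"
  by (simp add: direct_sum_def vec_eq_iff)

lemma Phi_convex_if_Psi_convex:
  assumes "convex_on psd (Psi p q :: complex^('m::finite \<times> 'n::finite)^('m \<times> 'n) \<Rightarrow> real)"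
  shows "convex_on psd_tuples (Phi p q :: complex^'m^'m^'n \<Rightarrow> real)"
  unfolding convex_on_def
proof (intro conjI convex_psd_tuples ballI allI impI)
  fix A B :: "complex^'m^'m^'n" and u v :: real
  assume *: "A \<in> psd_tuples" "B \<in> psd_tuples" "0 \<le> u" "0 \<le> v" "u + v = 1"
  then have "u *\<^sub>R A + v *\<^sub>R B \<in> psd_tuples"
    by (intro convexD[OF convex_psd_tuples])
  moreover have "Psi p q (u *\<^sub>R direct_sum A + v *\<^sub>R direct_sum B) \<le> u * Psi p q (direct_sum A) + v * Psi p q (direct_sum B)"
    using * by (intro assms[unfolded convex_on_def, THEN conjunct2, rule_format] direct_sum_psd)
  ultimately show "Phi p q (u *\<^sub>R A + v *\<^sub>R B) \<le> u * Phi p q A + v * Phi p q B"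
    using * by (simp add: Psi_direct_sum flip: direct_sum_mix)
qed

lemma Phi_concave_if_Psi_concave:
  assumes "concave_on psd (Psi p q :: complex^('m::finite \<times> 'n::finite)^('m \<times> 'n) \<Rightarrow> real)"
  shows "concave_on psd_tuples (Phi p q :: complex^'m^'m^'n \<Rightarrow> real)"
  unfolding concave_on_iff
proof (intro conjI convex_psd_tuples ballI allI impI)
  fix A B :: "complex^'m^'m^'n" and u v :: real
  assume *: "A \<in> psd_tuples" "B \<in> psd_tuples" "0 \<le> u" "0 \<le> v" "u + v = 1"
  then have "u *\<^sub>R A + v *\<^sub>R B \<in> psd_tuples"
    by (intro convexD[OF convex_psd_tuples])
  moreover have "u * Psi p q (direct_sum A) + v * Psi p q (direct_sum B) \<le> Psi p q (u *\<^sub>R direct_sum A + v *\<^sub>R direct_sum B)"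
    using * by (intro assms[unfolded concave_on_iff, THEN conjunct2, rule_format] direct_sum_psd)
  ultimately show "u * Phi p q A + v * Phi p q B \<le> Phi p q (u *\<^sub>R A + v *\<^sub>R B)"
    using * by (simp add: Psi_direct_sum flip: direct_sum_mix)
qed

lemma exists_distinct: "2 \<le> CARD('a) \<Longrightarrow> \<exists>a b::'a::finite. a \<noteq> b"
  using card_le_Suc0_iff_eq[of "UNIV :: 'a set"] by fastforce

text \<open>The dimension bounds exclude true exceptions: for n = 1 \<open>Upsilon\<close> is a
  multiple of a^q and \<open>Phi\<close> is an l^p norm, while for m = 1 \<open>Psi\<close> is a
  Schatten p-norm. The matrix \<open>B\<close> has to be chosen, since \<open>Upsilon\<close> is
  constant for B = 0.\<close>

theorem theorem1p1:
  shows
    "(\<forall>p q::real. 1 \<le> p \<and> p \<le> 2 \<and> 1 \<le> q \<longrightarrow>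
        (\<forall>B::complex^'n^'n. convex_on psd (Upsilon B p q)) \<and>
        convex_on psd (Psi p q :: complex^('m \<times> 'n)^('m \<times> 'n) \<Rightarrow> real) \<and>
        convex_on psd_tuples (Phi p q :: complex^'n^'n^'m \<Rightarrow> real))
   \<and> (\<forall>p q::real. 0 < p \<and> p \<le> q \<and> q \<le> 1 \<longrightarrow>
        (\<forall>B::complex^'n^'n. concave_on psd (Upsilon B p q)) \<and>
        concave_on psd (Psi p q :: complex^('m \<times> 'n)^('m \<times> 'n) \<Rightarrow> real) \<and>
        concave_on psd_tuples (Phi p q :: complex^'n^'n^'m \<Rightarrow> real))
   \<and> (\<forall>p q::real. 2 < p \<and> 0 < q \<and> q \<noteq> p \<longrightarrow>
        (2 \<le> CARD('n) \<longrightarrow>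
          (\<exists>B::complex^'n^'n. \<not> convex_on psd (Upsilon B p q) \<and>
                              \<not> concave_on psd (Upsilon B p q))) \<and>
        (2 \<le> CARD('m) \<and> 2 \<le> CARD('n) \<longrightarrow>
          \<not> convex_on psd (Psi p q :: complex^('m \<times> 'n)^('m \<times> 'n) \<Rightarrow> real) \<and>
          \<not> concave_on psd (Psi p q :: complex^('m \<times> 'n)^('m \<times> 'n) \<Rightarrow> real) \<and>
          \<not> convex_on psd_tuples (Phi p q :: complex^'n^'n^'m \<Rightarrow> real) \<and>
          \<not> concave_on psd_tuples (Phi p q :: complex^'n^'n^'m \<Rightarrow> real)))"
proof (intro conjI allI impI)
  fix p q :: real assume pq: "1 \<le> p \<and> p \<le> 2 \<and> 1 \<le> q"
  show "convex_on psd (Upsilon B p q)" for B :: "complex^'n^'n"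
    using pq by (simp add: Upsilon_convex)
  show "convex_on psd (Psi p q :: complex^('m \<times> 'n)^('m \<times> 'n) \<Rightarrow> real)"
    using pq by (simp add: Psi_convex)
  show "convex_on psd_tuples (Phi p q :: complex^'n^'n^'m \<Rightarrow> real)"
    using pq by (simp add: Phi_convex)
next
  fix p q :: real assume pq: "0 < p \<and> p \<le> q \<and> q \<le> 1"
  show "concave_on psd (Upsilon B p q)" for B :: "complex^'n^'n"
    using pq by (simp add: Upsilon_concave)
  show "concave_on psd (Psi p q :: complex^('m \<times> 'n)^('m \<times> 'n) \<Rightarrow> real)"
    using pq by (simp add: Psi_concave)
  show "concave_on psd_tuples (Phi p q :: complex^'n^'n^'m \<Rightarrow> real)"
    using pq by (simp add: Phi_concave)
next
  fix p q :: real assume pq: "2 < p \<and> 0 < q \<and> q \<noteq> p"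
  assume "2 \<le> CARD('n)"
  then obtain a b :: 'n where "a \<noteq> b"
    using exists_distinct by blast
  then show "\<exists>B::complex^'n^'n. \<not> convex_on psd (Upsilon B p q) \<and> \<not> concave_on psd (Upsilon B p q)"
    using pq Upsilon_corner_not_convex Upsilon_corner_not_concave by blast
next
  fix p q :: real assume pq: "2 < p \<and> 0 < q \<and> q \<noteq> p"
  assume card: "2 \<le> CARD('m) \<and> 2 \<le> CARD('n)"
  \<comment> \<open>\<open>Psi\<close> contains \<open>Phi\<close> for n-tuples of m by m matrices,
    whereas the claims on \<open>Phi\<close> concern m-tuples of n by n matrices: the two types
    exchange their roles.\<close>
  then obtain a b :: 'm and c d :: 'n where "a \<noteq> b" "c \<noteq> d"
    using exists_distinct by metis
  with pq show "\<not> convex_on psd (Psi p q :: complex^('m \<times> 'n)^('m \<times> 'n) \<Rightarrow> real)"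
    "\<not> concave_on psd (Psi p q :: complex^('m \<times> 'n)^('m \<times> 'n) \<Rightarrow> real)"
    "\<not> convex_on psd_tuples (Phi p q :: complex^'n^'n^'m \<Rightarrow> real)"
    "\<not> concave_on psd_tuples (Phi p q :: complex^'n^'n^'m \<Rightarrow> real)"
    by (auto dest: Phi_convex_if_Psi_convex Phi_concave_if_Psi_concave
        simp: Phi_not_convex Phi_not_concave)
qed

end
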